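(* Suppose that $\mathbb{T}\times G^{(0)}\overset{\iota}{\to}E\overset{\pi}{\to}G$ is a topological twist over a Lie groupoid $G$, that $\{(U_\alpha,\varphi_\alpha)\}_{\alpha\in\mathfrak{A}}$ is a smooth atlas of $G$, and that $\{\sigma_\alpha:U_\alpha\to\pi^{-1}(U_\alpha)\}_{\alpha\in\mathfrak{A}}$ is a family of continuous sections of $\pi$ that satisfies conditions (S$^\infty$), (U$^\infty$) and (M$^\infty$). Give $E$ the unique smooth structure with respect to which $\pi:E\to G$ is a smooth principal $\mathbb{T}$-bundle and all the $\sigma_\alpha$ are smooth. Then $E$ is a Lie groupoid and $\mathbb{T}\times G^{(0)}\overset{\iota}{\to}E\overset{\pi}{\to}G$ is a Lie twist.
   Context: "Manifold" means smooth manifold (Hausdorff, second-countable, with a maximal smooth atlas compatible with the given topology). A submersion is a smooth map with everywhere surjective differential. All groupoids are locally compact Hausdorff topological groupoids with unit space $G^{(0)}\subseteq G$, continuous surjective range and source maps $r,s:G\to G^{(0)}$, composable pairs $G^{(2)}=\{(\gamma,\eta):s(\gamma)=r(\eta)\}$, and continuous composition and inversion. For $U,V\subseteq G$ put $U*V=(U\times V)\cap G^{(2)}$. A Lie groupoid is a topological groupoid such that $G,G^{(0)}$ are manifolds, $G^{(0)}\hookrightarrow G$ is a smooth embedding, $r,s$ are submersions, and composition and inversion are smooth (where $G^{(2)}$ is an embedded submanifold of $G\times G$). A topological twist over $G$ consists of a locally compact Hausdorff groupoid $E$ and groupoid homomorphisms $\iota:\mathbb{T}\times G^{(0)}\to E$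 ($\mathbb{T}\times G^{(0)}$ the trivial group bundle) and $\pi:E\to G$ such that $\iota$ is a homeomorphism onto $\pi^{-1}(G^{(0)})$ with $\iota(1,\pi(y))=y$ for $y\in E^{(0)}$; $\pi$ is a continuous open surjection; and $\iota(z,\pi(r(e)))e=e\,\iota(z,\pi(s(e)))$ for all $e\in E$, $z\in\mathbb{T}$. $\mathbb{T}$ acts on $E$ by $z\cdot e=\iota(z,r(e))e$ (units of $E$ identified with units of $G$ via $\pi$). A Lie twist over a Lie groupoid $G$ is a topological twist in which $E$ is a Lie groupoid, $\pi:E\to G$ is a submersion, and $\iota:\mathbb{T}\times G^{(0)}\to E$ is smooth. That $\pi:E\to G$ is a smooth principal $\mathbb{T}$-bundle means $E,G$ are manifolds, $\pi$ and the $\mathbb{T}$-action are smooth, and $G$ has an open cover by sets $U$ with $\mathbb{T}$-equivariant diffeomorphisms $\pi^{-1}(U)\cong\mathbb{T}\times U$ over $U$. When (S$^\infty$) below holds for sections defined on the chart domains of an atlas of $G$, there is a unique smooth structure on the topological space $E$ for which $\pi$ is a smooth principal $\mathbb{T}$-bundle and all $\sigma_\alpha$ are smooth. Conditions: - (U$^\infty$): for each $\alpha$ there is a smooth $k_\alpha:U_\alpha\cap G^{(0)}\to\mathbb{T}$ with $\sigma_\alpha(x)=\iota(k_\alpha(x),x)$ for all $x\in U_\alpha\cap G^{(0)}$. - (S$^\infty$): for all $\alpha,\alpha'$, the map $U_\alpha\cap U_{\alpha'}\to\mathbb{T}\times G^{(0)}$, $\gamma\mapsto\iota^{-1}(\sigma_\alpha(\gamma)\sigma_{\alpha'}(\gamma)^{-1})$,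 is smooth. - (M$^\infty$): for all $\alpha,\alpha_1,\alpha_2$, the map $\{(\gamma_1,\gamma_2)\in U_{\alpha_1}*U_{\alpha_2}:\gamma_1\gamma_2\in U_\alpha\}\to\mathbb{T}\times G^{(0)}$, $(\gamma_1,\gamma_2)\mapsto\iota^{-1}(\sigma_{\alpha_1}(\gamma_1)\sigma_{\alpha_2}(\gamma_2)\sigma_\alpha(\gamma_1\gamma_2)^{-1})$, is smooth. *)

theory Defs
  imports "HOL-Analysis.Analysis"
begin

section \<open>Smooth functions on open subsets of Euclidean spaces\<close>

text \<open>
  The model spaces are the library spaces \<^term>\<open>Euclidean_space n\<close>, that is, the functions
  \<open>nat \<Rightarrow> real\<close> that vanish from index \<open>n\<close> on.  Their dimension is a term, which
  allows dimension 0 (a Lie group has a one-point unit space) and products and submanifolds whose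
  dimension is computed from other dimensions.
\<close>

definition partial_deriv :: "nat \<Rightarrow> ((nat \<Rightarrow> real) \<Rightarrow> real) \<Rightarrow> (nat \<Rightarrow> real) \<Rightarrow> real" where
  "partial_deriv i f x = deriv (\<lambda>t. f (x(i := t))) (x i)"

text \<open>\<open>Ck_on k n W f\<close>: all iterated partial derivatives of \<open>f\<close> of order at most
  \<open>k\<close> exist and are continuous on \<open>W\<close>.  Here and below, \<open>W\<close> is meant to be open
  in \<^term>\<open>Euclidean_space n\<close>.\<close>

primrec Ck_on :: "nat \<Rightarrow> nat \<Rightarrow> (nat \<Rightarrow> real) set \<Rightarrow> ((nat \<Rightarrow> real) \<Rightarrow> real) \<Rightarrow> bool" where
  "Ck_on 0 n W f \<longleftrightarrow> continuous_map (subtopology (Euclidean_space n) W) euclideanreal f"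
| "Ck_on (Suc k) n W f \<longleftrightarrow>
     continuous_map (subtopology (Euclidean_space n) W) euclideanreal f \<and>
     (\<forall>i<n. (\<forall>x\<in>W. (\<lambda>t. f (x(i := t))) differentiable at (x i)) \<and> Ck_on k n W (partial_deriv i f))"

definition smooth_between ::
    "nat \<Rightarrow> nat \<Rightarrow> (nat \<Rightarrow> real) set \<Rightarrow> ((nat \<Rightarrow> real) \<Rightarrow> (nat \<Rightarrow> real)) \<Rightarrow> bool" where
  "smooth_between m n W f \<longleftrightarrow>
     f ` W \<subseteq> topspace (Euclidean_space n) \<and> (\<forall>j<n. \<forall>k. Ck_on k m W (\<lambda>x. f x j))"

text \<open>The linear map \<open>\<real>\<^sup>m \<Rightarrow> \<real>\<^sup>n\<close> given by the Jacobian matrix of \<open>f\<close> at \<open>x\<close>.\<close>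

definition jacobian_map ::
    "nat \<Rightarrow> nat \<Rightarrow> ((nat \<Rightarrow> real) \<Rightarrow> (nat \<Rightarrow> real)) \<Rightarrow> (nat \<Rightarrow> real) \<Rightarrow> (nat \<Rightarrow> real) \<Rightarrow> (nat \<Rightarrow> real)" where
  "jacobian_map m n f x v =
     (\<lambda>j. if j < n then \<Sum>i<m. partial_deriv i (\<lambda>y. f y j) x * v i else 0)"


section \<open>Smooth manifolds\<close>

text \<open>A chart is a domain together with a coordinate map, of which only the values on the domain
  matter; a maximal atlas therefore contains all the extensions of each of its coordinate maps.\<close>

type_synonym 'a chart = "'a set \<times> ('a \<Rightarrow> nat \<Rightarrow> real)"

definition is_chart :: "nat \<Rightarrow> 'a topology \<Rightarrow> 'a chart \<Rightarrow> bool" where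
  "is_chart n X = (\<lambda>(U, \<phi>).
     openin X U \<and> openin (Euclidean_space n) (\<phi> ` U) \<and>
     homeomorphic_map (subtopology X U) (subtopology (Euclidean_space n) (\<phi> ` U)) \<phi>)"

definition compatible_charts :: "nat \<Rightarrow> 'a chart \<Rightarrow> 'a chart \<Rightarrow> bool" where
  "compatible_charts n = (\<lambda>(U, \<phi>) (V, \<psi>).
     smooth_between n n (\<phi> ` (U \<inter> V)) (\<psi> \<circ> inv_into U \<phi>) \<and>
     smooth_between n n (\<psi> ` (U \<inter> V)) (\<phi> \<circ> inv_into V \<psi>))"

definition smooth_atlas :: "nat \<Rightarrow> 'a topology \<Rightarrow> 'a chart set \<Rightarrow> bool" where
  "smooth_atlas n X A \<longleftrightarrow>
     (\<forall>c\<in>A. is_chart n X c) \<and> (\<Union>c\<in>A. fst c) = topspace X \<and>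
     (\<forall>c\<in>A. \<forall>d\<in>A. compatible_charts n c d)"

definition maximal_atlas :: "nat \<Rightarrow> 'a topology \<Rightarrow> 'a chart set \<Rightarrow> 'a chart set" where
  "maximal_atlas n X A = {c. is_chart n X c \<and> (\<forall>d\<in>A. compatible_charts n c d)}"

record 'a manifold =
  mtop :: "'a topology"
  mdim :: nat
  charts :: "'a chart set"

definition smooth_manifold :: "'a manifold \<Rightarrow> bool" where
  "smooth_manifold M \<longleftrightarrow>
     Hausdorff_space (mtop M) \<and> second_countable (mtop M) \<and>
     smooth_atlas (mdim M) (mtop M) (charts M) \<and>
     maximal_atlas (mdim M) (mtop M) (charts M) \<subseteq> charts M"

definition smooth_map :: "'a manifold \<Rightarrow> 'b manifold \<Rightarrow> ('a \<Rightarrow> 'b) \<Rightarrow> bool" where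
  "smooth_map M N f \<longleftrightarrow>
     continuous_map (mtop M) (mtop N) f \<and>
     (\<forall>(U, \<phi>)\<in>charts M. \<forall>(V, \<psi>)\<in>charts N.
        smooth_between (mdim M) (mdim N) (\<phi> ` (U \<inter> f -` V)) (\<psi> \<circ> f \<circ> inv_into U \<phi>))"

definition diffeomorphism :: "'a manifold \<Rightarrow> 'b manifold \<Rightarrow> ('a \<Rightarrow> 'b) \<Rightarrow> bool" where
  "diffeomorphism M N f \<longleftrightarrow>
     smooth_map M N f \<and>
     (\<exists>g. smooth_map N M g \<and>
          (\<forall>x\<in>topspace (mtop M). g (f x) = x) \<and> (\<forall>y\<in>topspace (mtop N). f (g y) = y))"

text \<open>The differential of \<open>f\<close> at \<open>p\<close>, read in a chart around \<open>p\<close> and a chart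
  around \<open>f p\<close>.\<close>

definition differential_in ::
    "'a manifold \<Rightarrow> 'b manifold \<Rightarrow> 'a chart \<Rightarrow> 'b chart \<Rightarrow> ('a \<Rightarrow> 'b) \<Rightarrow> 'a \<Rightarrow> (nat \<Rightarrow> real) \<Rightarrow> (nat \<Rightarrow> real)" where
  "differential_in M N c d f p =
     jacobian_map (mdim M) (mdim N) (snd d \<circ> f \<circ> inv_into (fst c) (snd c)) (snd c p)"

definition submersion :: "'a manifold \<Rightarrow> 'b manifold \<Rightarrow> ('a \<Rightarrow> 'b) \<Rightarrow> bool" where
  "submersion M N f \<longleftrightarrow>
     smooth_map M N f \<and>
     (\<forall>c\<in>charts M. \<forall>d\<in>charts N. \<forall>p \<in> fst c \<inter> f -` fst d.
        differential_in M N c d f p ` topspace (Euclidean_space (mdim M)) =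
          topspace (Euclidean_space (mdim N)))"

definition immersion :: "'a manifold \<Rightarrow> 'b manifold \<Rightarrow> ('a \<Rightarrow> 'b) \<Rightarrow> bool" where
  "immersion M N f \<longleftrightarrow>
     smooth_map M N f \<and>
     (\<forall>c\<in>charts M. \<forall>d\<in>charts N. \<forall>p \<in> fst c \<inter> f -` fst d.
        inj_on (differential_in M N c d f p) (topspace (Euclidean_space (mdim M))))"

definition smooth_embedding :: "'a manifold \<Rightarrow> 'b manifold \<Rightarrow> ('a \<Rightarrow> 'b) \<Rightarrow> bool" where
  "smooth_embedding M N f \<longleftrightarrow> immersion M N f \<and> embedding_map (mtop M) (mtop N) f"


subsection \<open>Constructions\<close>

definition open_submanifold :: "'a manifold \<Rightarrow> 'a set \<Rightarrow> 'a manifold" where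
  "open_submanifold M W =
     \<lparr>mtop = subtopology (mtop M) W, mdim = mdim M, charts = {c \<in> charts M. fst c \<subseteq> W}\<rparr>"

definition prod_chart :: "nat \<Rightarrow> 'a chart \<Rightarrow> 'b chart \<Rightarrow> ('a \<times> 'b) chart" where
  "prod_chart m = (\<lambda>(U, \<phi>) (V, \<psi>).
     (U \<times> V, \<lambda>(x, y) i. if i < m then \<phi> x i else \<psi> y (i - m)))"

definition prod_manifold :: "'a manifold \<Rightarrow> 'b manifold \<Rightarrow> ('a \<times> 'b) manifold" where
  "prod_manifold M N =
     (let X = prod_topology (mtop M) (mtop N); n = mdim M + mdim N
      in \<lparr>mtop = X, mdim = n,
          charts = maximal_atlas n X {prod_chart (mdim M) c d | c d. c \<in> charts M \<and> d \<in> charts N}\<rparr>)"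

text \<open>Slice charts: with the convention for \<^term>\<open>Euclidean_space k\<close> above,
  \<open>\<real>\<^sup>k\<close> is the set of points of \<open>\<real>\<^sup>n\<close> whose coordinates from index
  \<open>k\<close> on vanish.\<close>

definition slice_charts :: "'a manifold \<Rightarrow> nat \<Rightarrow> 'a set \<Rightarrow> 'a chart set" where
  "slice_charts M k S =
     {(U, \<phi>) \<in> charts M. \<phi> ` (U \<inter> S) = \<phi> ` U \<inter> topspace (Euclidean_space k)}"

definition embedded_submanifold :: "'a manifold \<Rightarrow> nat \<Rightarrow> 'a set \<Rightarrow> bool" where
  "embedded_submanifold M k S \<longleftrightarrow>
     S \<subseteq> topspace (mtop M) \<and> S \<subseteq> (\<Union>c \<in> slice_charts M k S. fst c)"

definition submanifold :: "'a manifold \<Rightarrow> nat \<Rightarrow> 'a set \<Rightarrow> 'a manifold" where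
  "submanifold M k S =
     (let X = subtopology (mtop M) S
      in \<lparr>mtop = X, mdim = k,
          charts = maximal_atlas k X ((\<lambda>(U, \<phi>). (U \<inter> S, \<phi>)) ` slice_charts M k S)\<rparr>)"

text \<open>Transport of the smooth structure of \<open>M\<close> along a homeomorphism from \<open>X\<close> onto
  the underlying space of \<open>M\<close>.\<close>

definition transported_manifold :: "'a topology \<Rightarrow> ('a \<Rightarrow> 'b) \<Rightarrow> 'b manifold \<Rightarrow> 'a manifold" where
  "transported_manifold X f M =
     \<lparr>mtop = X, mdim = mdim M,
      charts = maximal_atlas (mdim M) X ((\<lambda>(U, \<phi>). (topspace X \<inter> f -` U, \<phi> \<circ> f)) ` charts M)\<rparr>"

abbreviation circle :: "complex set" where
  "circle \<equiv> sphere 0 1"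

text \<open>The angle coordinate with values in the open interval \<open>(a, a + 2\<pi>)\<close>.\<close>

definition angle_chart :: "real \<Rightarrow> complex chart" where
  "angle_chart a =
     (circle - {cis a}, \<lambda>z i. if i = 0 then inv_into {a<..<a + 2 * pi} cis z else 0)"

definition circle_manifold :: "complex manifold" where
  "circle_manifold =
     \<lparr>mtop = top_of_set circle, mdim = 1,
      charts = maximal_atlas 1 (top_of_set circle) (range angle_chart)\<rparr>"


section \<open>Topological groupoids and Lie groupoids\<close>

record 'a groupoid =
  gtop :: "'a topology"
  units :: "'a set"
  rng :: "'a \<Rightarrow> 'a"
  src :: "'a \<Rightarrow> 'a"
  gmult :: "'a \<Rightarrow> 'a \<Rightarrow> 'a"
  ginv :: "'a \<Rightarrow> 'a"

abbreviation arrows :: "'a groupoid \<Rightarrow> 'a set" where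
  "arrows G \<equiv> topspace (gtop G)"

abbreviation unit_top :: "'a groupoid \<Rightarrow> 'a topology" where
  "unit_top G \<equiv> subtopology (gtop G) (units G)"

definition composable :: "'a groupoid \<Rightarrow> ('a \<times> 'a) set" where
  "composable G = {(g, h). g \<in> arrows G \<and> h \<in> arrows G \<and> src G g = rng G h}"

definition is_groupoid :: "'a groupoid \<Rightarrow> bool" where
  "is_groupoid G \<longleftrightarrow>
     units G \<subseteq> arrows G \<and>
     (\<forall>g \<in> arrows G. rng G g \<in> units G \<and> src G g \<in> units G) \<and>
     (\<forall>u \<in> units G. rng G u = u \<and> src G u = u) \<and>
     (\<forall>(g, h) \<in> composable G.
        gmult G g h \<in> arrows G \<and> rng G (gmult G g h) = rng G g \<and> src G (gmult G g h) = src G h) \<and>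
     (\<forall>g h k. (g, h) \<in> composable G \<and> (h, k) \<in> composable G \<longrightarrow>
        gmult G (gmult G g h) k = gmult G g (gmult G h k)) \<and>
     (\<forall>g \<in> arrows G. gmult G (rng G g) g = g \<and> gmult G g (src G g) = g) \<and>
     (\<forall>g \<in> arrows G. ginv G g \<in> arrows G \<and> rng G (ginv G g) = src G g \<and> src G (ginv G g) = rng G g \<and>
        gmult G g (ginv G g) = rng G g \<and> gmult G (ginv G g) g = src G g)"

definition topological_groupoid :: "'a groupoid \<Rightarrow> bool" where
  "topological_groupoid G \<longleftrightarrow>
     is_groupoid G \<and>
     locally_compact_space (gtop G) \<and> Hausdorff_space (gtop G) \<and>
     continuous_map (gtop G) (unit_top G) (rng G) \<and>
     continuous_map (gtop G) (unit_top G) (src G) \<and>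
     continuous_map (subtopology (prod_topology (gtop G) (gtop G)) (composable G)) (gtop G)
       (\<lambda>(g, h). gmult G g h) \<and>
     continuous_map (gtop G) (gtop G) (ginv G)"

definition groupoid_hom :: "'a groupoid \<Rightarrow> 'b groupoid \<Rightarrow> ('a \<Rightarrow> 'b) \<Rightarrow> bool" where
  "groupoid_hom G H f \<longleftrightarrow>
     f ` arrows G \<subseteq> arrows H \<and>
     (\<forall>(g, h) \<in> composable G. (f g, f h) \<in> composable H \<and> f (gmult G g h) = gmult H (f g) (f h))"

text \<open>The manifold of composable pairs.  Its dimension is the one of the fibre product of two
  submersions from \<open>G\<close> to the unit space, \<open>2 dim G - dim G\<^sup>(\<^sup>0\<^sup>)\<close>.\<close>

definition composable_dim :: "'a manifold \<Rightarrow> 'a manifold \<Rightarrow> nat" where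
  "composable_dim M M0 = 2 * mdim M - mdim M0"

definition composable_manifold :: "'a groupoid \<Rightarrow> 'a manifold \<Rightarrow> 'a manifold \<Rightarrow> ('a \<times> 'a) manifold" where
  "composable_manifold G M M0 = submanifold (prod_manifold M M) (composable_dim M M0) (composable G)"

text \<open>\<open>M\<close> and \<open>M0\<close> are the manifold structures of \<open>G\<close> and of its unit space.\<close>

definition lie_groupoid :: "'a groupoid \<Rightarrow> 'a manifold \<Rightarrow> 'a manifold \<Rightarrow> bool" where
  "lie_groupoid G M M0 \<longleftrightarrow>
     topological_groupoid G \<and>
     smooth_manifold M \<and> mtop M = gtop G \<and>
     smooth_manifold M0 \<and> mtop M0 = unit_top G \<and>
     smooth_embedding M0 M (\<lambda>x. x) \<and>
     submersion M M0 (rng G) \<and> submersion M M0 (src G) \<and>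
     embedded_submanifold (prod_manifold M M) (composable_dim M M0) (composable G) \<and>
     smooth_map (composable_manifold G M M0) M (\<lambda>(g, h). gmult G g h) \<and>
     smooth_map M M (ginv G)"


section \<open>Twists\<close>

definition circle_bundle :: "'a groupoid \<Rightarrow> (complex \<times> 'a) groupoid" where
  "circle_bundle G =
     \<lparr>gtop = prod_topology (top_of_set circle) (unit_top G),
      units = {1} \<times> units G,
      rng = (\<lambda>(z, x). (1, x)),
      src = (\<lambda>(z, x). (1, x)),
      gmult = (\<lambda>(z, x) (w, y). (z * w, x)),
      ginv = (\<lambda>(z, x). (inverse z, x))\<rparr>"

definition topological_twist ::
    "'g groupoid \<Rightarrow> 'e groupoid \<Rightarrow> (complex \<times> 'g \<Rightarrow> 'e) \<Rightarrow> ('e \<Rightarrow> 'g) \<Rightarrow> bool" where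
  "topological_twist G E \<iota> \<pi> \<longleftrightarrow>
     topological_groupoid G \<and> topological_groupoid E \<and>
     groupoid_hom (circle_bundle G) E \<iota> \<and> groupoid_hom E G \<pi> \<and>
     homeomorphic_map (gtop (circle_bundle G)) (subtopology (gtop E) (\<pi> -` units G)) \<iota> \<and>
     (\<forall>y \<in> units E. \<iota> (1, \<pi> y) = y) \<and>
     continuous_map (gtop E) (gtop G) \<pi> \<and> open_map (gtop E) (gtop G) \<pi> \<and>
     \<pi> ` arrows E = arrows G \<and>
     (\<forall>e \<in> arrows E. \<forall>z \<in> circle.
        gmult E (\<iota> (z, \<pi> (rng E e))) e = gmult E e (\<iota> (z, \<pi> (src E e))))"

definition twist_action ::
    "'e groupoid \<Rightarrow> (complex \<times> 'g \<Rightarrow> 'e) \<Rightarrow> ('e \<Rightarrow> 'g) \<Rightarrow> complex \<Rightarrow> 'e \<Rightarrow> 'e" where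
  "twist_action E \<iota> \<pi> z e = gmult E (\<iota> (z, \<pi> (rng E e))) e"

definition twist_coord :: "'g groupoid \<Rightarrow> (complex \<times> 'g \<Rightarrow> 'e) \<Rightarrow> 'e \<Rightarrow> complex \<times> 'g" where
  "twist_coord G \<iota> = inv_into (circle \<times> units G) \<iota>"

text \<open>The units of \<open>E\<close> are identified with those of \<open>G\<close> via \<open>\<pi>\<close>, so the
  manifold structure of the unit space of \<open>E\<close> is the one of the unit space of
  \<open>G\<close>.\<close>

definition twist_unit_manifold :: "'e groupoid \<Rightarrow> ('e \<Rightarrow> 'g) \<Rightarrow> 'g manifold \<Rightarrow> 'e manifold" where
  "twist_unit_manifold E \<pi> M0 = transported_manifold (unit_top E) \<pi> M0"

definition lie_twist ::
    "'g groupoid \<Rightarrow> 'g manifold \<Rightarrow> 'g manifold \<Rightarrow> 'e groupoid \<Rightarrow> 'e manifold \<Rightarrow>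
     (complex \<times> 'g \<Rightarrow> 'e) \<Rightarrow> ('e \<Rightarrow> 'g) \<Rightarrow> bool" where
  "lie_twist G M M0 E N \<iota> \<pi> \<longleftrightarrow>
     lie_groupoid G M M0 \<and> topological_twist G E \<iota> \<pi> \<and>
     lie_groupoid E N (twist_unit_manifold E \<pi> M0) \<and>
     submersion N M \<pi> \<and>
     smooth_map (prod_manifold circle_manifold M0) N \<iota>"

definition smooth_principal_circle_bundle ::
    "'e manifold \<Rightarrow> 'g manifold \<Rightarrow> (complex \<Rightarrow> 'e \<Rightarrow> 'e) \<Rightarrow> ('e \<Rightarrow> 'g) \<Rightarrow> bool" where
  "smooth_principal_circle_bundle N M act \<pi> \<longleftrightarrow>
     smooth_manifold N \<and> smooth_manifold M \<and>
     smooth_map N M \<pi> \<and>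
     (\<forall>e \<in> topspace (mtop N). act 1 e = e \<and>
        (\<forall>z \<in> circle. \<pi> (act z e) = \<pi> e \<and> (\<forall>w \<in> circle. act z (act w e) = act (z * w) e))) \<and>
     smooth_map (prod_manifold circle_manifold N) N (\<lambda>(z, e). act z e) \<and>
     (\<forall>x \<in> topspace (mtop M). \<exists>U h.
        openin (mtop M) U \<and> x \<in> U \<and>
        diffeomorphism (open_submanifold N (topspace (mtop N) \<inter> \<pi> -` U))
          (prod_manifold circle_manifold (open_submanifold M U)) h \<and>
        (\<forall>e \<in> topspace (mtop N) \<inter> \<pi> -` U.
           snd (h e) = \<pi> e \<and> (\<forall>z \<in> circle. h (act z e) = (z * fst (h e), \<pi> e))))"


subsection \<open>Families of local sections\<close>

definition smooth_atlas_of :: "'g manifold \<Rightarrow> 'i set \<Rightarrow> ('i \<Rightarrow> 'g set) \<Rightarrow> ('i \<Rightarrow> 'g \<Rightarrow> nat \<Rightarrow> real) \<Rightarrow> bool" where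
  "smooth_atlas_of M A U \<phi> \<longleftrightarrow>
     (\<forall>\<alpha>\<in>A. (U \<alpha>, \<phi> \<alpha>) \<in> charts M) \<and> (\<Union>\<alpha>\<in>A. U \<alpha>) = topspace (mtop M)"

definition continuous_section :: "'g groupoid \<Rightarrow> 'e groupoid \<Rightarrow> ('e \<Rightarrow> 'g) \<Rightarrow> 'g set \<Rightarrow> ('g \<Rightarrow> 'e) \<Rightarrow> bool" where
  "continuous_section G E \<pi> V \<sigma> \<longleftrightarrow>
     continuous_map (subtopology (gtop G) V) (subtopology (gtop E) (\<pi> -` V)) \<sigma> \<and>
     (\<forall>\<gamma>\<in>V. \<pi> (\<sigma> \<gamma>) = \<gamma>)"

definition U_smooth ::
    "'g groupoid \<Rightarrow> 'g manifold \<Rightarrow> (complex \<times> 'g \<Rightarrow> 'e) \<Rightarrow> 'i set \<Rightarrow> ('i \<Rightarrow> 'g set) \<Rightarrow> ('i \<Rightarrow> 'g \<Rightarrow> 'e) \<Rightarrow> bool" where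
  "U_smooth G M0 \<iota> A U \<sigma> \<longleftrightarrow>
     (\<forall>\<alpha>\<in>A. \<exists>k. smooth_map (open_submanifold M0 (U \<alpha> \<inter> units G)) circle_manifold k \<and>
        (\<forall>x \<in> U \<alpha> \<inter> units G. \<sigma> \<alpha> x = \<iota> (k x, x)))"

definition S_smooth ::
    "'g groupoid \<Rightarrow> 'g manifold \<Rightarrow> 'g manifold \<Rightarrow> 'e groupoid \<Rightarrow> (complex \<times> 'g \<Rightarrow> 'e) \<Rightarrow>
     'i set \<Rightarrow> ('i \<Rightarrow> 'g set) \<Rightarrow> ('i \<Rightarrow> 'g \<Rightarrow> 'e) \<Rightarrow> bool" where
  "S_smooth G M M0 E \<iota> A U \<sigma> \<longleftrightarrow>
     (\<forall>\<alpha>\<in>A. \<forall>\<alpha>'\<in>A.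
        smooth_map (open_submanifold M (U \<alpha> \<inter> U \<alpha>')) (prod_manifold circle_manifold M0)
          (\<lambda>\<gamma>. twist_coord G \<iota> (gmult E (\<sigma> \<alpha> \<gamma>) (ginv E (\<sigma> \<alpha>' \<gamma>)))))"

definition M_smooth ::
    "'g groupoid \<Rightarrow> 'g manifold \<Rightarrow> 'g manifold \<Rightarrow> 'e groupoid \<Rightarrow> (complex \<times> 'g \<Rightarrow> 'e) \<Rightarrow>
     'i set \<Rightarrow> ('i \<Rightarrow> 'g set) \<Rightarrow> ('i \<Rightarrow> 'g \<Rightarrow> 'e) \<Rightarrow> bool" where
  "M_smooth G M M0 E \<iota> A U \<sigma> \<longleftrightarrow>
     (\<forall>\<alpha>\<in>A. \<forall>\<alpha>\<^sub>1\<in>A. \<forall>\<alpha>\<^sub>2\<in>A.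
        smooth_map
          (open_submanifold (composable_manifold G M M0)
             {(\<gamma>\<^sub>1, \<gamma>\<^sub>2) \<in> composable G. \<gamma>\<^sub>1 \<in> U \<alpha>\<^sub>1 \<and> \<gamma>\<^sub>2 \<in> U \<alpha>\<^sub>2 \<and> gmult G \<gamma>\<^sub>1 \<gamma>\<^sub>2 \<in> U \<alpha>})
          (prod_manifold circle_manifold M0)
          (\<lambda>(\<gamma>\<^sub>1, \<gamma>\<^sub>2). twist_coord G \<iota>
             (gmult E (gmult E (\<sigma> \<alpha>\<^sub>1 \<gamma>\<^sub>1) (\<sigma> \<alpha>\<^sub>2 \<gamma>\<^sub>2)) (ginv E (\<sigma> \<alpha> (gmult G \<gamma>\<^sub>1 \<gamma>\<^sub>2))))))"

end

theory Submission
  imports Defs "HOL-Homology.Invariance_of_Domain"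
begin

text \<open>
  Every element of \<open>E\<close> over \<open>U \<alpha>\<close> is \<open>z \<cdot> \<sigma> \<alpha> \<gamma>\<close> for exactly one \<open>z\<close> in the circle, its phase with
  respect to \<open>\<sigma> \<alpha>\<close>, and \<open>\<gamma>\<close> is its image under \<open>\<pi>\<close>.  In a local trivialisation of the bundle the phase is
  a quotient of two smooth circle-valued functions, so it is smooth (\<open>smooth_phase\<close>).  Hence a map
  into \<open>E\<close> is smooth as soon as it can be written locally as a smooth circle-valued function acting on a
  section \<open>\<sigma> \<alpha>\<close> at a smoothly varying point of \<open>G\<close>.

  Multiplication has this form.  The circle is central in \<open>E\<close>, so
  \<open>(z\<^sub>1 \<cdot> \<sigma> \<alpha>\<^sub>1 \<gamma>\<^sub>1) (z\<^sub>2 \<cdot> \<sigma> \<alpha>\<^sub>2 \<gamma>\<^sub>2) = z\<^sub>1 z\<^sub>2 m(\<gamma>\<^sub>1, \<gamma>\<^sub>2) \<cdot> \<sigma> \<alpha> (\<gamma>\<^sub>1 \<gamma>\<^sub>2)\<close>, and \<open>m\<close> is the circle component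
  that condition (M) asserts to be smooth.  For inversion, apply this to \<open>\<gamma>\<close> and \<open>\<gamma>\<^sup>-\<^sup>1\<close>.  Their product is
  the unit \<open>r(\<gamma>)\<close>, over which condition (U) compares \<open>\<sigma> \<delta>\<close> with the unit section:
  \<open>\<sigma> \<alpha> \<gamma> \<sigma> \<beta> (\<gamma>\<^sup>-\<^sup>1) = m(\<gamma>, \<gamma>\<^sup>-\<^sup>1) k(r(\<gamma>)) \<cdot> r(\<gamma>)\<close>, which gives
  \<open>(\<sigma> \<alpha> \<gamma>)\<^sup>-\<^sup>1 = (m k)\<^sup>-\<^sup>1 \<cdot> \<sigma> \<beta> (\<gamma>\<^sup>-\<^sup>1)\<close>.

  By (U) the unit section \<open>x \<mapsto> \<iota>(1, x) = k(x)\<^sup>-\<^sup>1 \<cdot> \<sigma> \<alpha> x\<close> is smooth, hence so is \<open>\<iota>(z, x) = z \<cdot> \<iota>(1, x)\<close>.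
  The inclusion of the units of \<open>E\<close> is an immersion because its composite with \<open>\<pi>\<close> is the inclusion of the
  units of \<open>G\<close>.  Through every point of \<open>E\<close> passes a local section \<open>z \<cdot> \<sigma> \<alpha>\<close> of \<open>\<pi>\<close>, so \<open>\<pi>\<close> is a submersion,
  and range and source of \<open>E\<close> are composites of \<open>\<pi>\<close>, the range or source of \<open>G\<close>, and the diffeomorphism between the units.

  A pair is composable in \<open>E\<close> exactly if its image under \<open>\<pi> \<times> \<pi>\<close> is composable in \<open>G\<close>.  A slice chart for
  the composable pairs of \<open>G\<close> therefore yields one for those of \<open>E\<close> if the angles of the two phases are added to
  the coordinates along the slice (\<open>composable_slice_chart\<close>).  The slice dimension grows by two, which agrees with
  \<open>2 dim E - dim E\<^sup>(\<^sup>0\<^sup>)\<close> since \<open>dim E = dim G + 1\<close> by invariance of domain.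

  The calculus behind this is built from coordinates.  The chain rule for \<open>Ck_on\<close> makes smooth functions
  on open subsets of the model spaces stable under composition.  On manifolds, everything is expressed by
  the smooth real functions \<open>smooth_fun\<close>: a map is smooth iff its coordinates in one chart
  around each image point are (\<open>smooth_mapI\<close>, \<open>smooth_map_coordinate\<close>).  Smooth maps into products,
  submanifolds, transported structures and the circle are all obtained from this criterion.
\<close>

section \<open>Partial derivatives and the chain rule\<close>

abbreviation coord_space :: "nat \<Rightarrow> (nat \<Rightarrow> real) set" where
  "coord_space n \<equiv> topspace (Euclidean_space n)"

lemma coord_space_iff: "x \<in> coord_space n \<longleftrightarrow> (\<forall>i\<ge>n. x i = 0)"
  by (simp add: topspace_Euclidean_space)

lemma coord_space_upd: "x \<in> coord_space n \<Longrightarrow> i < n \<Longrightarrow> x(i := t) \<in> coord_space n"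
  by (auto simp: coord_space_iff)

lemma continuous_map_coordinate: "continuous_map (Euclidean_space n) euclideanreal (\<lambda>x. x i)"
  unfolding Euclidean_space_def
  by (rule continuous_map_from_subtopology) (rule continuous_map_product_projection, simp)

lemma continuous_map_into_Euclidean_space:
  assumes "\<And>i. i < n \<Longrightarrow> continuous_map X euclideanreal (\<lambda>x. f x i)"
    and "\<And>x. x \<in> topspace X \<Longrightarrow> f x \<in> coord_space n"
  shows "continuous_map X (Euclidean_space n) f"
proof -
  have "continuous_map X (Euclidean_space n) (\<lambda>x i. if i < n then f x i else 0)"
    using assms(1) by (simp add: continuous_map_componentwise_Euclidean_space)
  then show ?thesis
  proof (rule continuous_map_eq)
    fix x assume "x \<in> topspace X"
    then show "(\<lambda>i. if i < n then f x i else 0) = f x"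
      using assms(2)[of x] by (auto simp: coord_space_iff fun_eq_iff)
  qed
qed

lemma continuous_map_coordinate_of:
  assumes "continuous_map X (Euclidean_space n) f"
  shows "continuous_map X euclideanreal (\<lambda>x. f x i)"
  using continuous_map_compose[OF assms continuous_map_coordinate[of n i]] by (simp add: o_def)

text \<open>A neighbourhood in the product topology restricts finitely many coordinates only, so a common side length
  exists.\<close>

lemma Euclidean_space_box:
  assumes V: "openin (Euclidean_space n) V" and a: "a \<in> V"
  shows "\<exists>\<delta>>0. \<forall>x \<in> coord_space n. (\<forall>i<n. \<bar>x i - a i\<bar> < \<delta>) \<longrightarrow> x \<in> V"
proof -
  obtain T where T: "openin (powertop_real UNIV) T" "V = T \<inter> {x. \<forall>i\<ge>n. x i = 0}"
    using V unfolding Euclidean_space_def openin_subtopology by blast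
  then have "a \<in> T" using a by blast
  then obtain B where B: "\<And>i. open (B i)" "a \<in> Pi\<^sub>E UNIV B" "Pi\<^sub>E UNIV B \<subseteq> T"
    using T(1) unfolding openin_product_topology_alt by (simp) blast
  have "\<forall>i. \<exists>d>0. \<forall>t. \<bar>t - a i\<bar> < d \<longrightarrow> t \<in> B i"
    using B(1,2) unfolding open_dist dist_real_def by (auto simp: PiE_iff)
  then obtain d where d: "\<And>i. d i > 0" "\<And>i t. \<bar>t - a i\<bar> < d i \<Longrightarrow> t \<in> B i" by metis
  define \<delta> where "\<delta> = Min (insert 1 (d ` {..<n}))"
  have "\<delta> > 0" unfolding \<delta>_def using d(1) by (subst Min_gr_iff) auto
  moreover have "x \<in> V" if x: "x \<in> coord_space n" "\<forall>i<n. \<bar>x i - a i\<bar> < \<delta>" for x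
  proof -
    have "x i \<in> B i" for i
    proof (cases "i < n")
      case True
      then have "\<delta> \<le> d i" unfolding \<delta>_def by (intro Min_le) auto
      then show ?thesis using x(2) True d(2) by (meson less_le_trans)
    next
      case False
      then have "x i = a i" using x(1) a T(2) by (simp add: coord_space_iff)
      then show ?thesis using B(2) by (simp add: PiE_iff)
    qed
    then have "x \<in> T" using B(3) by (auto simp: PiE_iff)
    then show ?thesis using x(1) T(2) by (simp add: coord_space_iff)
  qed
  ultimately show ?thesis by blast
qed

lemma continuous_map_box:
  assumes V: "openin (Euclidean_space n) V" and a: "a \<in> V"
    and f: "continuous_map (subtopology (Euclidean_space n) V) euclideanreal f" and e: "\<epsilon> > 0"
  shows "\<exists>\<delta>>0. \<forall>x \<in> coord_space n. (\<forall>i<n. \<bar>x i - a i\<bar> < \<delta>) \<longrightarrow> x \<in> V \<and> \<bar>f x - f a\<bar> < \<epsilon>"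
proof -
  let ?W = "{x \<in> topspace (subtopology (Euclidean_space n) V). f x \<in> ball (f a) \<epsilon>}"
  have "openin (subtopology (Euclidean_space n) V) ?W"
    using f by (rule openin_continuous_map_preimage) simp
  then have "openin (Euclidean_space n) ?W" using V by (rule openin_trans_full)
  moreover have "a \<in> ?W" using a V e openin_subset by fastforce
  ultimately obtain \<delta> where "\<delta> > 0"
    "\<forall>x \<in> coord_space n. (\<forall>i<n. \<bar>x i - a i\<bar> < \<delta>) \<longrightarrow> x \<in> ?W"
    using Euclidean_space_box[of n ?W a] by blast
  then show ?thesis
    by (intro exI[of _ \<delta>]) (simp add: dist_real_def abs_minus_commute)
qed

text \<open>Partial derivatives at a point of an open set \<open>W\<close> depend only on the values on \<open>W\<close>, because the coordinate
  lines stay in \<open>W\<close> for a while.\<close>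

lemma eventually_upd_in:
  assumes "openin (Euclidean_space n) W" "x \<in> W" "i < n"
  shows "eventually (\<lambda>t. x(i := t) \<in> W) (nhds (x i))"
proof -
  obtain \<delta> where \<delta>: "\<delta> > 0" "\<And>y. y \<in> coord_space n \<Longrightarrow> \<forall>j<n. \<bar>y j - x j\<bar> < \<delta> \<Longrightarrow> y \<in> W"
    using Euclidean_space_box[OF assms(1,2)] by blast
  have "x \<in> coord_space n" using assms(1,2) openin_subset by blast
  then have "x(i := t) \<in> W" if "\<bar>t - x i\<bar> < \<delta>" for t
    using that \<delta> assms(3) by (intro \<delta>(2)) (auto simp: coord_space_upd)
  then show ?thesis
    unfolding eventually_nhds_metric dist_real_def using \<delta>(1) by blast
qed

lemma partial_deriv_cong:
  assumes "openin (Euclidean_space n) W" "x \<in> W" "i < n" "\<And>y. y \<in> W \<Longrightarrow> f y = g y"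
  shows "partial_deriv i f x = partial_deriv i g x"
  unfolding partial_deriv_def
  by (rule deriv_cong_ev) (use eventually_upd_in[OF assms(1-3)] assms(4) in \<open>auto elim: eventually_mono\<close>)

lemma has_partial_deriv:
  assumes "(\<lambda>t. f (x(i := t))) differentiable at (x i)"
  shows "((\<lambda>t. f (x(i := t))) has_real_derivative partial_deriv i f x) (at (x i))"
  unfolding partial_deriv_def
  using assms by (simp add: DERIV_deriv_iff_real_differentiable)

lemma partial_deriv_eqI:
  assumes "((\<lambda>t. f (x(i := t))) has_real_derivative d) (at (x i))"
  shows "(\<lambda>t. f (x(i := t))) differentiable at (x i)" "partial_deriv i f x = d"
  using assms real_differentiable_def apply blast
  using assms unfolding partial_deriv_def by (rule DERIV_imp_deriv)

lemma differentiable_upd_cong: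
  fixes f g :: "(nat \<Rightarrow> real) \<Rightarrow> real"
  assumes "openin (Euclidean_space n) W" "x \<in> W" "i < n" "\<And>y. y \<in> W \<Longrightarrow> f y = g y"
    and "(\<lambda>t. f (x(i := t))) differentiable at (x i)"
  shows "(\<lambda>t. g (x(i := t))) differentiable at (x i)"
proof -
  have d: "((\<lambda>t. f (x(i := t))) has_real_derivative partial_deriv i f x) (at (x i))"
    using assms(5) by (rule has_partial_deriv)
  have "eventually (\<lambda>t. f (x(i := t)) = g (x(i := t))) (nhds (x i))"
    using eventually_upd_in[OF assms(1-3)] assms(4) by (rule eventually_mono)
  then have "((\<lambda>t. g (x(i := t))) has_real_derivative partial_deriv i f x) (at (x i))"
    using d by (rule iffD1[OF DERIV_cong_ev[OF refl _ refl]])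
  then show ?thesis by (rule partial_deriv_eqI)
qed

lemma Ck_on_continuous: "Ck_on k n W f \<Longrightarrow> continuous_map (subtopology (Euclidean_space n) W) euclideanreal f"
  by (cases k) auto

lemma Ck_on_cong:
  assumes "openin (Euclidean_space n) W" "\<And>x. x \<in> W \<Longrightarrow> f x = g x" "Ck_on k n W f"
  shows "Ck_on k n W g"
  using assms(2,3)
proof (induction k arbitrary: f g)
  case 0
  then show ?case using continuous_map_eq[of _ _ f g] by fastforce
next
  case (Suc k)
  have "continuous_map (subtopology (Euclidean_space n) W) euclideanreal g"
    using Suc.prems continuous_map_eq[of _ _ f g] by fastforce
  moreover have "(\<lambda>t. g (x(i := t))) differentiable at (x i)" if "i < n" "x \<in> W" for i x
    using Suc.prems that by (intro differentiable_upd_cong[OF assms(1) that(2,1), of f g]) auto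
  moreover have "Ck_on k n W (partial_deriv i g)" if "i < n" for i
  proof (rule Suc.IH)
    show "partial_deriv i f x = partial_deriv i g x" if "x \<in> W" for x
      by (rule partial_deriv_cong[OF assms(1) that \<open>i < n\<close>]) (rule Suc.prems)
    show "Ck_on k n W (partial_deriv i f)" using Suc.prems that by simp
  qed
  ultimately show ?case by simp
qed

lemma Ck_on_subset: "Ck_on k n W f \<Longrightarrow> W' \<subseteq> W \<Longrightarrow> Ck_on k n W' f"
proof (induction k arbitrary: f)
  case 0
  then show ?case using continuous_map_from_subtopology_mono by auto
next
  case (Suc k)
  then show ?case using continuous_map_from_subtopology_mono[of _ W _ f W'] by auto
qed

lemma continuous_map_local:
  assumes "\<And>x. x \<in> topspace X \<Longrightarrow> \<exists>W. openin X W \<and> x \<in> W \<and> continuous_map (subtopology X W) Y f"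
  shows "continuous_map X Y f"
proof -
  obtain T where T: "\<And>x. x \<in> topspace X \<Longrightarrow> openin X (T x) \<and> x \<in> T x \<and> continuous_map (subtopology X (T x)) Y f"
    using assms by metis
  show ?thesis
    by (rule pasting_lemma[of "topspace X" X T Y "\<lambda>_. f"]) (use T in auto)
qed

lemma Ck_on_local:
  assumes "W \<subseteq> coord_space n"
    and "\<And>x. x \<in> W \<Longrightarrow> \<exists>W'. openin (Euclidean_space n) W' \<and> x \<in> W' \<and> Ck_on k n (W' \<inter> W) f"
  shows "Ck_on k n W f"
  using assms(2)
proof (induction k arbitrary: f)
  have cont: "continuous_map (subtopology (Euclidean_space n) W) euclideanreal f"
    if *: "\<And>x. x \<in> W \<Longrightarrow> \<exists>W'. openin (Euclidean_space n) W' \<and> x \<in> W' \<and> Ck_on 0 n (W' \<inter> W) f" for f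
  proof (rule continuous_map_local)
    fix x assume "x \<in> topspace (subtopology (Euclidean_space n) W)"
    then obtain W' where W': "openin (Euclidean_space n) W'" "x \<in> W'" "Ck_on 0 n (W' \<inter> W) f" "x \<in> W"
      using *[of x] by auto
    have "openin (subtopology (Euclidean_space n) W) (W \<inter> W')" using W'(1) by (rule openin_subtopology_Int2)
    moreover have "continuous_map (subtopology (subtopology (Euclidean_space n) W) (W \<inter> W')) euclideanreal f"
      using W'(3) by (simp add: subtopology_subtopology Int_ac)
    ultimately show "\<exists>V. openin (subtopology (Euclidean_space n) W) V \<and> x \<in> V \<and>
        continuous_map (subtopology (subtopology (Euclidean_space n) W) V) euclideanreal f"
      using W' by blast
  qed
  {
    case 0
    then show ?case using cont[of f] by simp
  next
    case (Suc k)
    have "continuous_map (subtopology (Euclidean_space n) W) euclideanreal f"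
      by (rule cont) (use Suc.prems Ck_on_continuous in fastforce)
    moreover have "Ck_on k n W (partial_deriv i f)" if "i < n" for i
      by (rule Suc.IH) (use Suc.prems that in fastforce)
    moreover have "(\<lambda>t. f (x(i := t))) differentiable at (x i)" if "i < n" "x \<in> W" for i x
      using Suc.prems[OF that(2)] that by fastforce
    ultimately show ?case by simp
  }
qed

lemma Ck_on_Suc_imp: "Ck_on (Suc k) n W f \<Longrightarrow> Ck_on k n W f"
proof (induction k arbitrary: f)
  case (Suc k)
  then show ?case by auto
qed auto

lemma partial_deriv_const: "partial_deriv i (\<lambda>x. c) = (\<lambda>x. 0)"
  by (simp add: partial_deriv_def fun_eq_iff)

lemma Ck_on_const: "Ck_on k n W (\<lambda>x. c)"
proof (induction k arbitrary: c)
  case (Suc k)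
  then show ?case by (simp add: partial_deriv_const)
qed simp

lemma partial_deriv_coordinate: "partial_deriv i (\<lambda>x. x j) = (\<lambda>x. if i = j then 1 else 0)"
proof
  fix x :: "nat \<Rightarrow> real"
  have "((\<lambda>t. (x(i := t)) j) has_real_derivative (if i = j then 1 else 0)) (at (x i))"
    by (cases "i = j") auto
  then show "partial_deriv i (\<lambda>x. x j) x = (if i = j then 1 else 0)"
    by (rule partial_deriv_eqI)
qed

lemma Ck_on_coordinate: "Ck_on k n W (\<lambda>x. x j)"
proof (cases k)
  case 0
  then show ?thesis by (simp add: continuous_map_from_subtopology continuous_map_coordinate)
next
  case (Suc m)
  have "(\<lambda>t. (x(i := t)) j) differentiable at (x i)" for x :: "nat \<Rightarrow> real" and i
    by (cases "i = j") auto
  then show ?thesis using Suc Ck_on_const[of m n W]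
    by (simp add: continuous_map_from_subtopology continuous_map_coordinate partial_deriv_coordinate)
qed

lemma Ck_on_add:
  assumes W: "openin (Euclidean_space n) W"
  shows "Ck_on k n W f \<Longrightarrow> Ck_on k n W g \<Longrightarrow> Ck_on k n W (\<lambda>x. f x + g x)"
proof (induction k arbitrary: f g)
  case 0
  then show ?case by (simp add: continuous_map_add)
next
  case (Suc k)
  have d: "((\<lambda>t. f (x(i := t)) + g (x(i := t))) has_real_derivative partial_deriv i f x + partial_deriv i g x) (at (x i))"
    if "i < n" "x \<in> W" for i x
    using Suc.prems that by (intro DERIV_add has_partial_deriv) auto
  have "Ck_on k n W (partial_deriv i (\<lambda>x. f x + g x))" if "i < n" for i
  proof (rule Ck_on_cong[OF W])
    show "Ck_on k n W (\<lambda>x. partial_deriv i f x + partial_deriv i g x)"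
      using Suc that by auto
    show "partial_deriv i f x + partial_deriv i g x = partial_deriv i (\<lambda>x. f x + g x) x" if "x \<in> W" for x
      using partial_deriv_eqI(2)[OF d[OF \<open>i < n\<close> that]] by simp
  qed
  then show ?case
    using Suc.prems d by (auto simp: continuous_map_add real_differentiable_def)
qed

lemma Ck_on_mult:
  assumes W: "openin (Euclidean_space n) W"
  shows "Ck_on k n W f \<Longrightarrow> Ck_on k n W g \<Longrightarrow> Ck_on k n W (\<lambda>x. f x * g x)"
proof (induction k arbitrary: f g)
  case 0
  then show ?case by (simp add: continuous_map_real_mult)
next
  case (Suc k)
  have d: "((\<lambda>t. f (x(i := t)) * g (x(i := t))) has_real_derivative
      partial_deriv i f x * g x + partial_deriv i g x * f x) (at (x i))"
    if "i < n" "x \<in> W" for i x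
    using DERIV_mult[OF has_partial_deriv[of f x i] has_partial_deriv[of g x i]] Suc.prems that
    by simp
  have "Ck_on k n W (partial_deriv i (\<lambda>x. f x * g x))" if "i < n" for i
  proof (rule Ck_on_cong[OF W])
    show "Ck_on k n W (\<lambda>x. partial_deriv i f x * g x + partial_deriv i g x * f x)"
      using Suc.prems that by (intro Ck_on_add[OF W] Suc.IH) (auto intro: Ck_on_Suc_imp)
    show "partial_deriv i f x * g x + partial_deriv i g x * f x = partial_deriv i (\<lambda>x. f x * g x) x" if "x \<in> W" for x
      using partial_deriv_eqI(2)[OF d[OF \<open>i < n\<close> that]] by simp
  qed
  then show ?case
    using Suc.prems d by (auto simp: continuous_map_real_mult real_differentiable_def)
qed

lemma Ck_on_sum:
  assumes "openin (Euclidean_space n) W" "\<And>i. i \<in> I \<Longrightarrow> Ck_on k n W (f i)"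
  shows "Ck_on k n W (\<lambda>x. \<Sum>i\<in>I. f i x)"
proof (cases "finite I")
  case True
  then show ?thesis using assms(2)
    by (induction I rule: finite_induct) (auto intro: Ck_on_const Ck_on_add[OF assms(1)])
qed (simp add: Ck_on_const)

text \<open>The condition on \<open>t\<close> describes the segment between \<open>a\<close> and \<open>b\<close> (and its mirror image) without
  distinguishing which endpoint is larger.\<close>

lemma mvt_between:
  fixes h h' :: "real \<Rightarrow> real"
  assumes "\<And>t. \<bar>t - a\<bar> \<le> \<bar>b - a\<bar> \<Longrightarrow> (h has_real_derivative h' t) (at t)"
  shows "\<exists>t. \<bar>t - a\<bar> \<le> \<bar>b - a\<bar> \<and> h b - h a = h' t * (b - a)"
proof (cases a b rule: linorder_cases)
  case less
  then obtain z where "a < z" "z < b" "h b - h a = (b - a) * h' z"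
    using MVT2[of a b h h'] assms by (force simp: abs_le_iff)
  then show ?thesis by (intro exI[of _ z]) (auto simp: mult.commute)
next
  case equal
  then show ?thesis by (intro exI[of _ a]) simp
next
  case greater
  then obtain z where "b < z" "z < a" "h a - h b = (a - b) * h' z"
    using MVT2[of b a h h'] assms by (force simp: abs_le_iff)
  then show ?thesis by (intro exI[of _ z]) (auto simp: algebra_simps)
qed

text \<open>Change the coordinates one at a time from those of \<open>a\<close> to those of \<open>x\<close>, and apply the
  one-variable mean value theorem to each change.\<close>

lemma mvt_coordinatewise:
  assumes a: "a \<in> coord_space n" and x: "x \<in> coord_space n"
    and V: "\<And>y. y \<in> coord_space n \<Longrightarrow> \<forall>i<n. \<bar>y i - a i\<bar> \<le> \<bar>x i - a i\<bar> \<Longrightarrow> y \<in> V"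
    and d: "\<And>i y. i < n \<Longrightarrow> y \<in> V \<Longrightarrow> (\<lambda>t. g (y(i := t))) differentiable at (y i)"
  shows "\<exists>\<xi>. (\<forall>j<n. \<xi> j \<in> coord_space n \<and> (\<forall>i<n. \<bar>\<xi> j i - a i\<bar> \<le> \<bar>x i - a i\<bar>)) \<and>
     g x - g a = (\<Sum>j<n. partial_deriv j g (\<xi> j) * (x j - a j))"
proof -
  define y where "y j = (\<lambda>i. if i < j then x i else a i)" for j
  have "\<exists>\<xi>. \<xi> \<in> coord_space n \<and> (\<forall>i<n. \<bar>\<xi> i - a i\<bar> \<le> \<bar>x i - a i\<bar>) \<and>
     g (y (Suc j)) - g (y j) = partial_deriv j g \<xi> * (x j - a j)" if j: "j < n" for j
  proof -
    let ?z = "\<lambda>t. (y j)(j := t)"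
    have yc: "y j \<in> coord_space n" using a x by (auto simp: y_def coord_space_iff)
    have z: "?z t \<in> coord_space n" "\<forall>i<n. \<bar>?z t i - a i\<bar> \<le> \<bar>x i - a i\<bar>" if "\<bar>t - a j\<bar> \<le> \<bar>x j - a j\<bar>" for t
      using coord_space_upd[OF yc j] that by (auto simp: y_def)
    have "((\<lambda>t. g (?z t)) has_real_derivative partial_deriv j g (?z t)) (at t)" if "\<bar>t - a j\<bar> \<le> \<bar>x j - a j\<bar>" for t
      using has_partial_deriv[OF d[OF j V[OF z[OF that]]]] by (simp only: fun_upd_upd fun_upd_same)
    from mvt_between[of "a j" "x j" "\<lambda>t. g (?z t)" "\<lambda>t. partial_deriv j g (?z t)", OF this]
    obtain t where t: "\<bar>t - a j\<bar> \<le> \<bar>x j - a j\<bar>"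
      "g (?z (x j)) - g (?z (a j)) = partial_deriv j g (?z t) * (x j - a j)" by blast
    have "?z (x j) = y (Suc j)" "?z (a j) = y j" by (auto simp: y_def fun_eq_iff less_Suc_eq)
    then show ?thesis using t z[OF t(1)] by (intro exI[of _ "?z t"]) simp
  qed
  then obtain \<xi> where \<xi>: "\<And>j. j < n \<Longrightarrow> \<xi> j \<in> coord_space n" "\<And>j i. j < n \<Longrightarrow> i < n \<Longrightarrow> \<bar>\<xi> j i - a i\<bar> \<le> \<bar>x i - a i\<bar>"
     "\<And>j. j < n \<Longrightarrow> g (y (Suc j)) - g (y j) = partial_deriv j g (\<xi> j) * (x j - a j)" by metis
  have "y n = x" "y 0 = a" using a x by (auto simp: y_def coord_space_iff fun_eq_iff)
  then have "g x - g a = (\<Sum>j<n. g (y (Suc j)) - g (y j))"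
    using sum_lessThan_telescope[of "\<lambda>j. g (y j)" n] by simp
  then show ?thesis using \<xi> by (intro exI[of _ \<xi>]) simp
qed

text \<open>By \<open>mvt_coordinatewise\<close> the difference quotient of \<open>g \<circ> c\<close> is the sum of the difference quotients of the
  \<open>c j\<close>, weighted by partial derivatives of \<open>g\<close> at intermediate points.  These points tend to \<open>c t0\<close>, so
  continuity of the partial derivatives gives the limit.\<close>

lemma chain_rule_curve:
  assumes V: "openin (Euclidean_space n) V" and g: "Ck_on (Suc 0) n V g"
    and c0: "c t0 \<in> V" and c: "eventually (\<lambda>t. c t \<in> coord_space n) (nhds t0)"
    and c': "\<And>j. j < n \<Longrightarrow> ((\<lambda>t. c t j) has_real_derivative c' j) (at t0)"
  shows "((\<lambda>t. g (c t)) has_real_derivative (\<Sum>j<n. partial_deriv j g (c t0) * c' j)) (at t0)"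
proof -
  define a where "a = c t0"
  have aV: "a \<in> V" "a \<in> coord_space n" using c0 V openin_subset by (auto simp: a_def)
  obtain \<delta> where \<delta>: "\<delta> > 0" "\<And>x. x \<in> coord_space n \<Longrightarrow> \<forall>i<n. \<bar>x i - a i\<bar> < \<delta> \<Longrightarrow> x \<in> V"
    using Euclidean_space_box[OF V aV(1)] by blast
  let ?P = "\<lambda>x \<xi>. (\<forall>j<n. \<xi> j \<in> coord_space n \<and> (\<forall>i<n. \<bar>\<xi> j i - a i\<bar> \<le> \<bar>x i - a i\<bar>)) \<and>
     g x - g a = (\<Sum>j<n. partial_deriv j g (\<xi> j) * (x j - a j))"
  have "\<exists>\<xi>. x \<in> coord_space n \<and> (\<forall>i<n. \<bar>x i - a i\<bar> < \<delta>) \<longrightarrow> ?P x \<xi>" for x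
  proof (cases "x \<in> coord_space n \<and> (\<forall>i<n. \<bar>x i - a i\<bar> < \<delta>)")
    case True
    have "\<exists>\<xi>. ?P x \<xi>"
    proof (rule mvt_coordinatewise[where V = V])
      show "y \<in> V" if "y \<in> coord_space n" "\<forall>i<n. \<bar>y i - a i\<bar> \<le> \<bar>x i - a i\<bar>" for y
        using that True \<delta>(2) by (meson le_less_trans)
      show "(\<lambda>t. g (y(i := t))) differentiable at (y i)" if "i < n" "y \<in> V" for i y
        using g that by simp
    qed (use aV True in auto)
    then show ?thesis by blast
  qed blast
  then have "\<exists>\<xi>. \<forall>x. x \<in> coord_space n \<and> (\<forall>i<n. \<bar>x i - a i\<bar> < \<delta>) \<longrightarrow> ?P x (\<xi> x)"
    by (intro choice allI)
  then obtain \<xi> where "\<forall>x. x \<in> coord_space n \<and> (\<forall>i<n. \<bar>x i - a i\<bar> < \<delta>) \<longrightarrow> ?P x (\<xi> x)" ..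
  then have \<xi>: "?P x (\<xi> x)" if "x \<in> coord_space n" "\<forall>i<n. \<bar>x i - a i\<bar> < \<delta>" for x
    using that by simp
  have tend: "((\<lambda>t. c t i) \<longlongrightarrow> a i) (at t0)" if "i < n" for i
    using DERIV_isCont[OF c'[OF that]] by (simp add: isCont_def a_def)
  have near: "eventually (\<lambda>t. \<forall>i<n. \<bar>c t i - a i\<bar> < \<epsilon>) (at t0)" if "\<epsilon> > 0" for \<epsilon>
  proof -
    have "eventually (\<lambda>t. \<forall>i\<in>{..<n}. \<bar>c t i - a i\<bar> < \<epsilon>) (at t0)"
      by (rule eventually_ball_finite) (use tendstoD[OF tend that] in \<open>auto simp: dist_real_def\<close>)
    then show ?thesis by (rule eventually_mono) auto
  qed
  have cc: "eventually (\<lambda>t. c t \<in> coord_space n) (at t0)"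
    using c by (auto simp: eventually_at_filter elim: eventually_mono)
  let ?\<theta> = "\<lambda>t j. partial_deriv j g (\<xi> (c t) j)"
  have \<theta>: "((\<lambda>t. ?\<theta> t j) \<longlongrightarrow> partial_deriv j g a) (at t0)" if j: "j < n" for j
  proof (rule tendstoI)
    fix \<epsilon> :: real assume "\<epsilon> > 0"
    have "continuous_map (subtopology (Euclidean_space n) V) euclideanreal (partial_deriv j g)"
      using g j by simp
    from continuous_map_box[OF V aV(1) this \<open>\<epsilon> > 0\<close>]
    obtain \<eta> where \<eta>: "\<eta> > 0" "\<And>x. x \<in> coord_space n \<Longrightarrow> \<forall>i<n. \<bar>x i - a i\<bar> < \<eta> \<Longrightarrow>
        \<bar>partial_deriv j g x - partial_deriv j g a\<bar> < \<epsilon>" by blast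
    show "eventually (\<lambda>t. dist (?\<theta> t j) (partial_deriv j g a) < \<epsilon>) (at t0)"
      using near[OF \<eta>(1)] near[OF \<delta>(1)] cc
    proof eventually_elim
      case (elim t)
      then have *: "\<xi> (c t) j \<in> coord_space n" "\<And>i. i < n \<Longrightarrow> \<bar>\<xi> (c t) j i - a i\<bar> \<le> \<bar>c t i - a i\<bar>"
        using \<xi>[of "c t"] j by auto
      have "\<forall>i<n. \<bar>\<xi> (c t) j i - a i\<bar> < \<eta>" using *(2) elim(1) by (meson le_less_trans)
      then show ?case using \<eta>(2)[OF *(1)] by (simp add: dist_real_def)
    qed
  qed
  have "((\<lambda>t. \<Sum>j<n. ?\<theta> t j * ((c t j - c t0 j) / (t - t0))) \<longlongrightarrow> (\<Sum>j<n. partial_deriv j g a * c' j)) (at t0)"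
    using \<theta> c' by (intro tendsto_sum tendsto_mult) (auto simp: has_field_derivative_iff)
  moreover have "eventually (\<lambda>t. (\<Sum>j<n. ?\<theta> t j * ((c t j - c t0 j) / (t - t0))) = (g (c t) - g (c t0)) / (t - t0)) (at t0)"
    using near[OF \<delta>(1)] cc
  proof eventually_elim
    case (elim t)
    then have "g (c t) - g a = (\<Sum>j<n. ?\<theta> t j * (c t j - a j))" using \<xi>[of "c t"] by blast
    then show ?case by (simp add: a_def sum_divide_distrib)
  qed
  ultimately have "((\<lambda>t. (g (c t) - g (c t0)) / (t - t0)) \<longlongrightarrow> (\<Sum>j<n. partial_deriv j g a * c' j)) (at t0)"
    by (rule Lim_transform_eventually)
  then show ?thesis by (simp add: has_field_derivative_iff a_def)
qed

lemma partial_deriv_compose: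
  assumes V: "openin (Euclidean_space n) V" and W: "openin (Euclidean_space m) W"
    and g: "Ck_on (Suc 0) n V g" and f: "\<And>j. j < n \<Longrightarrow> Ck_on (Suc 0) m W (\<lambda>x. f x j)"
    and fW: "f ` W \<subseteq> V" and i: "i < m" and x: "x \<in> W"
  shows "((\<lambda>t. g (f (x(i := t)))) has_real_derivative
           (\<Sum>j<n. partial_deriv j g (f x) * partial_deriv i (\<lambda>y. f y j) x)) (at (x i))"
proof -
  have "((\<lambda>t. g (f (x(i := t)))) has_real_derivative
           (\<Sum>j<n. partial_deriv j g (f (x(i := x i))) * partial_deriv i (\<lambda>y. f y j) x)) (at (x i))"
  proof (rule chain_rule_curve[OF V g, of "\<lambda>t. f (x(i := t))"])
    show "f (x(i := x i)) \<in> V" using fW x by auto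
    show "eventually (\<lambda>t. f (x(i := t)) \<in> coord_space n) (nhds (x i))"
      using eventually_upd_in[OF W x i] by (rule eventually_mono) (use fW V openin_subset in blast)
    show "((\<lambda>t. f (x(i := t)) j) has_real_derivative partial_deriv i (\<lambda>y. f y j) x) (at (x i))" if "j < n" for j
      using f[OF that] i x by (intro has_partial_deriv[of "\<lambda>y. f y j"]) simp
  qed
  then show ?thesis by simp
qed

text \<open>The partial derivatives of \<open>g \<circ> f\<close> are sums of products of \<open>(\<partial>\<^sub>j g) \<circ> f\<close> and \<open>\<partial>\<^sub>i f\<^sub>j\<close>, so the order of
  differentiability goes up by induction.\<close>

lemma Ck_on_compose:
  assumes V: "openin (Euclidean_space n) V" and W: "openin (Euclidean_space m) W"
    and fW: "f ` W \<subseteq> V"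
  shows "Ck_on k n V g \<Longrightarrow> (\<And>j. j < n \<Longrightarrow> Ck_on k m W (\<lambda>x. f x j)) \<Longrightarrow> Ck_on k m W (g \<circ> f)"
proof (induction k arbitrary: g)
  have cont: "continuous_map (subtopology (Euclidean_space m) W) (subtopology (Euclidean_space n) V) f"
    if f: "\<And>j. j < n \<Longrightarrow> continuous_map (subtopology (Euclidean_space m) W) euclideanreal (\<lambda>x. f x j)"
  proof -
    have "f x \<in> coord_space n" if "x \<in> W" for x using that fW openin_subset[OF V] by blast
    then have "continuous_map (subtopology (Euclidean_space m) W) (Euclidean_space n) f"
      using f by (intro continuous_map_into_Euclidean_space) auto
    then show ?thesis using fW by (auto simp: continuous_map_in_subtopology)
  qed
  {
  case 0
  have "continuous_map (subtopology (Euclidean_space m) W) (subtopology (Euclidean_space n) V) f"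
    by (rule cont) (use "0.prems"(2) Ck_on_continuous in blast)
  then have "continuous_map (subtopology (Euclidean_space m) W) euclideanreal (g \<circ> f)"
    using Ck_on_continuous[OF "0.prems"(1)] by (rule continuous_map_compose)
  then show ?case by (simp only: Ck_on.simps)
  }
  {
  case (Suc k)
  have "continuous_map (subtopology (Euclidean_space m) W) (subtopology (Euclidean_space n) V) f"
    by (rule cont) (use Suc.prems(2) Ck_on_continuous in blast)
  then have 1: "continuous_map (subtopology (Euclidean_space m) W) euclideanreal (g \<circ> f)"
    using Ck_on_continuous[OF Suc.prems(1)] by (rule continuous_map_compose)
  have C1: "Ck_on (Suc 0) n V g" "\<And>j. j < n \<Longrightarrow> Ck_on (Suc 0) m W (\<lambda>x. f x j)"
    using Suc.prems by (auto dest!: Ck_on_continuous)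
  have d: "((\<lambda>t. g (f (x(i := t)))) has_real_derivative
      (\<Sum>j<n. partial_deriv j g (f x) * partial_deriv i (\<lambda>y. f y j) x)) (at (x i))" if "i < m" "x \<in> W" for i x
    by (rule partial_deriv_compose[OF V W C1(1) _ fW that]) (rule C1(2))
  have "Ck_on k m W (partial_deriv i (g \<circ> f))" if "i < m" for i
  proof (rule Ck_on_cong[OF W])
    show "Ck_on k m W (\<lambda>x. \<Sum>j<n. (partial_deriv j g \<circ> f) x * partial_deriv i (\<lambda>y. f y j) x)"
    proof (intro Ck_on_sum Ck_on_mult W)
      fix j assume "j \<in> {..<n}"
      then show "Ck_on k m W (partial_deriv j g \<circ> f)"
        using Suc.prems by (intro Suc.IH Ck_on_Suc_imp[of k m]) auto
      show "Ck_on k m W (partial_deriv i (\<lambda>y. f y j))"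
        using Suc.prems(2)[of j] \<open>j \<in> {..<n}\<close> that by simp
    qed
    show "(\<Sum>j<n. (partial_deriv j g \<circ> f) x * partial_deriv i (\<lambda>y. f y j) x) = partial_deriv i (g \<circ> f) x"
      if "x \<in> W" for x
      using partial_deriv_eqI(2)[of "g \<circ> f" x i] d[OF \<open>i < m\<close> that] by (simp add: o_def)
  qed
  moreover have "(\<lambda>t. (g \<circ> f) (x(i := t))) differentiable at (x i)" if "i < m" "x \<in> W" for i x
    using partial_deriv_eqI(1)[of "g \<circ> f" x i] d[OF that] by (simp add: o_def)
  ultimately show ?case using 1 unfolding Ck_on.simps by blast
  }
qed

lemma Euclidean_space_subspace: "m \<le> n \<Longrightarrow> Euclidean_space m = subtopology (Euclidean_space n) (coord_space m)"
  by (metis Euclidean_space_def inf.absorb_iff2 subset_Euclidean_space subtopology_subtopology topspace_Euclidean_space)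

text \<open>The coordinate lines of the first \<open>m\<close> coordinates stay in the subspace.  This is what makes the restriction of a
  transition map to a slice smooth.\<close>

lemma Ck_on_subspace:
  assumes "m \<le> n"
  shows "Ck_on k n W f \<Longrightarrow> Ck_on k m (W \<inter> coord_space m) f"
proof (induction k arbitrary: f)
  have *: "continuous_map (subtopology (Euclidean_space m) (W \<inter> coord_space m)) euclideanreal f"
    if "continuous_map (subtopology (Euclidean_space n) W) euclideanreal f" for f
  proof -
    have "subtopology (Euclidean_space m) (W \<inter> coord_space m) = subtopology (subtopology (Euclidean_space n) W) (coord_space m)"
      by (subst Euclidean_space_subspace[OF assms]) (simp add: subtopology_subtopology Int_ac)
    then show ?thesis using continuous_map_from_subtopology[OF that, of "coord_space m"] by (simp only:)
  qed
  { case 0 then show ?case using * by simp }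
  { case (Suc k)
    have "continuous_map (subtopology (Euclidean_space m) (W \<inter> coord_space m)) euclideanreal f"
      using Suc.prems by (intro *) simp
    then show ?case using Suc assms unfolding Ck_on.simps by (meson IntD1 less_le_trans) }
qed

definition smooth_on :: "nat \<Rightarrow> (nat \<Rightarrow> real) set \<Rightarrow> ((nat \<Rightarrow> real) \<Rightarrow> real) \<Rightarrow> bool" where
  "smooth_on n W f \<longleftrightarrow> (\<forall>k. Ck_on k n W f)"

lemma smooth_between_iff:
  "smooth_between m n W f \<longleftrightarrow> f ` W \<subseteq> coord_space n \<and> (\<forall>j<n. smooth_on m W (\<lambda>x. f x j))"
  by (simp add: smooth_between_def smooth_on_def)

lemma smooth_on_continuous: "smooth_on n W f \<Longrightarrow> continuous_map (subtopology (Euclidean_space n) W) euclideanreal f"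
  using Ck_on_continuous unfolding smooth_on_def by blast

lemma smooth_on_cong:
  "openin (Euclidean_space n) W \<Longrightarrow> (\<And>x. x \<in> W \<Longrightarrow> f x = g x) \<Longrightarrow> smooth_on n W f \<Longrightarrow> smooth_on n W g"
  unfolding smooth_on_def using Ck_on_cong by blast

lemma smooth_on_subset: "smooth_on n W f \<Longrightarrow> W' \<subseteq> W \<Longrightarrow> smooth_on n W' f"
  unfolding smooth_on_def using Ck_on_subset by blast

lemma smooth_on_local:
  assumes "W \<subseteq> coord_space n"
    and "\<And>x. x \<in> W \<Longrightarrow> \<exists>W'. openin (Euclidean_space n) W' \<and> x \<in> W' \<and> smooth_on n (W' \<inter> W) f"
  shows "smooth_on n W f"
  unfolding smooth_on_def
proof
  fix k
  show "Ck_on k n W f"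
    by (rule Ck_on_local[OF assms(1)]) (use assms(2) in \<open>auto simp: smooth_on_def\<close>)
qed

lemma smooth_on_const: "smooth_on n W (\<lambda>x. c)"
  by (simp add: smooth_on_def Ck_on_const)

lemma smooth_on_coordinate: "smooth_on n W (\<lambda>x. x j)"
  by (simp add: smooth_on_def Ck_on_coordinate)

lemma smooth_on_add:
  "openin (Euclidean_space n) W \<Longrightarrow> smooth_on n W f \<Longrightarrow> smooth_on n W g \<Longrightarrow> smooth_on n W (\<lambda>x. f x + g x)"
  by (simp add: smooth_on_def Ck_on_add)

lemma smooth_on_mult:
  "openin (Euclidean_space n) W \<Longrightarrow> smooth_on n W f \<Longrightarrow> smooth_on n W g \<Longrightarrow> smooth_on n W (\<lambda>x. f x * g x)"
  by (simp add: smooth_on_def Ck_on_mult)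

lemma smooth_on_compose:
  assumes "openin (Euclidean_space n) V" "openin (Euclidean_space m) W" "f ` W \<subseteq> V"
    and "smooth_on n V g" "\<And>j. j < n \<Longrightarrow> smooth_on m W (\<lambda>x. f x j)"
  shows "smooth_on m W (g \<circ> f)"
  using assms Ck_on_compose[OF assms(1-3)] by (simp add: smooth_on_def)

lemma smooth_on_subspace:
  "m \<le> n \<Longrightarrow> smooth_on n W f \<Longrightarrow> smooth_on m (W \<inter> coord_space m) f"
  by (simp add: smooth_on_def Ck_on_subspace)

lemma jacobian_map_in_coord_space: "jacobian_map m n f x v \<in> coord_space n"
  by (simp add: jacobian_map_def coord_space_iff)

lemma jacobian_map_compose:
  assumes V: "openin (Euclidean_space n) V" and W: "openin (Euclidean_space m) W"
    and f: "smooth_between m n W f" and g: "smooth_between n p V g" and fW: "f ` W \<subseteq> V" and x: "x \<in> W"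
  shows "jacobian_map m p (g \<circ> f) x v = jacobian_map n p g (f x) (jacobian_map m n f x v)"
proof
  fix l
  have "(\<Sum>i<m. partial_deriv i (\<lambda>y. g (f y) l) x * v i) =
        (\<Sum>j<n. partial_deriv j (\<lambda>y. g y l) (f x) * (\<Sum>i<m. partial_deriv i (\<lambda>y. f y j) x * v i))" if l: "l < p"
  proof -
    note C1 = g[unfolded smooth_between_def, THEN conjunct2, rule_format, OF l, of "Suc 0"]
      f[unfolded smooth_between_def, THEN conjunct2, rule_format, of _ "Suc 0"]
    have "partial_deriv i (\<lambda>y. g (f y) l) x =
        (\<Sum>j<n. partial_deriv j (\<lambda>y. g y l) (f x) * partial_deriv i (\<lambda>y. f y j) x)" if "i < m" for i
      by (rule partial_deriv_eqI(2)[of "\<lambda>y. g (f y) l"], rule partial_deriv_compose[OF V W C1(1) _ fW that x])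
        (rule C1(2))
    then have "(\<Sum>i<m. partial_deriv i (\<lambda>y. g (f y) l) x * v i) =
        (\<Sum>i<m. \<Sum>j<n. partial_deriv j (\<lambda>y. g y l) (f x) * partial_deriv i (\<lambda>y. f y j) x * v i)"
      by (simp add: sum_distrib_right)
    also have "\<dots> = (\<Sum>j<n. \<Sum>i<m. partial_deriv j (\<lambda>y. g y l) (f x) * partial_deriv i (\<lambda>y. f y j) x * v i)"
      by (rule sum.swap)
    finally show ?thesis by (simp add: sum_distrib_left mult.assoc)
  qed
  then show "jacobian_map m p (g \<circ> f) x v l = jacobian_map n p g (f x) (jacobian_map m n f x v) l"
    by (simp add: jacobian_map_def)
qed

lemma jacobian_map_cong:
  assumes W: "openin (Euclidean_space m) W" and x: "x \<in> W" and fg: "\<And>y. y \<in> W \<Longrightarrow> f y = g y"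
  shows "jacobian_map m n f x v = jacobian_map m n g x v"
proof -
  have "partial_deriv i (\<lambda>y. f y j) x = partial_deriv i (\<lambda>y. g y j) x" if "i < m" for i j
    by (rule partial_deriv_cong[OF W x that]) (simp add: fg)
  then show ?thesis by (auto simp: jacobian_map_def intro!: ext sum.cong)
qed

lemma jacobian_map_id: "v \<in> coord_space m \<Longrightarrow> jacobian_map m m (\<lambda>y. y) x v = v"
  by (auto simp: jacobian_map_def partial_deriv_coordinate coord_space_iff fun_eq_iff mult_if_delta)

section \<open>Charts and smooth structures\<close>

lemma smooth_between_cong:
  assumes "openin (Euclidean_space m) W" "\<And>x. x \<in> W \<Longrightarrow> f x = g x" "smooth_between m n W f"
  shows "smooth_between m n W g"
  using assms(3) smooth_on_cong[OF assms(1), of "\<lambda>x. f x _" "\<lambda>x. g x _"] assms(2)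
  by (auto simp: smooth_between_iff image_subset_iff)

lemma smooth_between_subset: "smooth_between m n W f \<Longrightarrow> W' \<subseteq> W \<Longrightarrow> smooth_between m n W' f"
  unfolding smooth_between_iff using smooth_on_subset by blast

lemma smooth_between_local:
  assumes "W \<subseteq> coord_space m"
    and "\<And>x. x \<in> W \<Longrightarrow> \<exists>W'. openin (Euclidean_space m) W' \<and> x \<in> W' \<and> smooth_between m n (W' \<inter> W) f"
  shows "smooth_between m n W f"
  unfolding smooth_between_iff
proof (intro conjI allI impI)
  show "f ` W \<subseteq> coord_space n"
  proof
    fix y assume "y \<in> f ` W"
    then obtain x where "x \<in> W" "y = f x" by blast
    with assms(2)[of x] show "y \<in> coord_space n" by (auto simp: smooth_between_iff)
  qed
  fix j assume "j < n"
  then show "smooth_on m W (\<lambda>x. f x j)"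
    using smooth_on_local[OF assms(1)] assms(2) unfolding smooth_between_iff by meson
qed

lemma smooth_between_compose:
  assumes "openin (Euclidean_space n) V" "openin (Euclidean_space m) W" "f ` W \<subseteq> V"
    and "smooth_between m n W f" "smooth_between n p V g"
  shows "smooth_between m p W (g \<circ> f)"
  unfolding smooth_between_iff
proof (intro conjI allI impI)
  show "(g \<circ> f) ` W \<subseteq> coord_space p" using assms(3,5) by (auto simp: smooth_between_iff)
  fix j assume "j < p"
  then have "smooth_on m W ((\<lambda>y. g y j) \<circ> f)"
    using assms(4,5) by (intro smooth_on_compose[OF assms(1-3)]) (auto simp: smooth_between_iff)
  then show "smooth_on m W (\<lambda>x. (g \<circ> f) x j)" by (simp add: o_def)
qed

lemma smooth_between_ident: "W \<subseteq> coord_space n \<Longrightarrow> smooth_between n n W (\<lambda>x. x)"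
  by (simp add: smooth_between_iff smooth_on_coordinate)

text \<open>Transition maps are written with \<^const>\<open>inv_into\<close>, so the inverse of a chart is fixed to be this one.\<close>

lemma chart_homeomorphic_maps:
  assumes "is_chart n X (U, \<phi>)"
  shows "homeomorphic_maps (subtopology X U) (subtopology (Euclidean_space n) (\<phi> ` U)) \<phi> (inv_into U \<phi>)"
proof -
  have U: "U \<subseteq> topspace X" "\<phi> ` U \<subseteq> coord_space n"
    using assms openin_subset by (auto simp: is_chart_def)
  obtain g where g: "homeomorphic_maps (subtopology X U) (subtopology (Euclidean_space n) (\<phi> ` U)) \<phi> g"
    using assms by (auto simp: is_chart_def homeomorphic_map_maps)
  have gx: "g (\<phi> x) = x" if "x \<in> U" for x using g U that by (auto simp: homeomorphic_maps_def)
  then have "inj_on \<phi> U" by (rule inj_on_inverseI[of U g \<phi>])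
  then have "g y = inv_into U \<phi> y" if "y \<in> \<phi> ` U" for y using that gx by auto
  then show ?thesis
    using g U unfolding homeomorphic_maps_def
    by (auto intro: continuous_map_eq)
qed

lemma chart_facts:
  assumes "is_chart n X (U, \<phi>)"
  shows chart_open: "openin X U" and chart_open_image: "openin (Euclidean_space n) (\<phi> ` U)"
    and chart_subset: "U \<subseteq> topspace X" and chart_inj: "inj_on \<phi> U"
    and chart_continuous: "continuous_map (subtopology X U) (Euclidean_space n) \<phi>"
    and chart_inv_continuous: "continuous_map (subtopology (Euclidean_space n) (\<phi> ` U)) X (inv_into U \<phi>)"
    and chart_coord: "x \<in> U \<Longrightarrow> \<phi> x \<in> coord_space n"
    and chart_inv: "x \<in> U \<Longrightarrow> inv_into U \<phi> (\<phi> x) = x"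
proof -
  show o: "openin X U" "openin (Euclidean_space n) (\<phi> ` U)" using assms by (auto simp: is_chart_def)
  then show s: "U \<subseteq> topspace X" by (simp add: openin_subset)
  note h = chart_homeomorphic_maps[OF assms]
  show "inj_on \<phi> U" using h s by (intro inj_on_inverseI[of _ "inv_into U \<phi>"]) (auto simp: homeomorphic_maps_def)
  then show "x \<in> U \<Longrightarrow> inv_into U \<phi> (\<phi> x) = x" by simp
  show "continuous_map (subtopology X U) (Euclidean_space n) \<phi>"
       "continuous_map (subtopology (Euclidean_space n) (\<phi> ` U)) X (inv_into U \<phi>)"
    using h by (auto simp: homeomorphic_maps_def continuous_map_in_subtopology)
  show "x \<in> U \<Longrightarrow> \<phi> x \<in> coord_space n" using openin_subset[OF o(2)] by blast
qed

lemma chart_image_open: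
  assumes c: "is_chart n X (U, \<phi>)" and W: "openin X W" "W \<subseteq> U"
  shows "openin (Euclidean_space n) (\<phi> ` W)"
proof -
  have "homeomorphic_map (subtopology X U) (subtopology (Euclidean_space n) (\<phi> ` U)) \<phi>"
    using c by (simp add: is_chart_def)
  moreover have "openin (subtopology X U) W" using W by (metis inf.absorb_iff2 openin_subtopology_Int2)
  ultimately have "openin (subtopology (Euclidean_space n) (\<phi> ` U)) (\<phi> ` W)"
    using homeomorphic_imp_open_map open_map_def by blast
  then show ?thesis using chart_open_image[OF c] by (rule openin_trans_full)
qed

lemma is_chartI:
  assumes "openin X U" "openin (Euclidean_space n) (\<phi> ` U)" "inj_on \<phi> U"
    and "continuous_map (subtopology X U) (Euclidean_space n) \<phi>"
    and "continuous_map (subtopology (Euclidean_space n) (\<phi> ` U)) X (inv_into U \<phi>)"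
  shows "is_chart n X (U, \<phi>)"
proof -
  have "homeomorphic_maps (subtopology X U) (subtopology (Euclidean_space n) (\<phi> ` U)) \<phi> (inv_into U \<phi>)"
    using assms openin_subset by (auto simp: homeomorphic_maps_def continuous_map_in_subtopology inv_into_into)
  then show ?thesis using assms(1,2) homeomorphic_map_maps by (auto simp: is_chart_def)
qed

lemma chart_restrict:
  assumes c: "is_chart n X (U, \<phi>)" and W: "openin X W"
  shows "is_chart n X (U \<inter> W, \<phi>)"
proof (rule is_chartI)
  show "openin X (U \<inter> W)" using chart_open[OF c] W by blast
  then show "openin (Euclidean_space n) (\<phi> ` (U \<inter> W))" by (rule chart_image_open[OF c]) blast
  show "inj_on \<phi> (U \<inter> W)" using chart_inj[OF c] by (rule inj_on_subset) blast
  show "continuous_map (subtopology X (U \<inter> W)) (Euclidean_space n) \<phi>"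
    using chart_continuous[OF c] by (rule continuous_map_from_subtopology_mono) blast
  have "continuous_map (subtopology (Euclidean_space n) (\<phi> ` (U \<inter> W))) X (inv_into U \<phi>)"
    using chart_inv_continuous[OF c] by (rule continuous_map_from_subtopology_mono) blast
  then show "continuous_map (subtopology (Euclidean_space n) (\<phi> ` (U \<inter> W))) X (inv_into (U \<inter> W) \<phi>)"
  proof (rule continuous_map_eq)
    fix z assume "z \<in> topspace (subtopology (Euclidean_space n) (\<phi> ` (U \<inter> W)))"
    then obtain x where "x \<in> U \<inter> W" "z = \<phi> x" by auto
    then show "inv_into U \<phi> z = inv_into (U \<inter> W) \<phi> z"
      using chart_inv[OF c] \<open>inj_on \<phi> (U \<inter> W)\<close> by simp
  qed
qed

lemma inv_into_restrict: "inj_on \<phi> U \<Longrightarrow> W \<subseteq> U \<Longrightarrow> z \<in> \<phi> ` W \<Longrightarrow> inv_into W \<phi> z = inv_into U \<phi> z"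
  by (metis imageE inj_on_subset inv_into_f_f subsetD)

lemma is_chart_subtopology:
  assumes W: "openin X W"
  shows "is_chart n (subtopology X W) (U, \<phi>) \<longleftrightarrow> is_chart n X (U, \<phi>) \<and> U \<subseteq> W"
proof -
  have "openin (subtopology X W) U \<longleftrightarrow> openin X U \<and> U \<subseteq> W" using W by (rule openin_open_subtopology)
  moreover have "subtopology (subtopology X W) U = subtopology X U" if "U \<subseteq> W"
    using that by (simp add: subtopology_subtopology inf.absorb2)
  ultimately show ?thesis by (auto simp: is_chart_def)
qed

lemma compatible_charts_sym: "compatible_charts n c d \<Longrightarrow> compatible_charts n d c"
  by (cases c; cases d) (auto simp: compatible_charts_def Int_commute)

lemma compatible_chartsD:
  "compatible_charts n (U, \<phi>) (V, \<psi>) \<Longrightarrow> smooth_between n n (\<phi> ` (U \<inter> V)) (\<psi> \<circ> inv_into U \<phi>)"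
  by (simp add: compatible_charts_def)

lemma compatible_via_one_side:
  assumes c: "is_chart n X (U, \<phi>)" and c': "is_chart n X (U', \<phi>')"
    and B: "\<And>p. p \<in> U \<inter> U' \<Longrightarrow> \<exists>V \<psi>. is_chart n X (V, \<psi>) \<and> p \<in> V \<and>
        compatible_charts n (U, \<phi>) (V, \<psi>) \<and> compatible_charts n (V, \<psi>) (U', \<phi>')"
  shows "smooth_between n n (\<phi> ` (U \<inter> U')) (\<phi>' \<circ> inv_into U \<phi>)"
proof (rule smooth_between_local)
  show "\<phi> ` (U \<inter> U') \<subseteq> coord_space n" using chart_coord[OF c] by blast
  fix z assume "z \<in> \<phi> ` (U \<inter> U')"
  then obtain p where p: "p \<in> U \<inter> U'" "z = \<phi> p" by blast
  from B[OF p(1)] obtain V \<psi> where d: "is_chart n X (V, \<psi>)" "p \<in> V"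
    "compatible_charts n (U, \<phi>) (V, \<psi>)" "compatible_charts n (V, \<psi>) (U', \<phi>')" by blast
  let ?W = "U \<inter> U' \<inter> V"
  have W: "openin X ?W" using chart_open[OF c] chart_open[OF c'] chart_open[OF d(1)] by blast
  have W': "openin (Euclidean_space n) (\<phi> ` ?W)" by (rule chart_image_open[OF c W]) blast
  have V': "openin (Euclidean_space n) (\<psi> ` (V \<inter> U'))"
    by (rule chart_image_open[OF d(1)]) (use chart_open[OF c'] chart_open[OF d(1)] in blast)+
  have "smooth_between n n (\<phi> ` ?W) ((\<phi>' \<circ> inv_into V \<psi>) \<circ> (\<psi> \<circ> inv_into U \<phi>))"
  proof (rule smooth_between_compose[OF V' W'])
    show "(\<psi> \<circ> inv_into U \<phi>) ` \<phi> ` ?W \<subseteq> \<psi> ` (V \<inter> U')" using chart_inv[OF c] by auto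
    show "smooth_between n n (\<phi> ` ?W) (\<psi> \<circ> inv_into U \<phi>)"
      using compatible_chartsD[OF d(3)] by (rule smooth_between_subset) blast
    show "smooth_between n n (\<psi> ` (V \<inter> U')) (\<phi>' \<circ> inv_into V \<psi>)"
      using compatible_chartsD[OF d(4)] .
  qed
  then have "smooth_between n n (\<phi> ` ?W) (\<phi>' \<circ> inv_into U \<phi>)"
    by (rule smooth_between_cong[OF W', rotated]) (use chart_inv[OF c] chart_inv[OF d(1)] in auto)
  moreover have "\<phi> ` ?W \<inter> \<phi> ` (U \<inter> U') = \<phi> ` ?W" by blast
  ultimately show "\<exists>W'. openin (Euclidean_space n) W' \<and> z \<in> W' \<and>
      smooth_between n n (W' \<inter> \<phi> ` (U \<inter> U')) (\<phi>' \<circ> inv_into U \<phi>)"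
    using W' p d(2) by (intro exI[of _ "\<phi> ` ?W"]) auto
qed

text \<open>Compatibility is transitive through charts that cover the overlap, because a transition map
  factors locally through them.\<close>

lemma compatible_via:
  assumes c: "is_chart n X (U, \<phi>)" and c': "is_chart n X (U', \<phi>')"
    and B: "\<And>p. p \<in> U \<inter> U' \<Longrightarrow> \<exists>V \<psi>. is_chart n X (V, \<psi>) \<and> p \<in> V \<and>
        compatible_charts n (U, \<phi>) (V, \<psi>) \<and> compatible_charts n (V, \<psi>) (U', \<phi>')"
  shows "compatible_charts n (U, \<phi>) (U', \<phi>')"
proof -
  have "smooth_between n n (\<phi>' ` (U' \<inter> U)) (\<phi> \<circ> inv_into U' \<phi>')"
  proof (rule compatible_via_one_side[OF c' c])
    fix p assume "p \<in> U' \<inter> U"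
    with B[of p] show "\<exists>V \<psi>. is_chart n X (V, \<psi>) \<and> p \<in> V \<and>
        compatible_charts n (U', \<phi>') (V, \<psi>) \<and> compatible_charts n (V, \<psi>) (U, \<phi>)"
      using compatible_charts_sym by (metis Int_commute)
  qed
  then show ?thesis
    using compatible_via_one_side[OF c c' B] by (simp add: compatible_charts_def Int_commute)
qed

lemma compatible_restrict:
  assumes c: "is_chart n X (U, \<phi>)" and d: "is_chart n X (V, \<psi>)" and W: "openin X W"
    and cd: "compatible_charts n (U, \<phi>) (V, \<psi>)"
  shows "compatible_charts n (U \<inter> W, \<phi>) (V, \<psi>)"
proof -
  have o: "openin X (U \<inter> W \<inter> V)" using chart_open[OF c] chart_open[OF d] W by blast
  have o1: "openin (Euclidean_space n) (\<phi> ` (U \<inter> W \<inter> V))" by (rule chart_image_open[OF c o]) blast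
  have "smooth_between n n (\<phi> ` (U \<inter> W \<inter> V)) (\<psi> \<circ> inv_into U \<phi>)"
    using compatible_chartsD[OF cd] by (rule smooth_between_subset) blast
  moreover have "inv_into (U \<inter> W) \<phi> z = inv_into U \<phi> z" if "z \<in> \<phi> ` (U \<inter> W \<inter> V)" for z
    using that by (intro inv_into_restrict[OF chart_inj[OF c]]) auto
  ultimately have "smooth_between n n (\<phi> ` (U \<inter> W \<inter> V)) (\<psi> \<circ> inv_into (U \<inter> W) \<phi>)"
    by (intro smooth_between_cong[OF o1 _ \<open>smooth_between n n _ (\<psi> \<circ> inv_into U \<phi>)\<close>]) simp
  moreover have "smooth_between n n (\<psi> ` (U \<inter> W \<inter> V)) (\<phi> \<circ> inv_into V \<psi>)"
    using cd unfolding compatible_charts_def by (auto intro: smooth_between_subset)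
  ultimately show ?thesis by (simp add: compatible_charts_def)
qed

text \<open>The conditions on the atlas without separation and countability.  The theory of smooth maps rests on them, and the
  maximal atlas of any smooth atlas satisfies them.\<close>

definition smooth_structure :: "'a manifold \<Rightarrow> bool" where
  "smooth_structure M \<longleftrightarrow> smooth_atlas (mdim M) (mtop M) (charts M) \<and>
     maximal_atlas (mdim M) (mtop M) (charts M) \<subseteq> charts M"

lemma smooth_manifold_structure: "smooth_manifold M \<Longrightarrow> smooth_structure M"
  by (simp add: smooth_manifold_def smooth_structure_def)

text \<open>Two charts that are compatible with \<open>A\<close> are compatible with each other by \<open>compatible_via\<close>, since \<open>A\<close> covers.\<close>

lemma smooth_structure_maximal_atlas:
  assumes A: "smooth_atlas n X A"
  shows "smooth_structure \<lparr>mtop = X, mdim = n, charts = maximal_atlas n X A\<rparr>"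
    and "A \<subseteq> maximal_atlas n X A"
proof -
  show sub: "A \<subseteq> maximal_atlas n X A" using A by (auto simp: smooth_atlas_def maximal_atlas_def)
  have cover: "\<exists>V \<psi>. (V, \<psi>) \<in> A \<and> is_chart n X (V, \<psi>) \<and> p \<in> V" if "p \<in> topspace X" for p
    using A that unfolding smooth_atlas_def by (metis UN_E prod.collapse)
  have comp: "compatible_charts n (U, \<phi>) (U', \<phi>')"
    if c: "(U, \<phi>) \<in> maximal_atlas n X A" and c': "(U', \<phi>') \<in> maximal_atlas n X A" for U \<phi> U' \<phi>'
  proof (rule compatible_via)
    show "is_chart n X (U, \<phi>)" "is_chart n X (U', \<phi>')" using c c' by (auto simp: maximal_atlas_def)
    fix p assume "p \<in> U \<inter> U'"
    then have "p \<in> topspace X" using chart_subset[OF \<open>is_chart n X (U, \<phi>)\<close>] by blast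
    from cover[OF this] show "\<exists>V \<psi>. is_chart n X (V, \<psi>) \<and> p \<in> V \<and>
        compatible_charts n (U, \<phi>) (V, \<psi>) \<and> compatible_charts n (V, \<psi>) (U', \<phi>')"
      using c c' compatible_charts_sym by (simp add: maximal_atlas_def) blast
  qed
  have "smooth_atlas n X (maximal_atlas n X A)"
    unfolding smooth_atlas_def
  proof (intro conjI ballI)
    show "(\<Union>c\<in>maximal_atlas n X A. fst c) = topspace X"
    proof
      show "(\<Union>c\<in>maximal_atlas n X A. fst c) \<subseteq> topspace X"
        using chart_subset by (fastforce simp: maximal_atlas_def)
      show "topspace X \<subseteq> (\<Union>c\<in>maximal_atlas n X A. fst c)"
        using A sub unfolding smooth_atlas_def by (metis Sup_subset_mono image_mono)
    qed
    show "is_chart n X c" if "c \<in> maximal_atlas n X A" for c using that by (simp add: maximal_atlas_def)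
    show "compatible_charts n c d" if "c \<in> maximal_atlas n X A" "d \<in> maximal_atlas n X A" for c d
      using comp that by (cases c; cases d) simp
  qed
  moreover have "maximal_atlas n X (maximal_atlas n X A) \<subseteq> maximal_atlas n X A"
    using sub by (auto simp: maximal_atlas_def)
  ultimately show "smooth_structure \<lparr>mtop = X, mdim = n, charts = maximal_atlas n X A\<rparr>"
    by (simp add: smooth_structure_def)
qed

lemma structure_chart: "smooth_structure M \<Longrightarrow> c \<in> charts M \<Longrightarrow> is_chart (mdim M) (mtop M) c"
  by (simp add: smooth_structure_def smooth_atlas_def)

lemma structure_compatible:
  "smooth_structure M \<Longrightarrow> c \<in> charts M \<Longrightarrow> d \<in> charts M \<Longrightarrow> compatible_charts (mdim M) c d"
  by (simp add: smooth_structure_def smooth_atlas_def)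

lemma structure_cover:
  assumes "smooth_structure M" "p \<in> topspace (mtop M)"
  obtains U \<phi> where "(U, \<phi>) \<in> charts M" "p \<in> U"
proof -
  have "p \<in> (\<Union>c\<in>charts M. fst c)" using assms by (simp add: smooth_structure_def smooth_atlas_def)
  then show ?thesis using that by auto
qed

lemma structure_maximal:
  assumes "smooth_structure M" "is_chart (mdim M) (mtop M) c"
    "\<And>d. d \<in> charts M \<Longrightarrow> compatible_charts (mdim M) c d"
  shows "c \<in> charts M"
  using assms unfolding smooth_structure_def maximal_atlas_def by blast

lemma structure_restrict:
  assumes M: "smooth_structure M" and c: "(U, \<phi>) \<in> charts M" and W: "openin (mtop M) W"
  shows "(U \<inter> W, \<phi>) \<in> charts M"
proof (rule structure_maximal[OF M])
  note c1 = structure_chart[OF M c]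
  show "is_chart (mdim M) (mtop M) (U \<inter> W, \<phi>)" by (rule chart_restrict[OF c1 W])
  fix d assume d: "d \<in> charts M"
  then show "compatible_charts (mdim M) (U \<inter> W, \<phi>) d"
    using compatible_restrict[OF c1 _ W, of "fst d" "snd d"] structure_compatible[OF M c d] structure_chart[OF M d]
    by simp
qed

lemma structure_cover_within:
  assumes M: "smooth_structure M" and W: "openin (mtop M) W" "p \<in> W"
  obtains U \<phi> where "(U, \<phi>) \<in> charts M" "p \<in> U" "U \<subseteq> W"
proof -
  have "p \<in> topspace (mtop M)" using W openin_subset by blast
  then obtain U \<phi> where "(U, \<phi>) \<in> charts M" "p \<in> U" using structure_cover[OF M] by blast
  then show ?thesis using structure_restrict[OF M _ W(1)] W(2) that[of "U \<inter> W" \<phi>] by blast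
qed

lemma open_submanifold_simps [simp]:
  "mtop (open_submanifold M W) = subtopology (mtop M) W"
  "mdim (open_submanifold M W) = mdim M"
  "c \<in> charts (open_submanifold M W) \<longleftrightarrow> c \<in> charts M \<and> fst c \<subseteq> W"
  by (auto simp: open_submanifold_def)

lemma open_submanifold_open_submanifold:
  "W' \<subseteq> W \<Longrightarrow> open_submanifold (open_submanifold M W) W' = open_submanifold M W'"
  by (auto simp: open_submanifold_def subtopology_subtopology inf.absorb2)

text \<open>A chart inside \<open>W\<close> that is compatible with the charts inside \<open>W\<close> is compatible with every chart of \<open>M\<close>, because
  the overlap is covered by charts inside \<open>W\<close>.\<close>

lemma smooth_structure_open_submanifold:
  assumes M: "smooth_structure M" and W: "openin (mtop M) W"
  shows "smooth_structure (open_submanifold M W)"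
proof -
  let ?n = "mdim M" and ?X = "mtop M"
  have "smooth_atlas ?n (subtopology ?X W) (charts (open_submanifold M W))"
    unfolding smooth_atlas_def
  proof (intro conjI ballI)
    show "is_chart ?n (subtopology ?X W) c" if "c \<in> charts (open_submanifold M W)" for c
      using that structure_chart[OF M] is_chart_subtopology[OF W, of ?n "fst c" "snd c"] by simp
    show "compatible_charts ?n c d" if "c \<in> charts (open_submanifold M W)" "d \<in> charts (open_submanifold M W)" for c d
      using that structure_compatible[OF M] by simp
    show "(\<Union>c\<in>charts (open_submanifold M W). fst c) = topspace (subtopology ?X W)"
    proof
      show "(\<Union>c\<in>charts (open_submanifold M W). fst c) \<subseteq> topspace (subtopology ?X W)"
        using structure_chart[OF M] chart_subset by fastforce
      show "topspace (subtopology ?X W) \<subseteq> (\<Union>c\<in>charts (open_submanifold M W). fst c)"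
      proof
        fix p assume "p \<in> topspace (subtopology ?X W)"
        then have "p \<in> W" by simp
        then obtain U \<phi> where "(U, \<phi>) \<in> charts M" "p \<in> U" "U \<subseteq> W"
          using structure_cover_within[OF M W] by blast
        then show "p \<in> (\<Union>c\<in>charts (open_submanifold M W). fst c)" by force
      qed
    qed
  qed
  moreover have "c \<in> charts (open_submanifold M W)"
    if "c \<in> maximal_atlas ?n (subtopology ?X W) (charts (open_submanifold M W))" for c
  proof -
    obtain U \<phi> where c: "c = (U, \<phi>)" by (cases c)
    have c1: "is_chart ?n ?X (U, \<phi>)" "U \<subseteq> W"
      using that is_chart_subtopology[OF W] by (auto simp: c maximal_atlas_def)
    have "(U, \<phi>) \<in> charts M"
    proof (rule structure_maximal[OF M c1(1)])
      fix d assume d: "d \<in> charts M"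
      obtain U' \<phi>' where d': "d = (U', \<phi>')" by (cases d)
      show "compatible_charts ?n (U, \<phi>) d"
        unfolding d'
      proof (rule compatible_via[OF c1(1)])
        show "is_chart ?n ?X (U', \<phi>')" using structure_chart[OF M] d d' by simp
        fix p assume "p \<in> U \<inter> U'"
        then obtain V \<psi> where "(V, \<psi>) \<in> charts M" "p \<in> V" "V \<subseteq> W"
          using structure_cover_within[OF M W] c1(2) by blast
        then show "\<exists>V \<psi>. is_chart ?n ?X (V, \<psi>) \<and> p \<in> V \<and>
            compatible_charts ?n (U, \<phi>) (V, \<psi>) \<and> compatible_charts ?n (V, \<psi>) (U', \<phi>')"
          using that d d' structure_chart[OF M] structure_compatible[OF M]
          by (auto simp: c maximal_atlas_def intro!: exI[of _ V] exI[of _ \<psi>])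
      qed
    qed
    then show ?thesis using c c1 by simp
  qed
  ultimately show ?thesis by (auto simp: smooth_structure_def)
qed

section \<open>Smooth functions and smooth maps\<close>

definition smooth_fun :: "'a manifold \<Rightarrow> ('a \<Rightarrow> real) \<Rightarrow> bool" where
  "smooth_fun M f \<longleftrightarrow> (\<forall>(U, \<phi>)\<in>charts M. smooth_on (mdim M) (\<phi> ` U) (f \<circ> inv_into U \<phi>))"

lemma smooth_funD:
  "smooth_fun M f \<Longrightarrow> (U, \<phi>) \<in> charts M \<Longrightarrow> smooth_on (mdim M) (\<phi> ` U) (f \<circ> inv_into U \<phi>)"
  by (auto simp: smooth_fun_def)

lemma smooth_fun_restrict: "smooth_fun M f \<Longrightarrow> smooth_fun (open_submanifold M W) f"
  by (auto simp: smooth_fun_def)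

text \<open>Smoothness in one chart around a point implies smoothness near this point in every other chart, because the
  transition map is smooth.\<close>

lemma smooth_fun_atlasI:
  assumes M: "smooth_structure M"
    and f: "\<And>p. p \<in> topspace (mtop M) \<Longrightarrow>
      \<exists>U \<phi>. (U, \<phi>) \<in> charts M \<and> p \<in> U \<and> smooth_on (mdim M) (\<phi> ` U) (f \<circ> inv_into U \<phi>)"
  shows "smooth_fun M f"
  unfolding smooth_fun_def
proof clarify
  fix U' \<phi>' assume c': "(U', \<phi>') \<in> charts M"
  let ?n = "mdim M" and ?X = "mtop M"
  note c'1 = structure_chart[OF M c']
  show "smooth_on ?n (\<phi>' ` U') (f \<circ> inv_into U' \<phi>')"
  proof (rule smooth_on_local)
    show "\<phi>' ` U' \<subseteq> coord_space ?n" using chart_coord[OF c'1] by blast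
    fix z assume "z \<in> \<phi>' ` U'"
    then obtain p where p: "p \<in> U'" "z = \<phi>' p" by blast
    then obtain U \<phi> where c: "(U, \<phi>) \<in> charts M" "p \<in> U" "smooth_on ?n (\<phi> ` U) (f \<circ> inv_into U \<phi>)"
      using f chart_subset[OF c'1] by blast
    note c1 = structure_chart[OF M c(1)]
    have "openin ?X (U' \<inter> U)" using chart_open[OF c1] chart_open[OF c'1] by blast
    then have W: "openin (Euclidean_space ?n) (\<phi>' ` (U' \<inter> U))" by (rule chart_image_open[OF c'1]) blast
    have "smooth_on ?n (\<phi>' ` (U' \<inter> U)) ((f \<circ> inv_into U \<phi>) \<circ> (\<phi> \<circ> inv_into U' \<phi>'))"
    proof (rule smooth_on_compose[OF chart_open_image[OF c1] W _ c(3)])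
      show "(\<phi> \<circ> inv_into U' \<phi>') ` \<phi>' ` (U' \<inter> U) \<subseteq> \<phi> ` U" using chart_inv[OF c'1] by auto
      show "smooth_on ?n (\<phi>' ` (U' \<inter> U)) (\<lambda>x. (\<phi> \<circ> inv_into U' \<phi>') x j)" if "j < ?n" for j
        using compatible_chartsD[OF structure_compatible[OF M c' c(1)]] that by (simp add: smooth_between_iff)
    qed
    then have "smooth_on ?n (\<phi>' ` (U' \<inter> U)) (f \<circ> inv_into U' \<phi>')"
      by (rule smooth_on_cong[OF W, rotated]) (use chart_inv[OF c'1] chart_inv[OF c1] in auto)
    moreover have "\<phi>' ` (U' \<inter> U) \<inter> \<phi>' ` U' = \<phi>' ` (U' \<inter> U)" by blast
    ultimately show "\<exists>W. openin (Euclidean_space ?n) W \<and> z \<in> W \<and> smooth_on ?n (W \<inter> \<phi>' ` U') (f \<circ> inv_into U' \<phi>')"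
      using W p c(2) by (intro exI[of _ "\<phi>' ` (U' \<inter> U)"]) auto
  qed
qed

lemma smooth_fun_local:
  assumes M: "smooth_structure M"
    and f: "\<And>p. p \<in> topspace (mtop M) \<Longrightarrow> \<exists>W. openin (mtop M) W \<and> p \<in> W \<and> smooth_fun (open_submanifold M W) f"
  shows "smooth_fun M f"
proof (rule smooth_fun_atlasI[OF M])
  fix p assume "p \<in> topspace (mtop M)"
  then obtain W where W: "openin (mtop M) W" "p \<in> W" "smooth_fun (open_submanifold M W) f" using f by blast
  then obtain U \<phi> where c: "(U, \<phi>) \<in> charts M" "p \<in> U" "U \<subseteq> W" using structure_cover_within[OF M] by blast
  then show "\<exists>U \<phi>. (U, \<phi>) \<in> charts M \<and> p \<in> U \<and> smooth_on (mdim M) (\<phi> ` U) (f \<circ> inv_into U \<phi>)"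
    using smooth_funD[OF W(3), of U \<phi>] by auto
qed

lemma smooth_fun_cong:
  assumes M: "smooth_structure M" and fg: "\<And>p. p \<in> topspace (mtop M) \<Longrightarrow> f p = g p" and f: "smooth_fun M f"
  shows "smooth_fun M g"
  unfolding smooth_fun_def
proof clarify
  fix U \<phi> assume c: "(U, \<phi>) \<in> charts M"
  note c1 = structure_chart[OF M c]
  show "smooth_on (mdim M) (\<phi> ` U) (g \<circ> inv_into U \<phi>)"
    by (rule smooth_on_cong[OF chart_open_image[OF c1] _ smooth_funD[OF f c]])
      (use fg chart_subset[OF c1] chart_inv[OF c1] in auto)
qed

lemma smooth_fun_of_smooth_on:
  assumes M: "smooth_structure M" and V: "openin (Euclidean_space n) V" and h: "smooth_on n V h"
    and F: "\<And>p. p \<in> topspace (mtop M) \<Longrightarrow> F p \<in> V" "\<And>j. j < n \<Longrightarrow> smooth_fun M (\<lambda>p. F p j)"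
  shows "smooth_fun M (\<lambda>p. h (F p))"
  unfolding smooth_fun_def
proof clarify
  fix U \<phi> assume c: "(U, \<phi>) \<in> charts M"
  note c1 = structure_chart[OF M c]
  have "smooth_on (mdim M) (\<phi> ` U) (h \<circ> (F \<circ> inv_into U \<phi>))"
  proof (rule smooth_on_compose[OF V chart_open_image[OF c1] _ h])
    show "(F \<circ> inv_into U \<phi>) ` \<phi> ` U \<subseteq> V" using F(1) chart_inv[OF c1] chart_subset[OF c1] by auto
    show "smooth_on (mdim M) (\<phi> ` U) (\<lambda>x. (F \<circ> inv_into U \<phi>) x j)" if "j < n" for j
      using smooth_funD[OF F(2)[OF that] c] by (simp add: o_def)
  qed
  then show "smooth_on (mdim M) (\<phi> ` U) ((\<lambda>p. h (F p)) \<circ> inv_into U \<phi>)" by (simp add: o_def)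
qed

lemma smooth_fun_const: "smooth_fun M (\<lambda>p. c)"
  by (auto simp: smooth_fun_def o_def smooth_on_const)

lemma smooth_fun_add:
  assumes "smooth_structure M" "smooth_fun M f" "smooth_fun M g"
  shows "smooth_fun M (\<lambda>p. f p + g p)"
  using assms smooth_on_add[OF chart_open_image[OF structure_chart[OF assms(1)]]]
  by (fastforce simp: smooth_fun_def o_def)

lemma smooth_fun_mult:
  assumes "smooth_structure M" "smooth_fun M f" "smooth_fun M g"
  shows "smooth_fun M (\<lambda>p. f p * g p)"
  using assms smooth_on_mult[OF chart_open_image[OF structure_chart[OF assms(1)]]]
  by (fastforce simp: smooth_fun_def o_def)

lemma smooth_fun_continuous:
  assumes M: "smooth_structure M" and f: "smooth_fun M f"
  shows "continuous_map (mtop M) euclideanreal f"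
proof (rule continuous_map_local)
  fix p assume "p \<in> topspace (mtop M)"
  then obtain U \<phi> where c: "(U, \<phi>) \<in> charts M" "p \<in> U" using structure_cover[OF M] by blast
  note c1 = structure_chart[OF M c(1)]
  have "continuous_map (subtopology (mtop M) U) (subtopology (Euclidean_space (mdim M)) (\<phi> ` U)) \<phi>"
    using chart_continuous[OF c1] by (auto simp: continuous_map_in_subtopology)
  then have "continuous_map (subtopology (mtop M) U) euclideanreal ((f \<circ> inv_into U \<phi>) \<circ> \<phi>)"
    using smooth_on_continuous[OF smooth_funD[OF f c(1)]] by (rule continuous_map_compose)
  then have "continuous_map (subtopology (mtop M) U) euclideanreal f"
    by (rule continuous_map_eq) (use chart_inv[OF c1] in auto)
  then show "\<exists>W. openin (mtop M) W \<and> p \<in> W \<and> continuous_map (subtopology (mtop M) W) euclideanreal f"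
    using chart_open[OF c1] c(2) by blast
qed

lemma smooth_map_continuous: "smooth_map M N f \<Longrightarrow> continuous_map (mtop M) (mtop N) f"
  by (simp add: smooth_map_def)

lemma smooth_map_in_topspace:
  "smooth_map M N f \<Longrightarrow> p \<in> topspace (mtop M) \<Longrightarrow> f p \<in> topspace (mtop N)"
  by (auto simp: smooth_map_def continuous_map_def)

lemma smooth_map_preimage_open:
  assumes "smooth_map M N f" "openin (mtop N) V"
  shows "openin (mtop M) (topspace (mtop M) \<inter> f -` V)"
  using openin_continuous_map_preimage[OF smooth_map_continuous[OF assms(1)] assms(2)]
  by (simp add: vimage_def Collect_conj_eq)

lemma smooth_mapD:
  "smooth_map M N f \<Longrightarrow> (U, \<phi>) \<in> charts M \<Longrightarrow> (V, \<psi>) \<in> charts N \<Longrightarrow>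
   smooth_between (mdim M) (mdim N) (\<phi> ` (U \<inter> f -` V)) (\<psi> \<circ> f \<circ> inv_into U \<phi>)"
  by (auto simp: smooth_map_def)

lemma smooth_map_restrict: "smooth_map M N f \<Longrightarrow> smooth_map (open_submanifold M W) N f"
  by (auto simp: smooth_map_def continuous_map_from_subtopology)

lemma smooth_map_restrict_mono:
  "smooth_map (open_submanifold M W) N f \<Longrightarrow> W' \<subseteq> W \<Longrightarrow> smooth_map (open_submanifold M W') N f"
  using smooth_map_restrict open_submanifold_open_submanifold by metis

lemma smooth_map_corestrict:
  "smooth_map M N f \<Longrightarrow> (\<And>p. p \<in> topspace (mtop M) \<Longrightarrow> f p \<in> V) \<Longrightarrow> smooth_map M (open_submanifold N V) f"
  unfolding smooth_map_def by (fastforce simp: continuous_map_in_subtopology)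

text \<open>The converse of \<open>smooth_mapI\<close> below.  Coordinates with index at least the dimension of \<open>N\<close> are constantly 0, so
  \<open>j\<close> is arbitrary.\<close>

lemma smooth_map_coordinate:
  assumes M: "smooth_structure M" and N: "smooth_structure N" and f: "smooth_map M N f"
    and d: "(V, \<psi>) \<in> charts N" and V: "\<And>p. p \<in> topspace (mtop M) \<Longrightarrow> f p \<in> V"
  shows "smooth_fun M (\<lambda>p. \<psi> (f p) j)"
proof (cases "j < mdim N")
  case True
  show ?thesis
    unfolding smooth_fun_def
  proof clarify
    fix U \<phi> assume c: "(U, \<phi>) \<in> charts M"
    have "U \<inter> f -` V = U" using V chart_subset[OF structure_chart[OF M c]] by blast
    then show "smooth_on (mdim M) (\<phi> ` U) ((\<lambda>p. \<psi> (f p) j) \<circ> inv_into U \<phi>)"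
      using smooth_mapD[OF f c d] True by (simp add: smooth_between_iff o_def)
  qed
next
  case False
  show ?thesis
  proof (rule smooth_fun_cong[OF M _ smooth_fun_const[of M 0]])
    fix p assume "p \<in> topspace (mtop M)"
    then have "\<psi> (f p) \<in> coord_space (mdim N)" using V chart_coord[OF structure_chart[OF N d]] by blast
    then show "0 = \<psi> (f p) j" using False by (simp add: coord_space_iff)
  qed
qed

text \<open>Charts of \<open>N\<close> differ by smooth transition maps, so one chart around each point of the image decides.  Continuity
  follows because \<open>f\<close> is locally the inverse of a chart after continuous coordinates.\<close>

lemma smooth_mapI:
  assumes M: "smooth_structure M" and N: "smooth_structure N"
    and f: "\<And>p. p \<in> topspace (mtop M) \<Longrightarrow> \<exists>W V \<psi>. openin (mtop M) W \<and> p \<in> W \<and> (V, \<psi>) \<in> charts N \<and>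
        f ` W \<subseteq> V \<and> (\<forall>j<mdim N. smooth_fun (open_submanifold M W) (\<lambda>q. \<psi> (f q) j))"
  shows "smooth_map M N f"
proof -
  let ?m = "mdim M" and ?n = "mdim N"
  have cont: "continuous_map (mtop M) (mtop N) f"
  proof (rule continuous_map_local)
    fix p assume "p \<in> topspace (mtop M)"
    then obtain W V \<psi> where W: "openin (mtop M) W" "p \<in> W" "(V, \<psi>) \<in> charts N" "f ` W \<subseteq> V"
      "\<And>j. j < ?n \<Longrightarrow> smooth_fun (open_submanifold M W) (\<lambda>q. \<psi> (f q) j)" using f by meson
    note d1 = structure_chart[OF N W(3)]
    have "continuous_map (subtopology (mtop M) W) (Euclidean_space ?n) (\<lambda>q. \<psi> (f q))"
      using smooth_fun_continuous[OF smooth_structure_open_submanifold[OF M W(1)] W(5)] chart_coord[OF d1] W(4)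
      by (intro continuous_map_into_Euclidean_space) auto
    then have "continuous_map (subtopology (mtop M) W) (subtopology (Euclidean_space ?n) (\<psi> ` V)) (\<lambda>q. \<psi> (f q))"
      using W(4) by (auto simp: continuous_map_in_subtopology)
    then have "continuous_map (subtopology (mtop M) W) (mtop N) (inv_into V \<psi> \<circ> (\<lambda>q. \<psi> (f q)))"
      using chart_inv_continuous[OF d1] by (rule continuous_map_compose)
    then have "continuous_map (subtopology (mtop M) W) (mtop N) f"
      by (rule continuous_map_eq) (use chart_inv[OF d1] W(4) in auto)
    then show "\<exists>W. openin (mtop M) W \<and> p \<in> W \<and> continuous_map (subtopology (mtop M) W) (mtop N) f"
      using W by blast
  qed
  moreover have "smooth_between ?m ?n (\<phi> ` (U \<inter> f -` V')) (\<psi>' \<circ> f \<circ> inv_into U \<phi>)"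
    if c: "(U, \<phi>) \<in> charts M" and d': "(V', \<psi>') \<in> charts N" for U \<phi> V' \<psi>'
  proof (rule smooth_between_local)
    note c1 = structure_chart[OF M c] and d'1 = structure_chart[OF N d']
    show "\<phi> ` (U \<inter> f -` V') \<subseteq> coord_space ?m" using chart_coord[OF c1] by blast
    fix z assume "z \<in> \<phi> ` (U \<inter> f -` V')"
    then obtain p where p: "p \<in> U" "f p \<in> V'" "z = \<phi> p" by blast
    then obtain W V \<psi> where W: "openin (mtop M) W" "p \<in> W" "(V, \<psi>) \<in> charts N" "f ` W \<subseteq> V"
      "\<And>j. j < ?n \<Longrightarrow> smooth_fun (open_submanifold M W) (\<lambda>q. \<psi> (f q) j)"
      using f chart_subset[OF c1] by (meson subsetD)
    note d1 = structure_chart[OF N W(3)]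
    let ?W = "U \<inter> W \<inter> f -` V'"
    have eq: "U \<inter> W \<inter> f -` V' = (U \<inter> W) \<inter> (topspace (mtop M) \<inter> f -` V')"
      using chart_subset[OF c1] by blast
    have "openin (mtop M) (topspace (mtop M) \<inter> f -` V')"
      using openin_continuous_map_preimage[OF cont chart_open[OF d'1]] by (simp add: vimage_def Collect_conj_eq)
    then have "openin (mtop M) ?W" unfolding eq using chart_open[OF c1] W(1) openin_Int by blast
    then have W': "openin (Euclidean_space ?m) (\<phi> ` ?W)" by (rule chart_image_open[OF c1]) blast
    have V: "openin (Euclidean_space ?n) (\<psi> ` (V \<inter> V'))"
      by (rule chart_image_open[OF d1]) (use chart_open[OF d1] chart_open[OF d'1] in blast)+
    have cW: "(U \<inter> W, \<phi>) \<in> charts (open_submanifold M W)" using structure_restrict[OF M c W(1)] by simp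
    have inv: "inv_into (U \<inter> W) \<phi> y = inv_into U \<phi> y" if "y \<in> \<phi> ` ?W" for y
      using that by (intro inv_into_restrict[OF chart_inj[OF c1]]) auto
    have "smooth_between ?m ?n (\<phi> ` ?W) ((\<psi>' \<circ> inv_into V \<psi>) \<circ> (\<psi> \<circ> f \<circ> inv_into (U \<inter> W) \<phi>))"
    proof (rule smooth_between_compose[OF V W'])
      show "(\<psi> \<circ> f \<circ> inv_into (U \<inter> W) \<phi>) ` \<phi> ` ?W \<subseteq> \<psi> ` (V \<inter> V')"
        using inv chart_inv[OF c1] W(4) by auto
      show "smooth_between ?n ?n (\<psi> ` (V \<inter> V')) (\<psi>' \<circ> inv_into V \<psi>)"
        by (rule compatible_chartsD[OF structure_compatible[OF N W(3) d']])
      have "smooth_on ?m (\<phi> ` ?W) ((\<lambda>q. \<psi> (f q) j) \<circ> inv_into (U \<inter> W) \<phi>)" if "j < ?n" for j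
        using smooth_on_subset[OF smooth_funD[OF W(5)[OF that] cW], of "\<phi> ` ?W"] by auto
      moreover have "(\<psi> \<circ> f \<circ> inv_into (U \<inter> W) \<phi>) ` \<phi> ` ?W \<subseteq> coord_space ?n"
        using inv chart_inv[OF c1] W(4) chart_coord[OF d1] by auto
      ultimately show "smooth_between ?m ?n (\<phi> ` ?W) (\<psi> \<circ> f \<circ> inv_into (U \<inter> W) \<phi>)"
        by (simp add: smooth_between_iff o_def)
    qed
    then have "smooth_between ?m ?n (\<phi> ` ?W) (\<psi>' \<circ> f \<circ> inv_into U \<phi>)"
      by (rule smooth_between_cong[OF W', rotated]) (use inv chart_inv[OF c1] chart_inv[OF d1] W(4) in auto)
    moreover have "\<phi> ` ?W \<inter> \<phi> ` (U \<inter> f -` V') = \<phi> ` ?W" by blast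
    ultimately show "\<exists>W'. openin (Euclidean_space ?m) W' \<and> z \<in> W' \<and>
        smooth_between ?m ?n (W' \<inter> \<phi> ` (U \<inter> f -` V')) (\<psi>' \<circ> f \<circ> inv_into U \<phi>)"
      using W' p W(2) by (intro exI[of _ "\<phi> ` ?W"]) auto
  qed
  ultimately show ?thesis by (auto simp: smooth_map_def)
qed

lemma smooth_fun_compose:
  assumes M: "smooth_structure M" and N: "smooth_structure N" and f: "smooth_map M N f" and g: "smooth_fun N g"
  shows "smooth_fun M (\<lambda>p. g (f p))"
proof (rule smooth_fun_local[OF M])
  fix p assume p: "p \<in> topspace (mtop M)"
  then obtain V \<psi> where d: "(V, \<psi>) \<in> charts N" "f p \<in> V"
    using structure_cover[OF N] smooth_map_in_topspace[OF f] by blast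
  note d1 = structure_chart[OF N d(1)]
  let ?W = "topspace (mtop M) \<inter> f -` V"
  have W: "openin (mtop M) ?W" by (rule smooth_map_preimage_open[OF f chart_open[OF d1]])
  note MW = smooth_structure_open_submanifold[OF M W]
  have "smooth_fun (open_submanifold M ?W) (\<lambda>q. (g \<circ> inv_into V \<psi>) (\<psi> (f q)))"
  proof (rule smooth_fun_of_smooth_on[OF MW chart_open_image[OF d1] smooth_funD[OF g d(1)]])
    show "smooth_fun (open_submanifold M ?W) (\<lambda>q. \<psi> (f q) j)" for j
      by (rule smooth_map_coordinate[OF MW N smooth_map_restrict[OF f] d(1)]) auto
  qed auto
  then have "smooth_fun (open_submanifold M ?W) (\<lambda>q. g (f q))"
    by (rule smooth_fun_cong[OF MW, rotated]) (use chart_inv[OF d1] in auto)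
  then show "\<exists>W. openin (mtop M) W \<and> p \<in> W \<and> smooth_fun (open_submanifold M W) (\<lambda>q. g (f q))"
    using W p d(2) by (intro exI[of _ ?W]) auto
qed

lemma smooth_map_compose:
  assumes M: "smooth_structure M" and N: "smooth_structure N" and P: "smooth_structure P"
    and f: "smooth_map M N f" and g: "smooth_map N P g"
  shows "smooth_map M P (\<lambda>p. g (f p))"
proof (rule smooth_mapI[OF M P])
  fix p assume p: "p \<in> topspace (mtop M)"
  then obtain V \<psi> where d: "(V, \<psi>) \<in> charts P" "g (f p) \<in> V"
    using structure_cover[OF P smooth_map_in_topspace[OF g smooth_map_in_topspace[OF f]]] by blast
  note d1 = structure_chart[OF P d(1)]
  let ?W2 = "topspace (mtop N) \<inter> g -` V"
  have W2: "openin (mtop N) ?W2" by (rule smooth_map_preimage_open[OF g chart_open[OF d1]])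
  let ?W = "topspace (mtop M) \<inter> f -` ?W2"
  have W: "openin (mtop M) ?W" by (rule smooth_map_preimage_open[OF f W2])
  note MW = smooth_structure_open_submanifold[OF M W] and NW = smooth_structure_open_submanifold[OF N W2]
  have "smooth_fun (open_submanifold M ?W) (\<lambda>q. \<psi> (g (f q)) j)" for j
  proof (rule smooth_fun_compose[OF MW NW])
    show "smooth_map (open_submanifold M ?W) (open_submanifold N ?W2) f"
      by (rule smooth_map_corestrict[OF smooth_map_restrict[OF f]]) auto
    show "smooth_fun (open_submanifold N ?W2) (\<lambda>q. \<psi> (g q) j)"
      by (rule smooth_map_coordinate[OF NW P smooth_map_restrict[OF g] d(1)]) auto
  qed
  then show "\<exists>W V \<psi>. openin (mtop M) W \<and> p \<in> W \<and> (V, \<psi>) \<in> charts P \<and> (\<lambda>p. g (f p)) ` W \<subseteq> V \<and>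
      (\<forall>j<mdim P. smooth_fun (open_submanifold M W) (\<lambda>q. \<psi> (g (f q)) j))"
    using W p d smooth_map_in_topspace[OF f p]
    by (intro exI[of _ ?W] exI[of _ V] exI[of _ \<psi>]) auto
qed

lemma smooth_map_local:
  assumes M: "smooth_structure M" and N: "smooth_structure N"
    and f: "\<And>p. p \<in> topspace (mtop M) \<Longrightarrow> \<exists>W. openin (mtop M) W \<and> p \<in> W \<and> smooth_map (open_submanifold M W) N f"
  shows "smooth_map M N f"
proof (rule smooth_mapI[OF M N])
  fix p assume p: "p \<in> topspace (mtop M)"
  then obtain W where W: "openin (mtop M) W" "p \<in> W" "smooth_map (open_submanifold M W) N f" using f by blast
  obtain V \<psi> where d: "(V, \<psi>) \<in> charts N" "f p \<in> V"
    using structure_cover[OF N smooth_map_in_topspace[OF W(3), of p]] W(2) p by auto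
  note d1 = structure_chart[OF N d(1)]
  let ?W = "topspace (mtop (open_submanifold M W)) \<inter> f -` V"
  have "openin (mtop (open_submanifold M W)) ?W" by (rule smooth_map_preimage_open[OF W(3) chart_open[OF d1]])
  then have W': "openin (mtop M) ?W" using W(1) by (auto intro: openin_trans_full)
  note MW = smooth_structure_open_submanifold[OF M W']
  have "smooth_map (open_submanifold M ?W) N f" using W(3) by (rule smooth_map_restrict_mono) auto
  then have "smooth_fun (open_submanifold M ?W) (\<lambda>q. \<psi> (f q) j)" for j
    by (rule smooth_map_coordinate[OF MW N _ d(1)]) auto
  then show "\<exists>W V \<psi>. openin (mtop M) W \<and> p \<in> W \<and> (V, \<psi>) \<in> charts N \<and> f ` W \<subseteq> V \<and>
      (\<forall>j<mdim N. smooth_fun (open_submanifold M W) (\<lambda>q. \<psi> (f q) j))"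
    using W' W(2) p d by (intro exI[of _ ?W] exI[of _ V] exI[of _ \<psi>]) auto
qed

lemma smooth_map_cong:
  assumes M: "smooth_structure M" and N: "smooth_structure N" and fg: "\<And>p. p \<in> topspace (mtop M) \<Longrightarrow> f p = g p"
    and f: "smooth_map M N f"
  shows "smooth_map M N g"
proof (rule smooth_mapI[OF M N])
  fix p assume p: "p \<in> topspace (mtop M)"
  then obtain V \<psi> where d: "(V, \<psi>) \<in> charts N" "f p \<in> V"
    using structure_cover[OF N] smooth_map_in_topspace[OF f] by blast
  let ?W = "topspace (mtop M) \<inter> f -` V"
  have W: "openin (mtop M) ?W" by (rule smooth_map_preimage_open[OF f chart_open[OF structure_chart[OF N d(1)]]])
  note MW = smooth_structure_open_submanifold[OF M W]
  have "smooth_fun (open_submanifold M ?W) (\<lambda>q. \<psi> (f q) j)" for j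
    by (rule smooth_map_coordinate[OF MW N smooth_map_restrict[OF f] d(1)]) auto
  then have "smooth_fun (open_submanifold M ?W) (\<lambda>q. \<psi> (g q) j)" for j
    by (rule smooth_fun_cong[OF MW, rotated]) (use fg in auto)
  then show "\<exists>W V \<psi>. openin (mtop M) W \<and> p \<in> W \<and> (V, \<psi>) \<in> charts N \<and> g ` W \<subseteq> V \<and>
      (\<forall>j<mdim N. smooth_fun (open_submanifold M W) (\<lambda>q. \<psi> (g q) j))"
    using W p d fg by (intro exI[of _ ?W] exI[of _ V] exI[of _ \<psi>]) auto
qed

lemma smooth_map_ident: "smooth_structure M \<Longrightarrow> smooth_map M M (\<lambda>p. p)"
  unfolding smooth_map_def
proof (intro conjI, simp, clarify)
  fix U \<phi> V \<psi> assume "smooth_structure M" "(U, \<phi>) \<in> charts M" "(V, \<psi>) \<in> charts M"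
  from compatible_chartsD[OF structure_compatible[OF this]]
  show "smooth_between (mdim M) (mdim M) (\<phi> ` (U \<inter> (\<lambda>p. p) -` V)) (\<psi> \<circ> (\<lambda>p. p) \<circ> inv_into U \<phi>)"
    by (simp add: o_def)
qed

lemma smooth_map_const:
  assumes M: "smooth_structure M" and N: "smooth_structure N" and q: "q \<in> topspace (mtop N)"
  shows "smooth_map M N (\<lambda>p. q)"
proof (rule smooth_mapI[OF M N])
  fix p assume "p \<in> topspace (mtop M)"
  then show "\<exists>W V \<psi>. openin (mtop M) W \<and> p \<in> W \<and> (V, \<psi>) \<in> charts N \<and> (\<lambda>p. q) ` W \<subseteq> V \<and>
      (\<forall>j<mdim N. smooth_fun (open_submanifold M W) (\<lambda>_. \<psi> q j))"
    using structure_cover[OF N q] smooth_fun_const openin_topspace by (metis image_subsetI)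
qed

lemma smooth_map_inclusion:
  "smooth_structure M \<Longrightarrow> smooth_map (open_submanifold M W) M (\<lambda>p. p)"
  using smooth_map_restrict[OF smooth_map_ident] .

lemma chart_coordinate_smooth:
  assumes N: "smooth_structure N" and d: "(V, \<psi>) \<in> charts N"
  shows "smooth_fun (open_submanifold N V) (\<lambda>q. \<psi> q j)"
  using smooth_map_coordinate[OF smooth_structure_open_submanifold[OF N chart_open[OF structure_chart[OF N d]]] N
      smooth_map_inclusion[OF N] d, where j = j] by simp

section \<open>Euclidean space as a manifold\<close>

definition euclidean_manifold :: "nat \<Rightarrow> (nat \<Rightarrow> real) manifold" where
  "euclidean_manifold n = \<lparr>mtop = Euclidean_space n, mdim = n,
     charts = maximal_atlas n (Euclidean_space n) {(coord_space n, \<lambda>x. x)}\<rparr>"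

lemma euclidean_manifold_simps [simp]:
  "mtop (euclidean_manifold n) = Euclidean_space n" "mdim (euclidean_manifold n) = n"
  by (simp_all add: euclidean_manifold_def)

lemma inv_into_ident: "z \<in> S \<Longrightarrow> inv_into S (\<lambda>x. x) z = z"
  using inv_into_f_f[of "\<lambda>x. x" S z] by (simp add: inj_on_def)

lemma euclidean_atlas: "smooth_atlas n (Euclidean_space n) {(coord_space n, \<lambda>x. x)}"
proof -
  have "is_chart n (Euclidean_space n) (coord_space n, \<lambda>x. x)"
  proof (rule is_chartI)
    have "continuous_map (Euclidean_space n) (Euclidean_space n) (inv_into (coord_space n) (\<lambda>x. x))"
      by (rule continuous_map_eq[OF continuous_map_id]) (simp add: inv_into_ident)
    then show "continuous_map (subtopology (Euclidean_space n) ((\<lambda>x. x) ` coord_space n)) (Euclidean_space n)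
        (inv_into (coord_space n) (\<lambda>x. x))" by simp
  qed (simp_all add: inj_on_def)
  moreover have "compatible_charts n (coord_space n, \<lambda>x. x) (coord_space n, \<lambda>x. x)"
  proof -
    have "smooth_between n n (coord_space n) (inv_into (coord_space n) (\<lambda>x. x))"
      by (rule smooth_between_cong[OF _ _ smooth_between_ident]) (simp_all add: inv_into_ident)
    then show ?thesis by (simp add: compatible_charts_def o_def)
  qed
  ultimately show ?thesis by (simp add: smooth_atlas_def)
qed

lemma smooth_structure_euclidean: "smooth_structure (euclidean_manifold n)"
  unfolding euclidean_manifold_def by (rule smooth_structure_maximal_atlas[OF euclidean_atlas])

lemma euclidean_chart:
  assumes "openin (Euclidean_space n) W"
  shows "(W, \<lambda>x. x) \<in> charts (euclidean_manifold n)"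
proof -
  have "(coord_space n, \<lambda>x. x) \<in> charts (euclidean_manifold n)"
    using smooth_structure_maximal_atlas(2)[OF euclidean_atlas[of n]] by (simp add: euclidean_manifold_def)
  from structure_restrict[OF smooth_structure_euclidean this, of W] assms
  show ?thesis by (simp add: inf.absorb2 openin_subset)
qed

lemma smooth_fun_euclidean_coordinate: "smooth_fun (euclidean_manifold n) (\<lambda>x. x j)"
proof (rule smooth_fun_atlasI[OF smooth_structure_euclidean])
  fix p assume "p \<in> topspace (mtop (euclidean_manifold n))"
  moreover have "smooth_on n (coord_space n) ((\<lambda>x. x j) \<circ> inv_into (coord_space n) (\<lambda>x. x))"
    by (rule smooth_on_cong[OF _ _ smooth_on_coordinate[of n _ j]]) (simp_all add: inv_into_ident)
  ultimately show "\<exists>U \<phi>. (U, \<phi>) \<in> charts (euclidean_manifold n) \<and> p \<in> U \<and>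
      smooth_on (mdim (euclidean_manifold n)) (\<phi> ` U) ((\<lambda>x. x j) \<circ> inv_into U \<phi>)"
    using euclidean_chart[of n "coord_space n"] by (intro exI[of _ "coord_space n"] exI[of _ "\<lambda>x. x"]) simp
qed

lemma smooth_map_into_euclidean:
  assumes M: "smooth_structure M" and f: "\<And>p. p \<in> topspace (mtop M) \<Longrightarrow> f p \<in> coord_space n"
    and s: "\<And>j. j < n \<Longrightarrow> smooth_fun M (\<lambda>p. f p j)"
  shows "smooth_map M (euclidean_manifold n) f"
proof (rule smooth_mapI[OF M smooth_structure_euclidean])
  fix p assume "p \<in> topspace (mtop M)"
  then show "\<exists>W V \<psi>. openin (mtop M) W \<and> p \<in> W \<and> (V, \<psi>) \<in> charts (euclidean_manifold n) \<and> f ` W \<subseteq> V \<and>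
      (\<forall>j<mdim (euclidean_manifold n). smooth_fun (open_submanifold M W) (\<lambda>q. \<psi> (f q) j))"
    using euclidean_chart[of n "coord_space n"] f smooth_fun_restrict[OF s]
    by (intro exI[of _ "topspace (mtop M)"] exI[of _ "coord_space n"] exI[of _ "\<lambda>x. x"]) auto
qed

text \<open>The coordinates of this map in the chart itself are the coordinates of Euclidean space.\<close>

lemma chart_inverse_smooth:
  assumes M: "smooth_structure M" and c: "(U, \<phi>) \<in> charts M"
  shows "smooth_map (open_submanifold (euclidean_manifold (mdim M)) (\<phi> ` U)) M (inv_into U \<phi>)"
proof -
  let ?E = "euclidean_manifold (mdim M)"
  note c1 = structure_chart[OF M c]
  have o: "openin (mtop ?E) (\<phi> ` U)" using chart_open_image[OF c1] by simp
  note S = smooth_structure_open_submanifold[OF smooth_structure_euclidean o]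
  show ?thesis
  proof (rule smooth_mapI[OF S M])
    fix z assume z: "z \<in> topspace (mtop (open_submanifold ?E (\<phi> ` U)))"
    have "smooth_fun (open_submanifold ?E (\<phi> ` U)) (\<lambda>q. \<phi> (inv_into U \<phi> q) j)" for j
      by (rule smooth_fun_cong[OF S _ smooth_fun_restrict[OF smooth_fun_euclidean_coordinate[of _ j]]])
        (use chart_inv[OF c1] in auto)
    then show "\<exists>W V \<psi>. openin (mtop (open_submanifold ?E (\<phi> ` U))) W \<and> z \<in> W \<and> (V, \<psi>) \<in> charts M \<and>
        inv_into U \<phi> ` W \<subseteq> V \<and>
        (\<forall>j<mdim M. smooth_fun (open_submanifold (open_submanifold ?E (\<phi> ` U)) W) (\<lambda>q. \<psi> (inv_into U \<phi> q) j))"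
      using z c o chart_inv[OF c1]
      by (intro exI[of _ "\<phi> ` U"] exI[of _ U] exI[of _ \<phi>])
        (auto simp: open_submanifold_open_submanifold openin_open_subtopology)
  qed
qed

text \<open>By maximality of the atlas.  Charts can thus be built by composing smooth maps, without computing transition maps.\<close>

lemma chart_of_diffeomorphism:
  assumes M: "smooth_structure M" and Q: "openin (mtop M) Q"
    and V: "openin (Euclidean_space (mdim M)) (\<Phi> ` Q)"
    and \<Phi>: "\<And>j. j < mdim M \<Longrightarrow> smooth_fun (open_submanifold M Q) (\<lambda>p. \<Phi> p j)"
    and \<Psi>: "smooth_map (open_submanifold (euclidean_manifold (mdim M)) (\<Phi> ` Q)) M \<Psi>"
    and inv: "\<And>p. p \<in> Q \<Longrightarrow> \<Psi> (\<Phi> p) = p"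
  shows "(Q, \<Phi>) \<in> charts M"
proof (rule structure_maximal[OF M])
  let ?n = "mdim M" and ?X = "mtop M"
  note MQ = smooth_structure_open_submanifold[OF M Q]
  have inj: "inj_on \<Phi> Q" by (rule inj_on_inverseI[of _ \<Psi>]) (rule inv)
  have inv': "inv_into Q \<Phi> z = \<Psi> z" if "z \<in> \<Phi> ` Q" for z using that inv inj by auto
  have sub: "\<Phi> ` Q \<subseteq> coord_space ?n" using openin_subset[OF V] .
  show ch: "is_chart ?n ?X (Q, \<Phi>)"
  proof (rule is_chartI[OF Q V inj])
    show "continuous_map (subtopology ?X Q) (Euclidean_space ?n) \<Phi>"
      using smooth_fun_continuous[OF MQ \<Phi>] sub by (intro continuous_map_into_Euclidean_space) auto
    have "continuous_map (subtopology (Euclidean_space ?n) (\<Phi> ` Q)) ?X \<Psi>"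
      using smooth_map_continuous[OF \<Psi>] by simp
    then show "continuous_map (subtopology (Euclidean_space ?n) (\<Phi> ` Q)) ?X (inv_into Q \<Phi>)"
      by (rule continuous_map_eq) (simp add: inv')
  qed
  fix d assume "d \<in> charts M"
  then obtain V' \<psi> where d: "d = (V', \<psi>)" "(V', \<psi>) \<in> charts M" by (cases d) auto
  note d1 = structure_chart[OF M d(2)]
  have QV: "openin ?X (Q \<inter> V')" using Q chart_open[OF d1] by blast
  have "smooth_between ?n ?n ((\<lambda>x. x) ` (\<Phi> ` Q \<inter> \<Psi> -` V')) (\<psi> \<circ> \<Psi> \<circ> inv_into (\<Phi> ` Q) (\<lambda>x. x))"
    using smooth_mapD[OF \<Psi> _ d(2), of "\<Phi> ` Q" "\<lambda>x. x"] euclidean_chart[OF V] by simp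
  moreover have "(\<lambda>x. x) ` (\<Phi> ` Q \<inter> \<Psi> -` V') = \<Phi> ` (Q \<inter> V')" using inv by auto
  ultimately have "smooth_between ?n ?n (\<Phi> ` (Q \<inter> V')) (\<psi> \<circ> \<Psi> \<circ> inv_into (\<Phi> ` Q) (\<lambda>x. x))" by simp
  then have 1: "smooth_between ?n ?n (\<Phi> ` (Q \<inter> V')) (\<psi> \<circ> inv_into Q \<Phi>)"
    by (rule smooth_between_cong[OF chart_image_open[OF ch QV], rotated 2]) (auto simp: inv' inv_into_ident inj inv)
  have "(V' \<inter> Q, \<psi>) \<in> charts (open_submanifold M Q)" using structure_restrict[OF M d(2) Q] by simp
  from smooth_funD[OF \<Phi> this]
  have "smooth_on ?n (\<psi> ` (V' \<inter> Q)) (\<lambda>x. (\<Phi> \<circ> inv_into (V' \<inter> Q) \<psi>) x j)" if "j < ?n" for j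
    using that by (simp add: o_def)
  moreover have "(\<Phi> \<circ> inv_into (V' \<inter> Q) \<psi>) ` \<psi> ` (V' \<inter> Q) \<subseteq> coord_space ?n"
    using sub chart_inv[OF chart_restrict[OF d1 Q]] by auto
  ultimately have "smooth_between ?n ?n (\<psi> ` (V' \<inter> Q)) (\<Phi> \<circ> inv_into (V' \<inter> Q) \<psi>)"
    by (simp add: smooth_between_iff)
  then have 2: "smooth_between ?n ?n (\<psi> ` (V' \<inter> Q)) (\<Phi> \<circ> inv_into V' \<psi>)"
    by (rule smooth_between_cong[rotated 2])
      (use chart_open_image[OF chart_restrict[OF d1 Q]] chart_inv[OF d1] chart_inv[OF chart_restrict[OF d1 Q]] in auto)
  show "compatible_charts ?n (Q, \<Phi>) d"
    using 1 2 by (simp add: d compatible_charts_def Int_commute)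
qed

section \<open>Products\<close>

definition take_coords :: "nat \<Rightarrow> (nat \<Rightarrow> real) \<Rightarrow> nat \<Rightarrow> real" where
  "take_coords m z = (\<lambda>i. if i < m then z i else 0)"

definition drop_coords :: "nat \<Rightarrow> (nat \<Rightarrow> real) \<Rightarrow> nat \<Rightarrow> real" where
  "drop_coords m z = (\<lambda>i. z (i + m))"

definition join_coords :: "nat \<Rightarrow> (nat \<Rightarrow> real) \<Rightarrow> (nat \<Rightarrow> real) \<Rightarrow> nat \<Rightarrow> real" where
  "join_coords m x y = (\<lambda>i. if i < m then x i else y (i - m))"

lemma take_join: "x \<in> coord_space m \<Longrightarrow> take_coords m (join_coords m x y) = x"
  by (auto simp: take_coords_def join_coords_def coord_space_iff fun_eq_iff)

lemma drop_join: "drop_coords m (join_coords m x y) = y"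
  by (auto simp: drop_coords_def join_coords_def)

lemma join_take_drop: "join_coords m (take_coords m z) (drop_coords m z) = z"
  by (auto simp: take_coords_def drop_coords_def join_coords_def)

lemma take_coords_in: "take_coords m z \<in> coord_space m"
  by (auto simp: take_coords_def coord_space_iff)

lemma drop_coords_in: "z \<in> coord_space (m + n) \<Longrightarrow> drop_coords m z \<in> coord_space n"
  by (auto simp: drop_coords_def coord_space_iff)

lemma join_coords_in: "y \<in> coord_space n \<Longrightarrow> join_coords m x y \<in> coord_space (m + n)"
  by (auto simp: join_coords_def coord_space_iff)

lemma continuous_map_take_coords: "continuous_map (Euclidean_space (m + n)) (Euclidean_space m) (take_coords m)"
  by (rule continuous_map_into_Euclidean_space[OF _ take_coords_in]) (simp add: take_coords_def continuous_map_coordinate)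

lemma continuous_map_drop_coords: "continuous_map (Euclidean_space (m + n)) (Euclidean_space n) (drop_coords m)"
  by (rule continuous_map_into_Euclidean_space) (simp_all add: drop_coords_in, simp add: drop_coords_def continuous_map_coordinate)

lemma smooth_on_take_coords: "smooth_on k W (\<lambda>z. take_coords m z j)"
  by (cases "j < m") (simp_all add: take_coords_def smooth_on_coordinate smooth_on_const)

lemma smooth_on_drop_coords: "smooth_on k W (\<lambda>z. drop_coords m z j)"
  by (simp add: drop_coords_def smooth_on_coordinate)

lemma prod_chart_eq:
  "prod_chart m (U, \<phi>) (V, \<psi>) = (U \<times> V, \<lambda>p. join_coords m (\<phi> (fst p)) (\<psi> (snd p)))"
  by (auto simp: prod_chart_def join_coords_def fun_eq_iff)

lemma prod_chart_image:
  assumes U: "\<phi> ` U \<subseteq> coord_space m" and V: "\<psi> ` V \<subseteq> coord_space n"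
  shows "(\<lambda>p. join_coords m (\<phi> (fst p)) (\<psi> (snd p))) ` (U \<times> V) =
    {z \<in> coord_space (m + n). take_coords m z \<in> \<phi> ` U} \<inter> {z \<in> coord_space (m + n). drop_coords m z \<in> \<psi> ` V}"
proof (intro equalityI subsetI)
  fix z assume "z \<in> (\<lambda>p. join_coords m (\<phi> (fst p)) (\<psi> (snd p))) ` (U \<times> V)"
  then obtain x y where "x \<in> U" "y \<in> V" "z = join_coords m (\<phi> x) (\<psi> y)" by auto
  then show "z \<in> {z \<in> coord_space (m + n). take_coords m z \<in> \<phi> ` U} \<inter> {z \<in> coord_space (m + n). drop_coords m z \<in> \<psi> ` V}"
    using U V by (auto simp: take_join drop_join image_subset_iff intro!: join_coords_in)
next
  fix z assume "z \<in> {z \<in> coord_space (m + n). take_coords m z \<in> \<phi> ` U} \<inter> {z \<in> coord_space (m + n). drop_coords m z \<in> \<psi> ` V}"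
  then obtain x y where "x \<in> U" "y \<in> V" "take_coords m z = \<phi> x" "drop_coords m z = \<psi> y" by blast
  then show "z \<in> (\<lambda>p. join_coords m (\<phi> (fst p)) (\<psi> (snd p))) ` (U \<times> V)"
    by (intro image_eqI[of _ _ "(x, y)"]) (metis fst_conv snd_conv join_take_drop, simp)
qed

lemma prod_chart_inverse:
  assumes "\<phi> ` U \<subseteq> coord_space m" "inj_on \<phi> U" "inj_on \<psi> V" "p \<in> U \<times> V"
  shows "(\<lambda>z. (inv_into U \<phi> (take_coords m z), inv_into V \<psi> (drop_coords m z))) (join_coords m (\<phi> (fst p)) (\<psi> (snd p))) = p"
  using assms by (auto simp: take_join drop_join image_subset_iff)

text \<open>\<open>\<real>\<^sup>m \<times> \<real>\<^sup>n\<close> is homeomorphic to \<open>\<real>\<^sup>m\<^sup>+\<^sup>n\<close> by joining coordinates, with inverse given by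
  \<^const>\<open>take_coords\<close> and \<^const>\<open>drop_coords\<close>.\<close>

lemma prod_chart_is_chart:
  assumes c: "is_chart m X (U, \<phi>)" and d: "is_chart n Y (V, \<psi>)"
  shows "is_chart (m + n) (prod_topology X Y) (U \<times> V, \<lambda>p. join_coords m (\<phi> (fst p)) (\<psi> (snd p)))"
proof (rule is_chartI)
  let ?J = "\<lambda>p. join_coords m (\<phi> (fst p)) (\<psi> (snd p))"
  let ?g = "\<lambda>z. (inv_into U \<phi> (take_coords m z), inv_into V \<psi> (drop_coords m z))"
  have sub: "\<phi> ` U \<subseteq> coord_space m" "\<psi> ` V \<subseteq> coord_space n"
    using openin_subset[OF chart_open_image[OF c]] openin_subset[OF chart_open_image[OF d]] .
  note im = prod_chart_image[OF sub]
  have inv: "?g (?J p) = p" if "p \<in> U \<times> V" for p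
    by (rule prod_chart_inverse[OF sub(1) chart_inj[OF c] chart_inj[OF d] that])
  show "openin (prod_topology X Y) (U \<times> V)" using chart_open[OF c] chart_open[OF d] by (simp add: openin_prod_Times_iff)
  show "openin (Euclidean_space (m + n)) (?J ` (U \<times> V))"
    unfolding im
    using openin_continuous_map_preimage[OF continuous_map_take_coords chart_open_image[OF c], of n]
      openin_continuous_map_preimage[OF continuous_map_drop_coords chart_open_image[OF d], of m]
    by (rule openin_Int)
  show inj: "inj_on ?J (U \<times> V)" by (rule inj_on_inverseI[of _ ?g]) (rule inv)
  show "continuous_map (subtopology (prod_topology X Y) (U \<times> V)) (Euclidean_space (m + n)) ?J"
    unfolding subtopology_Times
  proof (rule continuous_map_into_Euclidean_space)
    show "?J p \<in> coord_space (m + n)" if "p \<in> topspace (prod_topology (subtopology X U) (subtopology Y V))" for p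
      using that sub by (intro join_coords_in) auto
    show "continuous_map (prod_topology (subtopology X U) (subtopology Y V)) euclideanreal (\<lambda>p. ?J p i)" for i
    proof (cases "i < m")
      case True
      have "continuous_map (subtopology X U) euclideanreal (\<lambda>x. \<phi> x i)"
        using chart_continuous[OF c] by (rule continuous_map_coordinate_of)
      from continuous_map_compose[OF continuous_map_fst this] True show ?thesis by (simp add: o_def join_coords_def)
    next
      case False
      have "continuous_map (subtopology Y V) euclideanreal (\<lambda>y. \<psi> y (i - m))"
        using chart_continuous[OF d] by (rule continuous_map_coordinate_of)
      from continuous_map_compose[OF continuous_map_snd this] False show ?thesis by (simp add: o_def join_coords_def)
    qed
  qed
  have "continuous_map (subtopology (Euclidean_space (m + n)) (?J ` (U \<times> V))) (subtopology (Euclidean_space m) (\<phi> ` U)) (take_coords m)"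
    unfolding im using continuous_map_from_subtopology[OF continuous_map_take_coords]
    by (auto simp: continuous_map_in_subtopology)
  from continuous_map_compose[OF this chart_inv_continuous[OF c]]
  have 1: "continuous_map (subtopology (Euclidean_space (m + n)) (?J ` (U \<times> V))) X (\<lambda>z. inv_into U \<phi> (take_coords m z))"
    by (simp add: o_def)
  have "continuous_map (subtopology (Euclidean_space (m + n)) (?J ` (U \<times> V))) (subtopology (Euclidean_space n) (\<psi> ` V)) (drop_coords m)"
    unfolding im using continuous_map_from_subtopology[OF continuous_map_drop_coords]
    by (auto simp: continuous_map_in_subtopology)
  from continuous_map_compose[OF this chart_inv_continuous[OF d]]
  have 2: "continuous_map (subtopology (Euclidean_space (m + n)) (?J ` (U \<times> V))) Y (\<lambda>z. inv_into V \<psi> (drop_coords m z))"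
    by (simp add: o_def)
  have "continuous_map (subtopology (Euclidean_space (m + n)) (?J ` (U \<times> V))) (prod_topology X Y) ?g"
    using 1 2 by (simp add: continuous_map_pairedI)
  then show "continuous_map (subtopology (Euclidean_space (m + n)) (?J ` (U \<times> V))) (prod_topology X Y) (inv_into (U \<times> V) ?J)"
  proof (rule continuous_map_eq)
    fix z assume "z \<in> topspace (subtopology (Euclidean_space (m + n)) (?J ` (U \<times> V)))"
    then obtain p where "p \<in> U \<times> V" "z = ?J p" by auto
    then show "?g z = inv_into (U \<times> V) ?J z" using inv[of p] inv_into_f_f[OF inj, of p] by simp
  qed
qed

text \<open>Each block of coordinates of the transition map is a transition map of one factor after a projection.\<close>

lemma prod_chart_transition:
  assumes c: "is_chart m X (U, \<phi>)" and d: "is_chart n Y (V, \<psi>)"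
    and c': "is_chart m X (U', \<phi>')" and d': "is_chart n Y (V', \<psi>')"
    and cc: "compatible_charts m (U, \<phi>) (U', \<phi>')" and dd: "compatible_charts n (V, \<psi>) (V', \<psi>')"
  shows "smooth_between (m + n) (m + n) ((\<lambda>p. join_coords m (\<phi> (fst p)) (\<psi> (snd p))) ` (U \<times> V \<inter> U' \<times> V'))
    ((\<lambda>p. join_coords m (\<phi>' (fst p)) (\<psi>' (snd p))) \<circ> inv_into (U \<times> V) (\<lambda>p. join_coords m (\<phi> (fst p)) (\<psi> (snd p))))"
proof -
  let ?J = "\<lambda>p. join_coords m (\<phi> (fst p)) (\<psi> (snd p))" and ?J' = "\<lambda>p. join_coords m (\<phi>' (fst p)) (\<psi>' (snd p))"
  let ?W = "?J ` (U \<times> V \<inter> U' \<times> V')"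
  note Jc = prod_chart_is_chart[OF c d] and J'c = prod_chart_is_chart[OF c' d']
  have W: "openin (Euclidean_space (m + n)) ?W"
    by (rule chart_image_open[OF Jc]) (use chart_open[OF Jc] chart_open[OF J'c] in blast)+
  have UU: "openin (Euclidean_space m) (\<phi> ` (U \<inter> U'))"
    by (rule chart_image_open[OF c]) (use chart_open[OF c] chart_open[OF c'] in blast)+
  have VV: "openin (Euclidean_space n) (\<psi> ` (V \<inter> V'))"
    by (rule chart_image_open[OF d]) (use chart_open[OF d] chart_open[OF d'] in blast)+
  have t: "take_coords m (?J p) = \<phi> (fst p)" "drop_coords m (?J p) = \<psi> (snd p)" if "p \<in> U \<times> V" for p
    using that chart_coord[OF c] by (auto simp: take_join drop_join)
  have J: "inv_into (U \<times> V) ?J (?J p) = p" if "p \<in> U \<times> V" for p using chart_inv[OF Jc that] .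
  have "smooth_on (m + n) ?W (\<lambda>z. (?J' \<circ> inv_into (U \<times> V) ?J) z i)" if i: "i < m + n" for i
  proof (cases "i < m")
    case True
    have "smooth_on (m + n) ?W ((\<lambda>x. (\<phi>' \<circ> inv_into U \<phi>) x i) \<circ> take_coords m)"
    proof (rule smooth_on_compose[OF UU W])
      show "take_coords m ` ?W \<subseteq> \<phi> ` (U \<inter> U')" using t by force
      show "smooth_on m (\<phi> ` (U \<inter> U')) (\<lambda>x. (\<phi>' \<circ> inv_into U \<phi>) x i)"
        using compatible_chartsD[OF cc] True by (simp add: smooth_between_iff)
    qed (rule smooth_on_take_coords)
    then show ?thesis
      by (rule smooth_on_cong[OF W, rotated]) (use t J True chart_inv[OF c] in \<open>force simp: join_coords_def\<close>)
  next
    case False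
    have "smooth_on (m + n) ?W ((\<lambda>x. (\<psi>' \<circ> inv_into V \<psi>) x (i - m)) \<circ> drop_coords m)"
    proof (rule smooth_on_compose[OF VV W])
      show "drop_coords m ` ?W \<subseteq> \<psi> ` (V \<inter> V')" using t by force
      show "smooth_on n (\<psi> ` (V \<inter> V')) (\<lambda>x. (\<psi>' \<circ> inv_into V \<psi>) x (i - m))"
        using compatible_chartsD[OF dd] False i by (simp add: smooth_between_iff)
    qed (rule smooth_on_drop_coords)
    then show ?thesis
      by (rule smooth_on_cong[OF W, rotated]) (use t J False chart_inv[OF d] in \<open>force simp: join_coords_def\<close>)
  qed
  moreover have "(?J' \<circ> inv_into (U \<times> V) ?J) ` ?W \<subseteq> coord_space (m + n)"
    using J chart_coord[OF J'c] by fastforce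
  ultimately show ?thesis by (simp add: smooth_between_iff)
qed

lemma prod_manifold_simps [simp]:
  "mtop (prod_manifold M N) = prod_topology (mtop M) (mtop N)" "mdim (prod_manifold M N) = mdim M + mdim N"
  by (simp_all add: prod_manifold_def Let_def)

lemma prod_atlas:
  assumes M: "smooth_structure M" and N: "smooth_structure N"
  shows "smooth_atlas (mdim M + mdim N) (prod_topology (mtop M) (mtop N))
    {prod_chart (mdim M) c d | c d. c \<in> charts M \<and> d \<in> charts N}" (is "smooth_atlas ?n ?X ?A")
  unfolding smooth_atlas_def
proof (intro conjI ballI)
  have A: "\<exists>U \<phi> V \<psi>. (U, \<phi>) \<in> charts M \<and> (V, \<psi>) \<in> charts N \<and>
      e = (U \<times> V, \<lambda>p. join_coords (mdim M) (\<phi> (fst p)) (\<psi> (snd p)))" if e: "e \<in> ?A" for e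
  proof -
    obtain c d where "c \<in> charts M" "d \<in> charts N" "e = prod_chart (mdim M) c d" using e by blast
    then show ?thesis
      by (cases c; cases d) (auto simp: prod_chart_eq)
  qed
  have ch: "is_chart ?n ?X e" if "e \<in> ?A" for e
    using A[OF that] prod_chart_is_chart structure_chart[OF M] structure_chart[OF N] by blast
  then show "\<And>e. e \<in> ?A \<Longrightarrow> is_chart ?n ?X e" .
  show "(\<Union>e\<in>?A. fst e) = topspace ?X"
  proof
    show "(\<Union>e\<in>?A. fst e) \<subseteq> topspace ?X"
    proof (rule UN_least)
      fix e assume "e \<in> ?A"
      then have "is_chart ?n ?X (fst e, snd e)" using ch by (simp only: prod.collapse)
      then show "fst e \<subseteq> topspace ?X" by (rule chart_subset)
    qed
    show "topspace ?X \<subseteq> (\<Union>e\<in>?A. fst e)"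
    proof
      fix p assume "p \<in> topspace ?X"
      then have p: "fst p \<in> topspace (mtop M)" "snd p \<in> topspace (mtop N)" by auto
      obtain U \<phi> where c: "(U, \<phi>) \<in> charts M" "fst p \<in> U" using structure_cover[OF M p(1)] .
      obtain V \<psi> where d: "(V, \<psi>) \<in> charts N" "snd p \<in> V" using structure_cover[OF N p(2)] .
      have "prod_chart (mdim M) (U, \<phi>) (V, \<psi>) \<in> ?A" using c d by blast
      moreover have "p \<in> fst (prod_chart (mdim M) (U, \<phi>) (V, \<psi>))" using c d by (simp add: prod_chart_eq mem_Times_iff)
      ultimately show "p \<in> (\<Union>e\<in>?A. fst e)" by blast
    qed
  qed
  fix e e' assume eA: "e \<in> ?A" "e' \<in> ?A"
  from A[OF eA(1)] obtain U \<phi> V \<psi> where e: "(U, \<phi>) \<in> charts M" "(V, \<psi>) \<in> charts N"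
      "e = (U \<times> V, \<lambda>p. join_coords (mdim M) (\<phi> (fst p)) (\<psi> (snd p)))" by blast
  from A[OF eA(2)] obtain U' \<phi>' V' \<psi>' where e': "(U', \<phi>') \<in> charts M" "(V', \<psi>') \<in> charts N"
      "e' = (U' \<times> V', \<lambda>p. join_coords (mdim M) (\<phi>' (fst p)) (\<psi>' (snd p)))" by blast
  note sM = structure_chart[OF M] structure_compatible[OF M] and sN = structure_chart[OF N] structure_compatible[OF N]
  show "compatible_charts ?n e e'"
    using prod_chart_transition[OF sM(1)[OF e(1)] sN(1)[OF e(2)] sM(1)[OF e'(1)] sN(1)[OF e'(2)]
        sM(2)[OF e(1) e'(1)] sN(2)[OF e(2) e'(2)]]
      prod_chart_transition[OF sM(1)[OF e'(1)] sN(1)[OF e'(2)] sM(1)[OF e(1)] sN(1)[OF e(2)]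
        sM(2)[OF e'(1) e(1)] sN(2)[OF e'(2) e(2)]]
    by (simp add: e(3) e'(3) compatible_charts_def Int_commute)
qed

lemma smooth_structure_prod:
  "smooth_structure M \<Longrightarrow> smooth_structure N \<Longrightarrow> smooth_structure (prod_manifold M N)"
  unfolding prod_manifold_def Let_def by (rule smooth_structure_maximal_atlas(1)[OF prod_atlas])

lemma prod_chart_in:
  assumes M: "smooth_structure M" and N: "smooth_structure N" and c: "(U, \<phi>) \<in> charts M" and d: "(V, \<psi>) \<in> charts N"
  shows "(U \<times> V, \<lambda>p. join_coords (mdim M) (\<phi> (fst p)) (\<psi> (snd p))) \<in> charts (prod_manifold M N)"
proof -
  have "prod_chart (mdim M) (U, \<phi>) (V, \<psi>) \<in> {prod_chart (mdim M) c d | c d. c \<in> charts M \<and> d \<in> charts N}"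
    using c d by blast
  from subsetD[OF smooth_structure_maximal_atlas(2)[OF prod_atlas[OF M N]] this]
  show ?thesis by (simp add: prod_manifold_def Let_def prod_chart_eq)
qed

lemma smooth_map_fst:
  assumes M: "smooth_structure M" and N: "smooth_structure N"
  shows "smooth_map (prod_manifold M N) M fst"
proof (rule smooth_mapI[OF smooth_structure_prod[OF M N] M])
  fix p assume "p \<in> topspace (mtop (prod_manifold M N))"
  then have p: "fst p \<in> topspace (mtop M)" "snd p \<in> topspace (mtop N)" by auto
  obtain U \<phi> where c: "(U, \<phi>) \<in> charts M" "fst p \<in> U" using structure_cover[OF M p(1)] .
  obtain V \<psi> where d: "(V, \<psi>) \<in> charts N" "snd p \<in> V" using structure_cover[OF N p(2)] .
  note J = prod_chart_in[OF M N c(1) d(1)]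
  note S = smooth_structure_prod[OF M N] and Jo = chart_open[OF structure_chart[OF smooth_structure_prod[OF M N] J]]
  have "smooth_fun (open_submanifold (prod_manifold M N) (U \<times> V)) (\<lambda>q. \<phi> (fst q) j)" if "j < mdim M" for j
    by (rule smooth_fun_cong[OF smooth_structure_open_submanifold[OF S Jo] _ chart_coordinate_smooth[OF S J, of j]])
      (simp add: join_coords_def that)
  then show "\<exists>W V \<psi>. openin (mtop (prod_manifold M N)) W \<and> p \<in> W \<and> (V, \<psi>) \<in> charts M \<and> fst ` W \<subseteq> V \<and>
      (\<forall>j<mdim M. smooth_fun (open_submanifold (prod_manifold M N) W) (\<lambda>q. \<psi> (fst q) j))"
    using c d Jo by (intro exI[of _ "U \<times> V"] exI[of _ U] exI[of _ \<phi>]) (auto simp: mem_Times_iff)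
qed

lemma smooth_map_snd:
  assumes M: "smooth_structure M" and N: "smooth_structure N"
  shows "smooth_map (prod_manifold M N) N snd"
proof (rule smooth_mapI[OF smooth_structure_prod[OF M N] N])
  fix p assume "p \<in> topspace (mtop (prod_manifold M N))"
  then have p: "fst p \<in> topspace (mtop M)" "snd p \<in> topspace (mtop N)" by auto
  obtain U \<phi> where c: "(U, \<phi>) \<in> charts M" "fst p \<in> U" using structure_cover[OF M p(1)] .
  obtain V \<psi> where d: "(V, \<psi>) \<in> charts N" "snd p \<in> V" using structure_cover[OF N p(2)] .
  note J = prod_chart_in[OF M N c(1) d(1)]
  note S = smooth_structure_prod[OF M N] and Jo = chart_open[OF structure_chart[OF smooth_structure_prod[OF M N] J]]
  have "smooth_fun (open_submanifold (prod_manifold M N) (U \<times> V)) (\<lambda>q. \<psi> (snd q) j)" for j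
    by (rule smooth_fun_cong[OF smooth_structure_open_submanifold[OF S Jo] _ chart_coordinate_smooth[OF S J, of "j + mdim M"]])
      (simp add: join_coords_def)
  then show "\<exists>W V \<psi>. openin (mtop (prod_manifold M N)) W \<and> p \<in> W \<and> (V, \<psi>) \<in> charts N \<and> snd ` W \<subseteq> V \<and>
      (\<forall>j<mdim N. smooth_fun (open_submanifold (prod_manifold M N) W) (\<lambda>q. \<psi> (snd q) j))"
    using c d Jo by (intro exI[of _ "U \<times> V"] exI[of _ V] exI[of _ \<psi>]) (auto simp: mem_Times_iff)
qed

lemma smooth_map_pair:
  assumes P: "smooth_structure P" and M: "smooth_structure M" and N: "smooth_structure N"
    and f: "smooth_map P M f" and g: "smooth_map P N g"
  shows "smooth_map P (prod_manifold M N) (\<lambda>p. (f p, g p))"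
proof (rule smooth_mapI[OF P smooth_structure_prod[OF M N]])
  fix p assume p: "p \<in> topspace (mtop P)"
  obtain U \<phi> where c: "(U, \<phi>) \<in> charts M" "f p \<in> U" using structure_cover[OF M smooth_map_in_topspace[OF f p]] .
  obtain V \<psi> where d: "(V, \<psi>) \<in> charts N" "g p \<in> V" using structure_cover[OF N smooth_map_in_topspace[OF g p]] .
  let ?W = "(topspace (mtop P) \<inter> f -` U) \<inter> (topspace (mtop P) \<inter> g -` V)"
  have W: "openin (mtop P) ?W"
    using smooth_map_preimage_open[OF f chart_open[OF structure_chart[OF M c(1)]]]
      smooth_map_preimage_open[OF g chart_open[OF structure_chart[OF N d(1)]]] by (rule openin_Int)
  note PW = smooth_structure_open_submanifold[OF P W]
  have "smooth_fun (open_submanifold P ?W) (\<lambda>q. \<phi> (f q) j)" "smooth_fun (open_submanifold P ?W) (\<lambda>q. \<psi> (g q) j)" for j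
    by (rule smooth_map_coordinate[OF PW M smooth_map_restrict[OF f] c(1)], auto)
      (rule smooth_map_coordinate[OF PW N smooth_map_restrict[OF g] d(1)], auto)
  then have "smooth_fun (open_submanifold P ?W) (\<lambda>q. join_coords (mdim M) (\<phi> (f q)) (\<psi> (g q)) j)" for j
    by (cases "j < mdim M") (simp_all add: join_coords_def)
  then show "\<exists>W V \<psi>. openin (mtop P) W \<and> p \<in> W \<and> (V, \<psi>) \<in> charts (prod_manifold M N) \<and> (\<lambda>p. (f p, g p)) ` W \<subseteq> V \<and>
      (\<forall>j<mdim (prod_manifold M N). smooth_fun (open_submanifold P W) (\<lambda>q. \<psi> (f q, g q) j))"
    using W p c(2) d(2) prod_chart_in[OF M N c(1) d(1)]
    by (intro exI[of _ ?W] exI[of _ "U \<times> V"] exI[of _ "\<lambda>p. join_coords (mdim M) (\<phi> (fst p)) (\<psi> (snd p))"]) auto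
qed

section \<open>Embedded submanifolds and transported structures\<close>

text \<open>A slice chart maps \<open>U \<inter> S\<close> onto an open subset of \<open>\<real>\<^sup>k\<close> because \<open>\<real>\<^sup>k\<close> carries the subspace topology of the
  ambient model space.\<close>

lemma slice_chart_facts:
  assumes M: "smooth_structure M" and k: "k \<le> mdim M" and c: "(U, \<phi>) \<in> slice_charts M k S"
  shows slice_chart_chart: "(U, \<phi>) \<in> charts M"
    and slice_chart_eq: "\<phi> ` (U \<inter> S) = \<phi> ` U \<inter> coord_space k"
    and slice_chart_coord: "x \<in> U \<inter> S \<Longrightarrow> \<phi> x \<in> coord_space k"
    and slice_chart_inv: "z \<in> \<phi> ` (U \<inter> S) \<Longrightarrow> inv_into (U \<inter> S) \<phi> z = inv_into U \<phi> z"
    and slice_chart_is_chart: "is_chart k (subtopology (mtop M) S) (U \<inter> S, \<phi>)"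
proof -
  show cM: "(U, \<phi>) \<in> charts M" and eq: "\<phi> ` (U \<inter> S) = \<phi> ` U \<inter> coord_space k"
    using c by (auto simp: slice_charts_def)
  note c1 = structure_chart[OF M cM]
  show co: "\<phi> x \<in> coord_space k" if "x \<in> U \<inter> S" for x using that eq by blast
  show inv: "inv_into (U \<inter> S) \<phi> z = inv_into U \<phi> z" if "z \<in> \<phi> ` (U \<inter> S)" for z
    using that by (intro inv_into_restrict[OF chart_inj[OF c1]]) auto
  have top: "subtopology (Euclidean_space k) W = subtopology (Euclidean_space (mdim M)) W" if "W \<subseteq> coord_space k" for W
    by (subst Euclidean_space_subspace[OF k]) (use that in \<open>simp add: subtopology_subtopology inf.absorb2\<close>)
  show "is_chart k (subtopology (mtop M) S) (U \<inter> S, \<phi>)"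
  proof (rule is_chartI)
    show "openin (subtopology (mtop M) S) (U \<inter> S)"
      using openin_subtopology_Int[OF chart_open[OF c1]] .
    show "openin (Euclidean_space k) (\<phi> ` (U \<inter> S))"
      unfolding eq by (subst Euclidean_space_subspace[OF k]) (rule openin_subtopology_Int[OF chart_open_image[OF c1]])
    show "inj_on \<phi> (U \<inter> S)" using chart_inj[OF c1] by (rule inj_on_subset) blast
    have "continuous_map (subtopology (mtop M) U) euclideanreal (\<lambda>x. \<phi> x i)" for i
      using chart_continuous[OF c1] by (rule continuous_map_coordinate_of)
    then have "continuous_map (subtopology (mtop M) (U \<inter> S)) euclideanreal (\<lambda>x. \<phi> x i)" for i
      by (rule continuous_map_from_subtopology_mono) blast
    moreover have "subtopology (subtopology (mtop M) S) (U \<inter> S) = subtopology (mtop M) (U \<inter> S)"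
      by (simp add: subtopology_subtopology Int_ac)
    ultimately show "continuous_map (subtopology (subtopology (mtop M) S) (U \<inter> S)) (Euclidean_space k) \<phi>"
      using co by (intro continuous_map_into_Euclidean_space) auto
    have "continuous_map (subtopology (Euclidean_space (mdim M)) (\<phi> ` (U \<inter> S))) (mtop M) (inv_into U \<phi>)"
      using chart_inv_continuous[OF c1] by (rule continuous_map_from_subtopology_mono) blast
    then have "continuous_map (subtopology (Euclidean_space k) (\<phi> ` (U \<inter> S))) (mtop M) (inv_into U \<phi>)"
      using eq by (simp add: top)
    then have "continuous_map (subtopology (Euclidean_space k) (\<phi> ` (U \<inter> S))) (mtop M) (inv_into (U \<inter> S) \<phi>)"
      by (rule continuous_map_eq) (simp add: inv)
    moreover have "inv_into (U \<inter> S) \<phi> z \<in> S" if "z \<in> \<phi> ` (U \<inter> S)" for z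
      using inv_into_into[OF that] by blast
    ultimately show "continuous_map (subtopology (Euclidean_space k) (\<phi> ` (U \<inter> S))) (subtopology (mtop M) S) (inv_into (U \<inter> S) \<phi>)"
      by (auto simp: continuous_map_in_subtopology)
  qed
qed

lemma slice_chart_transition:
  assumes M: "smooth_structure M" and k: "k \<le> mdim M"
    and c: "(U, \<phi>) \<in> slice_charts M k S" and d: "(V, \<psi>) \<in> slice_charts M k S"
  shows "smooth_between k k (\<phi> ` (U \<inter> S \<inter> (V \<inter> S))) (\<psi> \<circ> inv_into (U \<inter> S) \<phi>)"
proof -
  note c1 = slice_chart_facts[OF M k c] and d1 = slice_chart_facts[OF M k d]
  note cc = structure_chart[OF M c1(1)] and dd = structure_chart[OF M d1(1)]
  let ?W = "\<phi> ` (U \<inter> S \<inter> (V \<inter> S))"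
  have W: "openin (Euclidean_space k) ?W"
    by (rule chart_image_open[OF c1(5)]) (use chart_open[OF c1(5)] chart_open[OF d1(5)] in blast)+
  have sub: "?W \<subseteq> \<phi> ` (U \<inter> V) \<inter> coord_space k" using c1(2) by blast
  have "smooth_on k ?W (\<lambda>x. (\<psi> \<circ> inv_into U \<phi>) x j)" if "j < k" for j
  proof -
    have "smooth_on (mdim M) (\<phi> ` (U \<inter> V)) (\<lambda>x. (\<psi> \<circ> inv_into U \<phi>) x j)"
      using compatible_chartsD[OF structure_compatible[OF M c1(1) d1(1)]] that k by (simp add: smooth_between_iff)
    from smooth_on_subset[OF smooth_on_subspace[OF k this] sub] show ?thesis .
  qed
  moreover have "(\<psi> \<circ> inv_into U \<phi>) ` ?W \<subseteq> coord_space k"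
    using d1(3) chart_inv[OF cc] by auto
  ultimately have "smooth_between k k ?W (\<psi> \<circ> inv_into U \<phi>)" by (simp add: smooth_between_iff)
  then show ?thesis by (rule smooth_between_cong[OF W, rotated]) (use c1(4) in auto)
qed

lemma submanifold_simps [simp]:
  "mtop (submanifold M k S) = subtopology (mtop M) S" "mdim (submanifold M k S) = k"
  by (simp_all add: submanifold_def Let_def)

lemma embedded_submanifold_cover:
  assumes "embedded_submanifold M k S" "p \<in> S"
  obtains U \<phi> where "(U, \<phi>) \<in> slice_charts M k S" "p \<in> U"
proof -
  have "p \<in> (\<Union>c \<in> slice_charts M k S. fst c)" using assms by (auto simp: embedded_submanifold_def)
  then show ?thesis using that by auto
qed

lemma slice_atlas:
  assumes M: "smooth_structure M" and k: "k \<le> mdim M" and S: "embedded_submanifold M k S"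
  shows "smooth_atlas k (subtopology (mtop M) S) ((\<lambda>(U, \<phi>). (U \<inter> S, \<phi>)) ` slice_charts M k S)" (is "smooth_atlas k ?X ?A")
  unfolding smooth_atlas_def
proof (intro conjI ballI)
  have A: "\<exists>U \<phi>. (U, \<phi>) \<in> slice_charts M k S \<and> e = (U \<inter> S, \<phi>)" if "e \<in> ?A" for e using that by auto
  show "is_chart k ?X e" if "e \<in> ?A" for e
    using A[OF that] slice_chart_is_chart[OF M k] by blast
  show "(\<Union>e\<in>?A. fst e) = topspace ?X"
  proof
    show "(\<Union>e\<in>?A. fst e) \<subseteq> topspace ?X"
      using S by (auto simp: embedded_submanifold_def)
    show "topspace ?X \<subseteq> (\<Union>e\<in>?A. fst e)"
    proof
      fix p assume "p \<in> topspace ?X"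
      then have p: "p \<in> S" by simp
      obtain U \<phi> where "(U, \<phi>) \<in> slice_charts M k S" "p \<in> U" using embedded_submanifold_cover[OF S p] .
      then show "p \<in> (\<Union>e\<in>?A. fst e)" using p by (intro UN_I[of "(U \<inter> S, \<phi>)"]) force+
    qed
  qed
  fix e e' assume "e \<in> ?A" "e' \<in> ?A"
  then obtain U \<phi> V \<psi> where e: "(U, \<phi>) \<in> slice_charts M k S" "e = (U \<inter> S, \<phi>)"
    "(V, \<psi>) \<in> slice_charts M k S" "e' = (V \<inter> S, \<psi>)" by auto
  show "compatible_charts k e e'"
    using slice_chart_transition[OF M k e(1,3)] slice_chart_transition[OF M k e(3,1)]
    by (simp add: e(2,4) compatible_charts_def Int_commute)
qed

lemma smooth_structure_submanifold:
  "smooth_structure M \<Longrightarrow> k \<le> mdim M \<Longrightarrow> embedded_submanifold M k S \<Longrightarrow> smooth_structure (submanifold M k S)"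
  unfolding submanifold_def Let_def by (rule smooth_structure_maximal_atlas(1)[OF slice_atlas])

lemma submanifold_chart:
  assumes "smooth_structure M" "k \<le> mdim M" "embedded_submanifold M k S" "(U, \<phi>) \<in> slice_charts M k S"
  shows "(U \<inter> S, \<phi>) \<in> charts (submanifold M k S)"
proof -
  have "(U \<inter> S, \<phi>) \<in> (\<lambda>(U, \<phi>). (U \<inter> S, \<phi>)) ` slice_charts M k S" using assms(4) by force
  from subsetD[OF smooth_structure_maximal_atlas(2)[OF slice_atlas[OF assms(1-3)]] this]
  show ?thesis by (simp add: submanifold_def Let_def)
qed

lemma smooth_map_submanifold_inclusion:
  assumes M: "smooth_structure M" and k: "k \<le> mdim M" and S: "embedded_submanifold M k S"
  shows "smooth_map (submanifold M k S) M (\<lambda>p. p)"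
proof (rule smooth_mapI[OF smooth_structure_submanifold[OF M k S] M])
  fix p assume "p \<in> topspace (mtop (submanifold M k S))"
  then have p: "p \<in> S" by simp
  obtain U \<phi> where c: "(U, \<phi>) \<in> slice_charts M k S" "p \<in> U" using embedded_submanifold_cover[OF S p] .
  note cS = submanifold_chart[OF M k S c(1)] and SS = smooth_structure_submanifold[OF M k S]
  show "\<exists>W V \<psi>. openin (mtop (submanifold M k S)) W \<and> p \<in> W \<and> (V, \<psi>) \<in> charts M \<and> (\<lambda>p. p) ` W \<subseteq> V \<and>
      (\<forall>j<mdim M. smooth_fun (open_submanifold (submanifold M k S) W) (\<lambda>q. \<psi> q j))"
    using chart_open[OF structure_chart[OF SS cS]] p c(2) slice_chart_chart[OF M k c(1)] chart_coordinate_smooth[OF SS cS]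
    by (intro exI[of _ "U \<inter> S"] exI[of _ U] exI[of _ \<phi>]) auto
qed

text \<open>The coordinates of \<open>f\<close> in the chart of \<open>S\<close> induced by a slice chart are the first \<open>k\<close> of its coordinates in the
  slice chart.\<close>

lemma smooth_map_into_submanifold:
  assumes P: "smooth_structure P" and M: "smooth_structure M" and k: "k \<le> mdim M" and S: "embedded_submanifold M k S"
    and f: "smooth_map P M f" and fS: "\<And>p. p \<in> topspace (mtop P) \<Longrightarrow> f p \<in> S"
  shows "smooth_map P (submanifold M k S) f"
proof (rule smooth_mapI[OF P smooth_structure_submanifold[OF M k S]])
  fix p assume p: "p \<in> topspace (mtop P)"
  obtain U \<phi> where c: "(U, \<phi>) \<in> slice_charts M k S" "f p \<in> U" using embedded_submanifold_cover[OF S fS[OF p]] .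
  note cM = slice_chart_chart[OF M k c(1)]
  let ?W = "topspace (mtop P) \<inter> f -` U"
  have W: "openin (mtop P) ?W" by (rule smooth_map_preimage_open[OF f chart_open[OF structure_chart[OF M cM]]])
  have "smooth_fun (open_submanifold P ?W) (\<lambda>q. \<phi> (f q) j)" for j
    by (rule smooth_map_coordinate[OF smooth_structure_open_submanifold[OF P W] M smooth_map_restrict[OF f] cM]) auto
  then show "\<exists>W V \<psi>. openin (mtop P) W \<and> p \<in> W \<and> (V, \<psi>) \<in> charts (submanifold M k S) \<and> f ` W \<subseteq> V \<and>
      (\<forall>j<mdim (submanifold M k S). smooth_fun (open_submanifold P W) (\<lambda>q. \<psi> (f q) j))"
    using W p c(2) submanifold_chart[OF M k S c(1)] fS
    by (intro exI[of _ ?W] exI[of _ "U \<inter> S"] exI[of _ \<phi>]) auto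
qed

lemma transported_manifold_simps [simp]:
  "mtop (transported_manifold X f M) = X" "mdim (transported_manifold X f M) = mdim M"
  by (simp_all add: transported_manifold_def)

text \<open>In the transported charts the homeomorphism and its inverse are the identity of the model space, so transition maps are
  those of \<open>M\<close>.\<close>

lemma transported_chart_facts:
  assumes M: "smooth_structure M" and h: "homeomorphic_maps X (mtop M) f g" and c: "(U, \<phi>) \<in> charts M"
  shows transported_image: "W \<subseteq> U \<Longrightarrow> (\<phi> \<circ> f) ` (topspace X \<inter> f -` W) = \<phi> ` W"
    and transported_inv: "z \<in> \<phi> ` U \<Longrightarrow> inv_into (topspace X \<inter> f -` U) (\<phi> \<circ> f) z = g (inv_into U \<phi> z)"
    and transported_is_chart: "is_chart (mdim M) X (topspace X \<inter> f -` U, \<phi> \<circ> f)"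
proof -
  note c1 = structure_chart[OF M c]
  have fg: "continuous_map X (mtop M) f" "continuous_map (mtop M) X g"
    "\<And>x. x \<in> topspace X \<Longrightarrow> g (f x) = x" "\<And>y. y \<in> topspace (mtop M) \<Longrightarrow> f (g y) = y"
    "\<And>y. y \<in> topspace (mtop M) \<Longrightarrow> g y \<in> topspace X"
    using h by (auto simp: homeomorphic_maps_def continuous_map_def)
  show im: "(\<phi> \<circ> f) ` (topspace X \<inter> f -` W) = \<phi> ` W" if W: "W \<subseteq> U" for W
  proof (intro equalityI subsetI)
    fix z assume "z \<in> \<phi> ` W"
    then obtain y where y: "y \<in> W" "z = \<phi> y" by blast
    then have "y \<in> topspace (mtop M)" using W chart_subset[OF c1] by blast
    then show "z \<in> (\<phi> \<circ> f) ` (topspace X \<inter> f -` W)"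
      using y fg(4,5) by (intro image_eqI[of _ _ "g y"]) auto
  qed auto
  have inj: "inj_on (\<phi> \<circ> f) (topspace X \<inter> f -` U)"
  proof (rule inj_onI)
    fix x y assume "x \<in> topspace X \<inter> f -` U" "y \<in> topspace X \<inter> f -` U" "(\<phi> \<circ> f) x = (\<phi> \<circ> f) y"
    then have "f x = f y" "x \<in> topspace X" "y \<in> topspace X" using inj_onD[OF chart_inj[OF c1]] by auto
    then show "x = y" using fg(3) by metis
  qed
  show inv: "inv_into (topspace X \<inter> f -` U) (\<phi> \<circ> f) z = g (inv_into U \<phi> z)" if "z \<in> \<phi> ` U" for z
  proof -
    obtain y where y: "y \<in> U" "z = \<phi> y" using \<open>z \<in> \<phi> ` U\<close> by blast
    then have "y \<in> topspace (mtop M)" using chart_subset[OF c1] by blast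
    then have "g y \<in> topspace X \<inter> f -` U" "(\<phi> \<circ> f) (g y) = z" using y fg(4,5) by auto
    then show ?thesis using inv_into_f_f[OF inj, of "g y"] y chart_inv[OF c1] by simp
  qed
  show "is_chart (mdim M) X (topspace X \<inter> f -` U, \<phi> \<circ> f)"
  proof (rule is_chartI[OF _ _ inj])
    show "openin X (topspace X \<inter> f -` U)"
      using openin_continuous_map_preimage[OF fg(1) chart_open[OF c1]] by (simp add: vimage_def Collect_conj_eq)
    show "openin (Euclidean_space (mdim M)) ((\<phi> \<circ> f) ` (topspace X \<inter> f -` U))"
      using chart_open_image[OF c1] im[OF order_refl] by simp
    have "continuous_map (subtopology X (topspace X \<inter> f -` U)) (subtopology (mtop M) U) f"
      using continuous_map_from_subtopology[OF fg(1)] by (auto simp: continuous_map_in_subtopology)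
    then show "continuous_map (subtopology X (topspace X \<inter> f -` U)) (Euclidean_space (mdim M)) (\<phi> \<circ> f)"
      using chart_continuous[OF c1] by (rule continuous_map_compose)
    have "continuous_map (subtopology (Euclidean_space (mdim M)) (\<phi> ` U)) X (g \<circ> inv_into U \<phi>)"
      using chart_inv_continuous[OF c1] fg(2) by (rule continuous_map_compose)
    then have "continuous_map (subtopology (Euclidean_space (mdim M)) (\<phi> ` U)) X (inv_into (topspace X \<inter> f -` U) (\<phi> \<circ> f))"
      by (rule continuous_map_eq) (simp add: inv)
    then show "continuous_map (subtopology (Euclidean_space (mdim M)) ((\<phi> \<circ> f) ` (topspace X \<inter> f -` U))) X
        (inv_into (topspace X \<inter> f -` U) (\<phi> \<circ> f))"
      using im[OF order_refl] by simp
  qed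
qed

lemma transported_atlas:
  assumes M: "smooth_structure M" and h: "homeomorphic_maps X (mtop M) f g"
  shows "smooth_atlas (mdim M) X ((\<lambda>(U, \<phi>). (topspace X \<inter> f -` U, \<phi> \<circ> f)) ` charts M)" (is "smooth_atlas ?n X ?A")
  unfolding smooth_atlas_def
proof (intro conjI ballI)
  show "is_chart ?n X e" if "e \<in> ?A" for e
    using that transported_is_chart[OF M h] by auto
  show "(\<Union>e\<in>?A. fst e) = topspace X"
  proof
    show "topspace X \<subseteq> (\<Union>e\<in>?A. fst e)"
    proof
      fix x assume x: "x \<in> topspace X"
      then have "f x \<in> topspace (mtop M)" using h by (auto simp: homeomorphic_maps_def continuous_map_def)
      then obtain U \<phi> where "(U, \<phi>) \<in> charts M" "f x \<in> U" using structure_cover[OF M] by blast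
      then show "x \<in> (\<Union>e\<in>?A. fst e)" using x by force
    qed
  qed auto
  have *: "smooth_between ?n ?n ((\<phi> \<circ> f) ` (topspace X \<inter> f -` U \<inter> (topspace X \<inter> f -` V)))
      ((\<psi> \<circ> f) \<circ> inv_into (topspace X \<inter> f -` U) (\<phi> \<circ> f))"
    if c: "(U, \<phi>) \<in> charts M" and d: "(V, \<psi>) \<in> charts M" for U \<phi> V \<psi>
  proof -
    note c1 = structure_chart[OF M c] and d1 = structure_chart[OF M d]
    have "topspace X \<inter> f -` U \<inter> (topspace X \<inter> f -` V) = topspace X \<inter> f -` (U \<inter> V)" by blast
    then have im: "(\<phi> \<circ> f) ` (topspace X \<inter> f -` U \<inter> (topspace X \<inter> f -` V)) = \<phi> ` (U \<inter> V)"
      using transported_image[OF M h c, of "U \<inter> V"] by simp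
    have o: "openin (Euclidean_space ?n) (\<phi> ` (U \<inter> V))"
      by (rule chart_image_open[OF c1]) (use chart_open[OF c1] chart_open[OF d1] in blast)+
    have fg: "f (g y) = y" if "y \<in> U" for y
      using that h chart_subset[OF c1] by (auto simp: homeomorphic_maps_def)
    show ?thesis
      unfolding im
      by (rule smooth_between_cong[OF o _ compatible_chartsD[OF structure_compatible[OF M c d]]])
        (use transported_inv[OF M h c] chart_inv[OF c1] fg in auto)
  qed
  fix e e' assume "e \<in> ?A" "e' \<in> ?A"
  then obtain U \<phi> V \<psi> where e: "(U, \<phi>) \<in> charts M" "e = (topspace X \<inter> f -` U, \<phi> \<circ> f)"
    "(V, \<psi>) \<in> charts M" "e' = (topspace X \<inter> f -` V, \<psi> \<circ> f)" by auto
  show "compatible_charts ?n e e'"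
    using *[OF e(1,3)] *[OF e(3,1)] unfolding e(2,4) compatible_charts_def by (simp only: prod.case Int_commute)
qed

lemma smooth_structure_transported:
  "smooth_structure M \<Longrightarrow> homeomorphic_maps X (mtop M) f g \<Longrightarrow> smooth_structure (transported_manifold X f M)"
  unfolding transported_manifold_def by (rule smooth_structure_maximal_atlas(1)[OF transported_atlas])

lemma transported_chart:
  assumes "smooth_structure M" "homeomorphic_maps X (mtop M) f g" "(U, \<phi>) \<in> charts M"
  shows "(topspace X \<inter> f -` U, \<phi> \<circ> f) \<in> charts (transported_manifold X f M)"
proof -
  have "(topspace X \<inter> f -` U, \<phi> \<circ> f) \<in> (\<lambda>(U, \<phi>). (topspace X \<inter> f -` U, \<phi> \<circ> f)) ` charts M"
    using assms(3) by force
  from subsetD[OF smooth_structure_maximal_atlas(2)[OF transported_atlas[OF assms(1,2)]] this]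
  show ?thesis by (simp add: transported_manifold_def)
qed

lemma smooth_map_transport:
  assumes M: "smooth_structure M" and h: "homeomorphic_maps X (mtop M) f g"
  shows "smooth_map (transported_manifold X f M) M f" (is "smooth_map ?T M f")
proof (rule smooth_mapI[OF smooth_structure_transported[OF M h] M])
  fix x assume "x \<in> topspace (mtop ?T)"
  then have x: "x \<in> topspace X" "f x \<in> topspace (mtop M)"
    using h by (auto simp: homeomorphic_maps_def continuous_map_def)
  obtain U \<phi> where c: "(U, \<phi>) \<in> charts M" "f x \<in> U" using structure_cover[OF M x(2)] .
  note cT = transported_chart[OF M h c(1)] and T = smooth_structure_transported[OF M h]
  have "smooth_fun (open_submanifold ?T (topspace X \<inter> f -` U)) (\<lambda>q. \<phi> (f q) j)" for j
    using chart_coordinate_smooth[OF T cT, of j] by simp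
  then show "\<exists>W V \<psi>. openin (mtop ?T) W \<and> x \<in> W \<and> (V, \<psi>) \<in> charts M \<and> f ` W \<subseteq> V \<and>
      (\<forall>j<mdim M. smooth_fun (open_submanifold ?T W) (\<lambda>q. \<psi> (f q) j))"
    using chart_open[OF structure_chart[OF T cT]] x c
    by (intro exI[of _ "topspace X \<inter> f -` U"] exI[of _ U] exI[of _ \<phi>]) auto
qed

lemma smooth_map_transport_inverse:
  assumes M: "smooth_structure M" and h: "homeomorphic_maps X (mtop M) f g"
  shows "smooth_map M (transported_manifold X f M) g" (is "smooth_map M ?T g")
proof (rule smooth_mapI[OF M smooth_structure_transported[OF M h]])
  fix y assume y: "y \<in> topspace (mtop M)"
  have fg: "\<And>y. y \<in> topspace (mtop M) \<Longrightarrow> f (g y) = y" "\<And>y. y \<in> topspace (mtop M) \<Longrightarrow> g y \<in> topspace X"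
    using h by (auto simp: homeomorphic_maps_def continuous_map_def)
  obtain U \<phi> where c: "(U, \<phi>) \<in> charts M" "y \<in> U" using structure_cover[OF M y] .
  note c1 = structure_chart[OF M c(1)]
  have "smooth_fun (open_submanifold M U) (\<lambda>q. (\<phi> \<circ> f) (g q) j)" for j
    by (rule smooth_fun_cong[OF smooth_structure_open_submanifold[OF M chart_open[OF c1]] _ chart_coordinate_smooth[OF M c(1), of j]])
      (simp add: fg)
  then show "\<exists>W V \<psi>. openin (mtop M) W \<and> y \<in> W \<and> (V, \<psi>) \<in> charts ?T \<and> g ` W \<subseteq> V \<and>
      (\<forall>j<mdim ?T. smooth_fun (open_submanifold M W) (\<lambda>q. \<psi> (g q) j))"
    using c transported_chart[OF M h c(1)] chart_open[OF c1] chart_subset[OF c1] fg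
    by (intro exI[of _ U] exI[of _ "topspace X \<inter> f -` U"] exI[of _ "\<phi> \<circ> f"]) auto
qed

lemma smooth_manifold_transported:
  assumes M: "smooth_manifold M" and h: "homeomorphic_maps X (mtop M) f g"
  shows "smooth_manifold (transported_manifold X f M)"
proof -
  have "X homeomorphic_space mtop M" using h homeomorphic_space_def by blast
  moreover have "Hausdorff_space (mtop M)" "second_countable (mtop M)" using M by (auto simp: smooth_manifold_def)
  ultimately have "Hausdorff_space X" "second_countable X"
    using homeomorphic_Hausdorff_space homeomorphic_space_second_countability by blast+
  then show ?thesis
    using smooth_structure_transported[OF smooth_manifold_structure[OF M] h]
    by (simp add: smooth_manifold_def smooth_structure_def)
qed

section \<open>The circle\<close>

definition angle :: "real \<Rightarrow> complex \<Rightarrow> real" where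
  "angle a = inv_into {a<..<a + 2 * pi} cis"

lemma angle_chart_eq: "angle_chart a = (circle - {cis a}, \<lambda>z i. if i = 0 then angle a z else 0)"
  unfolding angle_chart_def angle_def ..

text \<open>Rotating by \<open>- a - \<pi>\<close> moves the interval to \<open>(-\<pi>, \<pi>)\<close>, where \<^const>\<open>Arg\<close> inverts \<^const>\<open>cis\<close> continuously.\<close>

lemma angle_formula:
  assumes "t \<in> {a<..<a + 2 * pi}"
  shows "a + pi + Arg (- cis t * cis (- a)) = t"
proof -
  have "- cis t * cis (- a) = cis (t - a - pi)" by (simp add: cis_mult flip: cis_divide)
  then show ?thesis using Arg_cis[of "t - a - pi"] assms by simp
qed

lemma inj_on_cis: "inj_on cis {a<..<a + 2 * pi}"
  by (rule inj_on_inverseI[of _ "\<lambda>z. a + pi + Arg (- z * cis (- a))"]) (rule angle_formula)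

lemma cis_image: "cis ` {a<..<a + 2 * pi} = circle - {cis a}"
proof (intro equalityI subsetI)
  fix z assume "z \<in> cis ` {a<..<a + 2 * pi}"
  then obtain t where t: "t \<in> {a<..<a + 2 * pi}" "z = cis t" by blast
  have "cis t \<noteq> cis a"
  proof
    assume "cis t = cis a"
    then have "- cis t * cis (- a) = -1" by (simp add: cis_mult)
    then have "a + pi + Arg (-1) = t" using angle_formula[OF t(1)] by simp
    moreover have "Arg (-1) = pi" using Arg_cis[of pi] by simp
    ultimately show False using t(1) by simp
  qed
  then show "z \<in> circle - {cis a}" using t by simp
next
  fix z assume z: "z \<in> circle - {cis a}"
  let ?w = "- z * cis (- a)"
  let ?s = "Arg ?w"
  have w: "cis ?s = ?w" using z cis_Arg[of ?w] by (cases "z = 0") (auto simp: sgn_eq norm_mult)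
  have "?s \<noteq> pi"
  proof
    assume "?s = pi"
    then have "z * cis (- a) = 1" using w by simp
    then have "z * cis (- a) * cis a = cis a" by simp
    then show False using z by (simp add: mult.assoc cis_mult)
  qed
  then have "a + pi + ?s \<in> {a<..<a + 2 * pi}" using Arg_bounded[of ?w] by auto
  moreover have "cis (a + pi + ?s) = z"
  proof -
    have "cis (a + pi + ?s) = cis a * cis pi * cis ?s" by (simp only: cis_mult add.assoc)
    also have "\<dots> = z * (cis a * cis (- a))" unfolding w by (simp add: mult.commute mult.left_commute)
    also have "\<dots> = z" unfolding cis_mult by simp
    finally show ?thesis .
  qed
  ultimately show "z \<in> cis ` {a<..<a + 2 * pi}" by (metis image_eqI)
qed

lemma cis_angle: "z \<in> circle \<Longrightarrow> z \<noteq> cis a \<Longrightarrow> cis (angle a z) = z"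
  unfolding angle_def using cis_image[of a] by (intro f_inv_into_f) blast

lemma angle_range: "z \<in> circle \<Longrightarrow> z \<noteq> cis a \<Longrightarrow> angle a z \<in> {a<..<a + 2 * pi}"
  unfolding angle_def using cis_image[of a] by (intro inv_into_into) blast

lemma angle_cis: "t \<in> {a<..<a + 2 * pi} \<Longrightarrow> angle a (cis t) = t"
  unfolding angle_def by (rule inv_into_f_f[OF inj_on_cis])

lemma cis_not_base: "t \<in> {a<..<a + 2 * pi} \<Longrightarrow> cis t \<noteq> cis a"
  using cis_image[of a] by blast

lemma continuous_angle: "continuous_map (top_of_set (circle - {cis a})) euclideanreal (angle a)"
proof -
  have "continuous_on (circle - {cis a}) (\<lambda>z. a + pi + Arg (- z * cis (- a)))"
  proof (intro continuous_intros)
    fix z assume z: "z \<in> circle - {cis a}"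
    define t where "t = angle a z"
    have t: "t \<in> {a<..<a + 2 * pi}" "z = cis t" using angle_range[of z a] cis_angle[of z a] z by (auto simp: t_def)
    have "Arg (- z * cis (- a)) = t - a - pi" using angle_formula[OF t(1)] t(2) by simp
    moreover have "- z * cis (- a) \<noteq> 0" using z by auto
    ultimately show "- z * cis (- a) \<notin> \<real>\<^sub>\<le>\<^sub>0" using t(1) Arg_eq_pi[of "- z * cis (- a)"]
      by (auto simp: complex_nonpos_Reals_iff complex_eq_iff less_le)
  qed
  then have "continuous_on (circle - {cis a}) (angle a)"
  proof (rule continuous_on_eq)
    fix z assume z: "z \<in> circle - {cis a}"
    then show "a + pi + Arg (- z * cis (- a)) = angle a z"
      using angle_formula[OF angle_range[of z a]] cis_angle[of z a] by simp
  qed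
  then show ?thesis by simp
qed

lemma circle_manifold_simps [simp]: "mtop circle_manifold = top_of_set circle" "mdim circle_manifold = 1"
  by (simp_all add: circle_manifold_def)

lemma angle_chart_image:
  "(\<lambda>z (i::nat). if i = 0 then angle a z else 0) ` (circle - {cis a}) = {x \<in> coord_space 1. x 0 \<in> {a<..<a + 2 * pi}}"
proof (intro equalityI subsetI)
  fix x assume "x \<in> {x \<in> coord_space 1. x 0 \<in> {a<..<a + 2 * pi}}"
  then have x: "x \<in> coord_space 1" "x 0 \<in> {a<..<a + 2 * pi}" by auto
  have "x = (\<lambda>i. if i = 0 then angle a (cis (x 0)) else 0)"
    using x(1) angle_cis[OF x(2)] by (auto simp: coord_space_iff fun_eq_iff)
  then show "x \<in> (\<lambda>z i. if i = 0 then angle a z else 0) ` (circle - {cis a})"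
    using cis_not_base[OF x(2)] by (intro image_eqI[of _ _ "cis (x 0)"]) auto
next
  fix x assume "x \<in> (\<lambda>z (i::nat). if i = 0 then angle a z else 0) ` (circle - {cis a})"
  then show "x \<in> {x \<in> coord_space 1. x 0 \<in> {a<..<a + 2 * pi}}"
    using angle_range by (auto simp: coord_space_iff)
qed

lemma angle_chart_inv:
  fixes x :: "nat \<Rightarrow> real"
  assumes "x \<in> coord_space 1" "x 0 \<in> {a<..<a + 2 * pi}"
  shows "inv_into (circle - {cis a}) (\<lambda>z i. if i = 0 then angle a z else 0) x = cis (x 0)"
proof -
  let ?\<phi> = "\<lambda>z i::nat. if i = 0 then angle a z else 0"
  have inj: "inj_on ?\<phi> (circle - {cis a})"
    by (rule inj_on_inverseI[of _ "\<lambda>x. cis (x 0)"]) (simp add: cis_angle)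
  have eq: "?\<phi> (cis (x 0)) = x" using assms angle_cis[OF assms(2)] by (auto simp: coord_space_iff fun_eq_iff)
  have "cis (x 0) \<in> circle - {cis a}" using cis_not_base[OF assms(2)] by simp
  from inv_into_f_f[OF inj this] show ?thesis by (simp only: eq)
qed

lemma angle_chart_is_chart: "is_chart 1 (top_of_set circle) (circle - {cis a}, \<lambda>z i. if i = 0 then angle a z else 0)"
proof (rule is_chartI)
  let ?\<phi> = "\<lambda>z i::nat. if i = 0 then angle a z else 0"
  show "openin (top_of_set circle) (circle - {cis a})" by (simp add: openin_diff)
  have "openin (Euclidean_space 1) {x \<in> topspace (Euclidean_space 1). x 0 \<in> {a<..<a + 2 * pi}}"
    by (rule openin_continuous_map_preimage[OF continuous_map_coordinate]) simp
  then show "openin (Euclidean_space 1) (?\<phi> ` (circle - {cis a}))" by (simp only: angle_chart_image)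
  show "inj_on ?\<phi> (circle - {cis a})"
    by (rule inj_on_inverseI[of _ "\<lambda>x. cis (x 0)"]) (simp add: cis_angle)
  show "continuous_map (subtopology (top_of_set circle) (circle - {cis a})) (Euclidean_space 1) ?\<phi>"
  proof (rule continuous_map_into_Euclidean_space)
    have "subtopology (top_of_set circle) (circle - {cis a}) = top_of_set (circle - {cis a})"
      by (simp add: subtopology_subtopology inf.absorb2)
    then show "continuous_map (subtopology (top_of_set circle) (circle - {cis a})) euclideanreal (\<lambda>z. ?\<phi> z i)" for i
      using continuous_angle[of a] by (cases "i = 0") auto
  qed (simp add: coord_space_iff)
  have "continuous_map (Euclidean_space 1) (top_of_set circle) (\<lambda>x. cis (x 0))"
  proof -
    have "continuous_map euclideanreal (top_of_set circle) cis"
      by (auto simp: continuous_map_in_subtopology intro!: continuous_intros)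
    from continuous_map_compose[OF continuous_map_coordinate this] show ?thesis by (simp add: o_def)
  qed
  then have "continuous_map (subtopology (Euclidean_space 1) (?\<phi> ` (circle - {cis a}))) (top_of_set circle) (\<lambda>x. cis (x 0))"
    by (rule continuous_map_from_subtopology)
  then show "continuous_map (subtopology (Euclidean_space 1) (?\<phi> ` (circle - {cis a}))) (top_of_set circle)
      (inv_into (circle - {cis a}) ?\<phi>)"
    by (rule continuous_map_eq) (simp only: angle_chart_image topspace_subtopology Int_iff mem_Collect_eq angle_chart_inv)
qed

lemma open_cis_not: "openin (Euclidean_space 1) {x \<in> coord_space 1. cis (x 0) \<noteq> cis b}"
proof -
  have "continuous_map euclideanreal euclidean cis" by (auto intro!: continuous_intros)
  from continuous_map_compose[OF continuous_map_coordinate[of 1 0] this]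
  have "continuous_map (Euclidean_space 1) euclidean (\<lambda>x. cis (x 0))" by (simp add: o_def)
  from openin_continuous_map_preimage[OF this, of "- {cis b}"] show ?thesis by (simp add: open_Compl)
qed

text \<open>The angle of \<open>cis t\<close> differs from \<open>t\<close> by a multiple of \<open>2 \<pi>\<close> that is locally constant in \<open>t\<close>.\<close>

lemma smooth_on_angle_cis: "smooth_on 1 {x \<in> coord_space 1. cis (x 0) \<noteq> cis b} (\<lambda>x. angle b (cis (x 0)))"
proof (rule smooth_on_local)
  let ?V = "{x \<in> coord_space 1. cis (x 0) \<noteq> cis b}"
  fix x assume x: "x \<in> ?V"
  \<comment> \<open>\<open>c\<close> is the multiple of \<open>2 \<pi>\<close> that is right at \<open>x\<close>; it stays right as long as the shifted argument is in the
    range of the angle.\<close>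
  define c where "c = angle b (cis (x 0)) - x 0"
  have "cis (x 0 + c) = cis (x 0)" using x cis_angle[of "cis (x 0)" b] by (simp add: c_def)
  then have "cis c = 1" by (simp flip: cis_mult)
  then have shift: "cis (t + c) = cis t" for t by (simp flip: cis_mult)
  let ?W = "{y \<in> coord_space 1. y 0 \<in> {b - c<..<b + 2 * pi - c}}"
  have W: "openin (Euclidean_space 1) ?W"
    by (rule openin_continuous_map_preimage[OF continuous_map_coordinate]) simp
  have "angle b (cis (x 0)) \<in> {b<..<b + 2 * pi}" using x by (intro angle_range) auto
  then have "x 0 \<in> {b - c<..<b + 2 * pi - c}" by (auto simp: c_def)
  then have xW: "x \<in> ?W" using x by blast
  have ang: "angle b (cis (y 0)) = y 0 + c" if "y \<in> ?W" for y
    using that angle_cis[of "y 0 + c" b] shift[of "y 0"] by auto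
  have "smooth_on 1 ?W (\<lambda>y. angle b (cis (y 0)))"
    by (rule smooth_on_cong[OF W _ smooth_on_add[OF W smooth_on_coordinate[of 1 _ 0] smooth_on_const[of 1 _ c]]])
      (simp add: ang)
  then have "smooth_on 1 (?W \<inter> ?V) (\<lambda>y. angle b (cis (y 0)))" by (rule smooth_on_subset) blast
  then show "\<exists>W. openin (Euclidean_space 1) W \<and> x \<in> W \<and> smooth_on 1 (W \<inter> ?V) (\<lambda>y. angle b (cis (y 0)))"
    using W xW by blast
qed auto

lemma circle_atlas: "smooth_atlas 1 (top_of_set circle) (range angle_chart)"
  unfolding smooth_atlas_def
proof (intro conjI ballI)
  show "is_chart 1 (top_of_set circle) c" if "c \<in> range angle_chart" for c
    using that angle_chart_is_chart by (auto simp: angle_chart_eq)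
  show "(\<Union>c\<in>range angle_chart. fst c) = topspace (top_of_set circle)"
  proof
    show "topspace (top_of_set circle) \<subseteq> (\<Union>c\<in>range angle_chart. fst c)"
    proof
      fix z :: complex assume z: "z \<in> topspace (top_of_set circle)"
      have "z \<in> fst (angle_chart (if z = 1 then pi else 0))" using z by (auto simp: angle_chart_eq)
      then show "z \<in> (\<Union>c\<in>range angle_chart. fst c)" by blast
    qed
  qed (auto simp: angle_chart_eq)
  have *: "smooth_between 1 1 ((\<lambda>z i. if i = 0 then angle a z else 0) ` ((circle - {cis a}) \<inter> (circle - {cis b})))
     ((\<lambda>z i. if i = 0 then angle b z else 0) \<circ> inv_into (circle - {cis a}) (\<lambda>z i. if i = 0 then angle a z else 0))"
    (is "smooth_between 1 1 ?W ?f") for a b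
  proof -
    note ca = angle_chart_is_chart[of a]
    have W: "openin (Euclidean_space 1) ?W"
      by (rule chart_image_open[OF ca]) (use chart_open[OF ca] chart_open[OF angle_chart_is_chart[of b]] in blast)+
    have sub: "?W \<subseteq> {x \<in> coord_space 1. cis (x 0) \<noteq> cis b}" by (auto simp: cis_angle coord_space_iff)
    have fx: "?f x 0 = angle b (cis (x 0))" if "x \<in> ?W" for x
    proof -
      have "x \<in> {x \<in> coord_space 1. x 0 \<in> {a<..<a + 2 * pi}}"
        by (rule subsetD[OF equalityD1[OF angle_chart_image]]) (use that in blast)
      then show ?thesis using angle_chart_inv[of x a] by auto
    qed
    have "smooth_on 1 ?W (\<lambda>x. ?f x 0)"
      by (rule smooth_on_cong[OF W _ smooth_on_subset[OF smooth_on_angle_cis sub]]) (simp only: fx)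
    moreover have "?f ` ?W \<subseteq> coord_space 1" by (auto simp: coord_space_iff)
    ultimately show ?thesis by (simp add: smooth_between_iff)
  qed
  fix c d :: "complex chart" assume "c \<in> range angle_chart" "d \<in> range angle_chart"
  then obtain a b where cd: "c = angle_chart a" "d = angle_chart b" by blast
  show "compatible_charts 1 c d"
    using *[of a b] *[of b a] unfolding cd angle_chart_eq compatible_charts_def by (simp only: prod.case Int_commute)
qed

lemma smooth_structure_circle: "smooth_structure circle_manifold"
  unfolding circle_manifold_def by (rule smooth_structure_maximal_atlas(1)[OF circle_atlas])

lemma angle_chart_in: "(circle - {cis a}, \<lambda>z i. if i = 0 then angle a z else 0) \<in> charts circle_manifold"
proof -
  have "angle_chart a \<in> charts circle_manifold"
    unfolding circle_manifold_def manifold.select_convs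
    by (rule subsetD[OF smooth_structure_maximal_atlas(2)[OF circle_atlas]]) simp
  then show ?thesis by (simp only: angle_chart_eq)
qed

lemma exists_cis_not: "\<exists>a. cis a \<noteq> z"
  by (rule exI[of _ "if z = 1 then pi else 0"]) auto

lemma smooth_map_cis:
  assumes M: "smooth_structure M" and \<theta>: "smooth_fun M \<theta>"
  shows "smooth_map M circle_manifold (\<lambda>p. cis (\<theta> p))"
proof (rule smooth_mapI[OF M smooth_structure_circle])
  fix p assume p: "p \<in> topspace (mtop M)"
  obtain b where b: "cis b \<noteq> cis (\<theta> p)" using exists_cis_not by blast
  let ?W = "{q \<in> topspace (mtop M). (\<lambda>i. if i = 0 then \<theta> q else 0) \<in> {x \<in> coord_space 1. cis (x 0) \<noteq> cis b}}"
  have "continuous_map (mtop M) (Euclidean_space 1) (\<lambda>q i. if i = 0 then \<theta> q else 0)"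
    by (rule continuous_map_into_Euclidean_space) (use smooth_fun_continuous[OF M \<theta>] in \<open>simp_all add: coord_space_iff\<close>)
  from openin_continuous_map_preimage[OF this open_cis_not] have W: "openin (mtop M) ?W" .
  have "smooth_fun (open_submanifold M ?W) (\<lambda>q. angle b (cis ((\<lambda>i::nat. if i = 0 then \<theta> q else 0) 0)))"
    by (rule smooth_fun_of_smooth_on[OF smooth_structure_open_submanifold[OF M W] open_cis_not smooth_on_angle_cis])
      (use smooth_fun_restrict[OF \<theta>] in auto)
  then show "\<exists>W V \<psi>. openin (mtop M) W \<and> p \<in> W \<and> (V, \<psi>) \<in> charts circle_manifold \<and> (\<lambda>p. cis (\<theta> p)) ` W \<subseteq> V \<and>
      (\<forall>j<mdim circle_manifold. smooth_fun (open_submanifold M W) (\<lambda>q. \<psi> (cis (\<theta> q)) j))"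
    using W p b angle_chart_in[of b]
    by (intro exI[of _ ?W] exI[of _ "circle - {cis b}"] exI[of _ "\<lambda>z i. if i = 0 then angle b z else 0"])
      (auto simp: coord_space_iff)
qed

lemma smooth_fun_angle:
  assumes M: "smooth_structure M" and f: "smooth_map M circle_manifold f"
    and a: "\<And>p. p \<in> topspace (mtop M) \<Longrightarrow> f p \<noteq> cis a"
  shows "smooth_fun M (\<lambda>p. angle a (f p))"
  using smooth_map_coordinate[OF M smooth_structure_circle f angle_chart_in[of a], of 0]
    a smooth_map_in_topspace[OF f] by simp

text \<open>Locally a smooth circle-valued map has a smooth angle.  This reduces products and inverses in the circle
  to sums and negatives of angles.\<close>

lemma smooth_map_circle_angle_nbhd:
  assumes M: "smooth_structure M" and f: "smooth_map M circle_manifold f" and p: "p \<in> topspace (mtop M)"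
  obtains W a where "openin (mtop M) W" "p \<in> W" "smooth_fun (open_submanifold M W) (\<lambda>q. angle a (f q))"
    "\<And>q. q \<in> W \<Longrightarrow> cis (angle a (f q)) = f q"
proof -
  obtain a where a: "cis a \<noteq> f p" using exists_cis_not by blast
  let ?W = "topspace (mtop M) \<inter> f -` (circle - {cis a})"
  have W: "openin (mtop M) ?W"
    by (rule smooth_map_preimage_open[OF f chart_open[OF structure_chart[OF smooth_structure_circle angle_chart_in]]])
  have "smooth_fun (open_submanifold M ?W) (\<lambda>q. angle a (f q))"
    by (rule smooth_fun_angle[OF smooth_structure_open_submanifold[OF M W] smooth_map_restrict[OF f]]) auto
  moreover have "cis (angle a (f q)) = f q" if "q \<in> ?W" for q using that by (intro cis_angle) auto
  moreover have "p \<in> ?W" using p a smooth_map_in_topspace[OF f p] by auto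
  ultimately show ?thesis using W that by blast
qed

lemma smooth_map_circle_mult:
  assumes M: "smooth_structure M" and f: "smooth_map M circle_manifold f" and g: "smooth_map M circle_manifold g"
  shows "smooth_map M circle_manifold (\<lambda>p. f p * g p)"
proof (rule smooth_map_local[OF M smooth_structure_circle])
  fix p assume p: "p \<in> topspace (mtop M)"
  obtain W a where W: "openin (mtop M) W" "p \<in> W" "smooth_fun (open_submanifold M W) (\<lambda>q. angle a (f q))"
    "\<And>q. q \<in> W \<Longrightarrow> cis (angle a (f q)) = f q" using smooth_map_circle_angle_nbhd[OF M f p] by blast
  obtain W' b where W': "openin (mtop M) W'" "p \<in> W'" "smooth_fun (open_submanifold M W') (\<lambda>q. angle b (g q))"
    "\<And>q. q \<in> W' \<Longrightarrow> cis (angle b (g q)) = g q" using smooth_map_circle_angle_nbhd[OF M g p] by blast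
  have o: "openin (mtop M) (W \<inter> W')" using W(1) W'(1) by blast
  note S = smooth_structure_open_submanifold[OF M o]
  have "smooth_fun (open_submanifold M (W \<inter> W')) (\<lambda>q. angle a (f q))"
    "smooth_fun (open_submanifold M (W \<inter> W')) (\<lambda>q. angle b (g q))"
    using smooth_fun_restrict[OF W(3), of "W \<inter> W'"] smooth_fun_restrict[OF W'(3), of "W \<inter> W'"]
    by (simp_all add: open_submanifold_open_submanifold)
  from smooth_map_cis[OF S smooth_fun_add[OF S this]]
  have "smooth_map (open_submanifold M (W \<inter> W')) circle_manifold (\<lambda>p. f p * g p)"
    by (rule smooth_map_cong[OF S smooth_structure_circle, rotated]) (simp add: W(4) W'(4) flip: cis_mult)
  then show "\<exists>W. openin (mtop M) W \<and> p \<in> W \<and> smooth_map (open_submanifold M W) circle_manifold (\<lambda>p. f p * g p)"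
    using o W(2) W'(2) by blast
qed

lemma smooth_map_circle_inverse:
  assumes M: "smooth_structure M" and f: "smooth_map M circle_manifold f"
  shows "smooth_map M circle_manifold (\<lambda>p. inverse (f p))"
proof (rule smooth_map_local[OF M smooth_structure_circle])
  fix p assume p: "p \<in> topspace (mtop M)"
  obtain W a where W: "openin (mtop M) W" "p \<in> W" "smooth_fun (open_submanifold M W) (\<lambda>q. angle a (f q))"
    "\<And>q. q \<in> W \<Longrightarrow> cis (angle a (f q)) = f q" using smooth_map_circle_angle_nbhd[OF M f p] by blast
  note S = smooth_structure_open_submanifold[OF M W(1)]
  have "smooth_map (open_submanifold M W) circle_manifold (\<lambda>q. cis (- 1 * angle a (f q)))"
    by (rule smooth_map_cis[OF S smooth_fun_mult[OF S smooth_fun_const W(3)]])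
  then have "smooth_map (open_submanifold M W) circle_manifold (\<lambda>p. inverse (f p))"
    by (rule smooth_map_cong[OF S smooth_structure_circle, rotated]) (metis (no_types) IntE W(4) cis_inverse mult_minus1 open_submanifold_simps(1) topspace_subtopology)
  then show "\<exists>W. openin (mtop M) W \<and> p \<in> W \<and> smooth_map (open_submanifold M W) circle_manifold (\<lambda>p. inverse (f p))"
    using W by blast
qed

section \<open>Differentials\<close>

lemma smooth_map_between_on:
  assumes M: "smooth_structure M" and W: "openin (mtop M) W" and f: "smooth_map (open_submanifold M W) N f"
    and c: "(U, \<phi>) \<in> charts M" and d: "(V, \<psi>) \<in> charts N" and N: "smooth_structure N"
  shows "openin (mtop M) (U \<inter> W \<inter> f -` V)"
    and "smooth_between (mdim M) (mdim N) (\<phi> ` (U \<inter> W \<inter> f -` V)) (\<psi> \<circ> f \<circ> inv_into U \<phi>)"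
proof -
  note c1 = structure_chart[OF M c] and d1 = structure_chart[OF N d]
  have "openin (mtop (open_submanifold M W)) (topspace (mtop (open_submanifold M W)) \<inter> f -` V)"
    by (rule smooth_map_preimage_open[OF f chart_open[OF d1]])
  then have "openin (mtop M) (topspace (mtop (open_submanifold M W)) \<inter> f -` V)" using W by (auto intro: openin_trans_full)
  moreover have "U \<inter> W \<inter> f -` V = U \<inter> (topspace (mtop (open_submanifold M W)) \<inter> f -` V)"
    using chart_subset[OF c1] by auto
  ultimately show o: "openin (mtop M) (U \<inter> W \<inter> f -` V)" using chart_open[OF c1] by (metis openin_Int)
  have "(U \<inter> W, \<phi>) \<in> charts (open_submanifold M W)" using structure_restrict[OF M c W] by simp
  from smooth_mapD[OF f this d]
  have s: "smooth_between (mdim M) (mdim N) (\<phi> ` (U \<inter> W \<inter> f -` V)) (\<psi> \<circ> f \<circ> inv_into (U \<inter> W) \<phi>)" by simp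
  have o': "openin (Euclidean_space (mdim M)) (\<phi> ` (U \<inter> W \<inter> f -` V))" by (rule chart_image_open[OF c1 o]) blast
  show "smooth_between (mdim M) (mdim N) (\<phi> ` (U \<inter> W \<inter> f -` V)) (\<psi> \<circ> f \<circ> inv_into U \<phi>)"
    by (rule smooth_between_cong[OF o' _ s]) (use chart_inv[OF c1] chart_inv[OF chart_restrict[OF c1 W]] in auto)
qed

lemma structure_chart_subset:
  assumes "smooth_structure M" "c \<in> charts M"
  shows "fst c \<subseteq> topspace (mtop M)"
proof -
  have "is_chart (mdim M) (mtop M) (fst c, snd c)" using structure_chart[OF assms] by simp
  then show ?thesis by (rule chart_subset)
qed

lemma differential_in_range: "differential_in M N c d f p v \<in> coord_space (mdim N)"
  by (simp add: differential_in_def jacobian_map_in_coord_space)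

text \<open>The maps are given on open subsets only, since the sections to which this is applied are local.\<close>

lemma differential_compose:
  assumes M: "smooth_structure M" and N: "smooth_structure N" and P: "smooth_structure P"
    and W: "openin (mtop M) W" and f: "smooth_map (open_submanifold M W) N f"
    and W': "openin (mtop N) W'" and g: "smooth_map (open_submanifold N W') P g"
    and c: "c \<in> charts M" and d: "d \<in> charts N" and e: "e \<in> charts P"
    and p: "p \<in> fst c" "p \<in> W" "f p \<in> fst d" "f p \<in> W'" "g (f p) \<in> fst e"
  shows "differential_in M P c e (\<lambda>q. g (f q)) p v =
    differential_in N P d e g (f p) (differential_in M N c d f p v)"
proof -
  obtain U \<phi> V \<psi> Q \<rho> where cde: "c = (U, \<phi>)" "d = (V, \<psi>)" "e = (Q, \<rho>)" by (cases c; cases d; cases e) auto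
  note c = c[unfolded cde] and d = d[unfolded cde] and e = e[unfolded cde] and p = p[unfolded cde fst_conv]
  note c1 = structure_chart[OF M c] and d1 = structure_chart[OF N d] and e1 = structure_chart[OF P e]
  let ?m = "mdim M" and ?n = "mdim N" and ?k = "mdim P"
  let ?B = "V \<inter> W' \<inter> g -` Q"
  have B: "openin (mtop N) ?B" by (rule smooth_map_between_on(1)[OF N W' g d e P])
  have B': "openin (Euclidean_space ?n) (\<psi> ` ?B)" by (rule chart_image_open[OF d1 B]) blast
  have NB: "(?B, \<psi>) \<in> charts N"
  proof -
    have "V \<inter> ?B = ?B" by blast
    then show ?thesis using structure_restrict[OF N d B] by simp
  qed
  let ?A = "U \<inter> W \<inter> f -` ?B"
  have A: "openin (mtop M) ?A" by (rule smooth_map_between_on(1)[OF M W f c NB N])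
  have A': "openin (Euclidean_space ?m) (\<phi> ` ?A)" by (rule chart_image_open[OF c1 A]) blast
  have pA: "\<phi> p \<in> \<phi> ` ?A" using p by blast
  have "smooth_between ?m ?n (\<phi> ` ?A) (\<psi> \<circ> f \<circ> inv_into U \<phi>)" by (rule smooth_map_between_on(2)[OF M W f c NB N])
  moreover have "smooth_between ?n ?k (\<psi> ` ?B) (\<rho> \<circ> g \<circ> inv_into V \<psi>)" by (rule smooth_map_between_on(2)[OF N W' g d e P])
  moreover have "(\<psi> \<circ> f \<circ> inv_into U \<phi>) ` \<phi> ` ?A \<subseteq> \<psi> ` ?B" using chart_inv[OF c1] by auto
  ultimately have "jacobian_map ?m ?k ((\<rho> \<circ> g \<circ> inv_into V \<psi>) \<circ> (\<psi> \<circ> f \<circ> inv_into U \<phi>)) (\<phi> p) v =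
     jacobian_map ?n ?k (\<rho> \<circ> g \<circ> inv_into V \<psi>) ((\<psi> \<circ> f \<circ> inv_into U \<phi>) (\<phi> p)) (jacobian_map ?m ?n (\<psi> \<circ> f \<circ> inv_into U \<phi>) (\<phi> p) v)"
    by (rule jacobian_map_compose[OF B' A' _ _ _ pA])
  moreover have "jacobian_map ?m ?k (\<rho> \<circ> (\<lambda>q. g (f q)) \<circ> inv_into U \<phi>) (\<phi> p) v =
      jacobian_map ?m ?k ((\<rho> \<circ> g \<circ> inv_into V \<psi>) \<circ> (\<psi> \<circ> f \<circ> inv_into U \<phi>)) (\<phi> p) v"
    by (rule jacobian_map_cong[OF A' pA]) (use chart_inv[OF c1] chart_inv[OF d1] in auto)
  ultimately show ?thesis using chart_inv[OF c1 p(1)] by (simp add: differential_in_def cde)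
qed

lemma differential_ident:
  assumes M: "smooth_structure M" and W: "openin (mtop M) W" "p \<in> W" and f: "\<And>q. q \<in> W \<Longrightarrow> f q = q"
    and c: "c \<in> charts M" "p \<in> fst c" and v: "v \<in> coord_space (mdim M)"
  shows "differential_in M M c c f p v = v"
proof -
  obtain U \<phi> where cc: "c = (U, \<phi>)" by (cases c)
  note c1 = structure_chart[OF M c(1), unfolded cc]
  have o: "openin (Euclidean_space (mdim M)) (\<phi> ` (U \<inter> W))"
    by (rule chart_image_open[OF c1]) (use chart_open[OF c1] W in blast)+
  have "jacobian_map (mdim M) (mdim M) (\<phi> \<circ> f \<circ> inv_into U \<phi>) (\<phi> p) v = jacobian_map (mdim M) (mdim M) (\<lambda>y. y) (\<phi> p) v"
    by (rule jacobian_map_cong[OF o]) (use c W f chart_inv[OF c1] cc in auto)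
  then show ?thesis using jacobian_map_id[OF v] by (simp add: differential_in_def cc)
qed

lemma smooth_map_as_restricted: "smooth_map M N f \<Longrightarrow> smooth_map (open_submanifold M (topspace (mtop M))) N f"
  by (rule smooth_map_restrict)

text \<open>The differential of a local section is a right inverse of the differential of the map.\<close>

lemma submersion_if_local_sections:
  assumes M: "smooth_structure M" and N: "smooth_structure N" and f: "smooth_map M N f"
    and s: "\<And>p. p \<in> topspace (mtop M) \<Longrightarrow> \<exists>W s. openin (mtop N) W \<and> f p \<in> W \<and> smooth_map (open_submanifold N W) M s \<and>
        s (f p) = p \<and> (\<forall>y\<in>W. f (s y) = y)"
  shows "submersion M N f"
  unfolding submersion_def
proof (intro conjI ballI f)
  fix c d p assume c: "c \<in> charts M" and d: "d \<in> charts N" and p: "p \<in> fst c \<inter> f -` fst d"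
  have pM: "p \<in> topspace (mtop M)" using p structure_chart_subset[OF M c] by blast
  from s[OF pM] obtain W s where W: "openin (mtop N) W" "f p \<in> W" "smooth_map (open_submanifold N W) M s"
    "s (f p) = p" "\<forall>y\<in>W. f (s y) = y" by (elim exE conjE)
  have sec: "differential_in M N c d f p (differential_in N M d c s (f p) w) = w" if w: "w \<in> coord_space (mdim N)" for w
  proof -
    have "differential_in N N d d (\<lambda>q. f (s q)) (f p) w =
        differential_in M N c d f (s (f p)) (differential_in N M d c s (f p) w)"
      by (rule differential_compose[OF N M N W(1,3) _ smooth_map_as_restricted[OF f] d c d])
        (use p pM W in auto)
    moreover have "differential_in N N d d (\<lambda>q. f (s q)) (f p) w = w"
      by (rule differential_ident[OF N W(1,2) _ d _ w]) (use p W in auto)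
    ultimately show ?thesis using W(4) by simp
  qed
  show "differential_in M N c d f p ` coord_space (mdim M) = coord_space (mdim N)"
  proof (intro equalityI subsetI)
    fix w assume "w \<in> coord_space (mdim N)"
    then show "w \<in> differential_in M N c d f p ` coord_space (mdim M)"
      using sec differential_in_range[of N M d c] by (intro image_eqI[of _ _ "differential_in N M d c s (f p) w"]) auto
  qed (auto simp: differential_in_range)
qed

lemma submersion_compose:
  assumes M: "smooth_structure M" and N: "smooth_structure N" and P: "smooth_structure P"
    and f: "submersion M N f" and g: "submersion N P g"
  shows "submersion M P (\<lambda>p. g (f p))"
  unfolding submersion_def
proof (intro conjI ballI)
  have fg: "smooth_map M N f" "smooth_map N P g" using f g by (auto simp: submersion_def)
  show "smooth_map M P (\<lambda>p. g (f p))" by (rule smooth_map_compose[OF M N P fg])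
  fix c e p assume c: "c \<in> charts M" and e: "e \<in> charts P" and p: "p \<in> fst c \<inter> (\<lambda>p. g (f p)) -` fst e"
  have pM: "p \<in> topspace (mtop M)" using p structure_chart_subset[OF M c] by blast
  then have fp: "f p \<in> topspace (mtop N)" by (rule smooth_map_in_topspace[OF fg(1)])
  then obtain V \<psi> where d: "(V, \<psi>) \<in> charts N" "f p \<in> V" using structure_cover[OF N] by blast
  have "differential_in M P c e (\<lambda>p. g (f p)) p =
      differential_in N P (V, \<psi>) e g (f p) \<circ> differential_in M N c (V, \<psi>) f p"
    unfolding o_def
    by (rule ext, rule differential_compose[OF M N P _ smooth_map_as_restricted[OF fg(1)] _ smooth_map_as_restricted[OF fg(2)] c d(1) e])
      (use p pM fp d(2) in auto)
  moreover have "differential_in M N c (V, \<psi>) f p ` coord_space (mdim M) = coord_space (mdim N)"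
    using f c d p unfolding submersion_def by fastforce
  moreover have "differential_in N P (V, \<psi>) e g (f p) ` coord_space (mdim N) = coord_space (mdim P)"
    using g d e p unfolding submersion_def by fastforce
  ultimately show "differential_in M P c e (\<lambda>p. g (f p)) p ` coord_space (mdim M) = coord_space (mdim P)"
    by (simp only: image_comp[symmetric])
qed

lemma immersion_compose:
  assumes M: "smooth_structure M" and N: "smooth_structure N" and P: "smooth_structure P"
    and f: "immersion M N f" and g: "immersion N P g"
  shows "immersion M P (\<lambda>p. g (f p))"
  unfolding immersion_def
proof (intro conjI ballI)
  have fg: "smooth_map M N f" "smooth_map N P g" using f g by (auto simp: immersion_def)
  show "smooth_map M P (\<lambda>p. g (f p))" by (rule smooth_map_compose[OF M N P fg])
  fix c e p assume c: "c \<in> charts M" and e: "e \<in> charts P" and p: "p \<in> fst c \<inter> (\<lambda>p. g (f p)) -` fst e"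
  have pM: "p \<in> topspace (mtop M)" using p structure_chart_subset[OF M c] by blast
  then have fp: "f p \<in> topspace (mtop N)" by (rule smooth_map_in_topspace[OF fg(1)])
  then obtain V \<psi> where d: "(V, \<psi>) \<in> charts N" "f p \<in> V" using structure_cover[OF N] by blast
  have "differential_in M P c e (\<lambda>p. g (f p)) p v =
      differential_in N P (V, \<psi>) e g (f p) (differential_in M N c (V, \<psi>) f p v)" for v
    by (rule differential_compose[OF M N P _ smooth_map_as_restricted[OF fg(1)] _ smooth_map_as_restricted[OF fg(2)] c d(1) e])
      (use p pM fp d(2) in auto)
  moreover have "inj_on (differential_in M N c (V, \<psi>) f p) (coord_space (mdim M))"
    using f c d p unfolding immersion_def by fastforce
  moreover have "inj_on (differential_in N P (V, \<psi>) e g (f p)) (coord_space (mdim N))"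
    using g d e p unfolding immersion_def by fastforce
  ultimately show "inj_on (differential_in M P c e (\<lambda>p. g (f p)) p) (coord_space (mdim M))"
    unfolding inj_on_def using differential_in_range[of M N c "(V, \<psi>)" f p] by metis
qed

text \<open>If the composite of the differentials is injective, then so is the first of them.\<close>

lemma immersion_factor:
  assumes M: "smooth_structure M" and N: "smooth_structure N" and P: "smooth_structure P"
    and f: "smooth_map M N f" and g: "smooth_map N P g" and gf: "immersion M P (\<lambda>p. g (f p))"
  shows "immersion M N f"
  unfolding immersion_def
proof (intro conjI ballI f)
  fix c d p assume c: "c \<in> charts M" and d: "d \<in> charts N" and p: "p \<in> fst c \<inter> f -` fst d"
  have pM: "p \<in> topspace (mtop M)" using p structure_chart_subset[OF M c] by blast
  then have fp: "f p \<in> topspace (mtop N)" by (rule smooth_map_in_topspace[OF f])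
  then obtain Q \<rho> where e: "(Q, \<rho>) \<in> charts P" "g (f p) \<in> Q"
    using structure_cover[OF P smooth_map_in_topspace[OF g]] by blast
  have eq: "differential_in M P c (Q, \<rho>) (\<lambda>p. g (f p)) p v =
      differential_in N P d (Q, \<rho>) g (f p) (differential_in M N c d f p v)" for v
    by (rule differential_compose[OF M N P _ smooth_map_as_restricted[OF f] _ smooth_map_as_restricted[OF g] c d e(1)])
      (use p pM fp e(2) in auto)
  have "inj_on (differential_in M P c (Q, \<rho>) (\<lambda>p. g (f p)) p) (coord_space (mdim M))"
    using gf c e p unfolding immersion_def by fastforce
  then show "inj_on (differential_in M N c d f p) (coord_space (mdim M))"
    unfolding eq by (auto simp: inj_on_def)
qed

text \<open>The differential of the left inverse is a left inverse of the differential.\<close>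

lemma immersion_if_left_inverse:
  assumes M: "smooth_structure M" and N: "smooth_structure N" and f: "smooth_map M N f" and g: "smooth_map N M g"
    and gf: "\<And>p. p \<in> topspace (mtop M) \<Longrightarrow> g (f p) = p"
  shows "immersion M N f"
  unfolding immersion_def
proof (intro conjI ballI f)
  fix c d p assume c: "c \<in> charts M" and d: "d \<in> charts N" and p: "p \<in> fst c \<inter> f -` fst d"
  have pM: "p \<in> topspace (mtop M)" using p structure_chart_subset[OF M c] by blast
  then have fp: "f p \<in> topspace (mtop N)" by (rule smooth_map_in_topspace[OF f])
  have "differential_in N M d c g (f p) (differential_in M N c d f p v) = v" if v: "v \<in> coord_space (mdim M)" for v
  proof -
    have "differential_in M M c c (\<lambda>q. g (f q)) p v =
        differential_in N M d c g (f p) (differential_in M N c d f p v)"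
      by (rule differential_compose[OF M N M _ smooth_map_as_restricted[OF f] _ smooth_map_as_restricted[OF g] c d c])
        (use p pM fp gf in auto)
    moreover have "differential_in M M c c (\<lambda>q. g (f q)) p v = v"
      by (rule differential_ident[OF M openin_topspace pM _ c _ v]) (use p gf in auto)
    ultimately show ?thesis by simp
  qed
  then show "inj_on (differential_in M N c d f p) (coord_space (mdim M))"
    by (rule inj_on_inverseI[of _ "differential_in N M d c g (f p)"])
qed

lemma submersion_cong:
  assumes M: "smooth_structure M" and N: "smooth_structure N" and f: "submersion M N f"
    and fg: "\<And>p. p \<in> topspace (mtop M) \<Longrightarrow> f p = g p"
  shows "submersion M N g"
  unfolding submersion_def
proof (intro conjI ballI)
  show "smooth_map M N g" by (rule smooth_map_cong[OF M N fg]) (use f in \<open>simp_all add: submersion_def\<close>)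
  fix c d p assume c: "c \<in> charts M" and d: "d \<in> charts N" and p: "p \<in> fst c \<inter> g -` fst d"
  obtain U \<phi> where cc: "c = (U, \<phi>)" by (cases c)
  note c1 = structure_chart[OF M c, unfolded cc]
  have U: "f q = g q" if "q \<in> U" for q using that fg chart_subset[OF c1] by blast
  have "differential_in M N c d g p v = differential_in M N c d f p v" for v
    unfolding differential_in_def cc fst_conv snd_conv
    by (rule jacobian_map_cong[OF chart_open_image[OF c1]]) (use p cc U chart_inv[OF c1] in auto)
  then have "differential_in M N c d g p = differential_in M N c d f p" by blast
  then show "differential_in M N c d g p ` coord_space (mdim M) = coord_space (mdim N)"
    using f c d p U cc unfolding submersion_def by fastforce
qed

section \<open>Dimensions\<close>

text \<open>If \<open>n < m\<close>, the image would be open in \<open>\<real>\<^sup>m\<close> by invariance of domain.  But it lies in \<open>\<real>\<^sup>n\<close>, so it cannot contain a point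
  whose coordinate with index \<open>n\<close> has been moved away from 0.\<close>

lemma dimension_le_if_embedding:
  assumes U: "openin (Euclidean_space m) U" "U \<noteq> {}"
    and f: "continuous_map (subtopology (Euclidean_space m) U) (Euclidean_space n) f" "inj_on f U"
  shows "m \<le> n"
proof (rule ccontr)
  assume "\<not> m \<le> n"
  then have nm: "n < m" by simp
  have sub: "f ` U \<subseteq> coord_space n" using f(1) U(1) openin_subset by (fastforce simp: continuous_map_def)
  have "continuous_map (Euclidean_space n) (Euclidean_space m) (\<lambda>x. x)"
    by (rule continuous_map_into_Euclidean_space) (use nm in \<open>auto simp: continuous_map_coordinate coord_space_iff\<close>)
  from continuous_map_compose[OF f(1) this]
  have "continuous_map (subtopology (Euclidean_space m) U) (Euclidean_space m) f" by (simp add: o_def)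
  from invariance_of_domain_Euclidean_space[OF U(1) this f(2)]
  have o: "openin (Euclidean_space m) (f ` U)" .
  obtain x where x: "x \<in> U" using U(2) by blast
  obtain \<delta> where \<delta>: "\<delta> > 0" "\<And>y. y \<in> coord_space m \<Longrightarrow> \<forall>i<m. \<bar>y i - f x i\<bar> < \<delta> \<Longrightarrow> y \<in> f ` U"
    using Euclidean_space_box[OF o imageI[OF x]] by blast
  \<comment> \<open>Move the coordinate with index \<open>n\<close>, which vanishes on the image of \<open>f\<close>.\<close>
  let ?y = "(f x)(n := f x n + \<delta> / 2)"
  have fx: "f x \<in> coord_space n" using sub x by blast
  then have "f x \<in> coord_space m" using nm by (auto simp: coord_space_iff)
  then have "?y \<in> f ` U" using \<delta>(1) nm by (intro \<delta>(2) coord_space_upd) auto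
  then have "?y \<in> coord_space n" using sub by blast
  then show False using fx \<delta>(1) by (auto simp: coord_space_iff)
qed

lemma manifold_dimension_le:
  assumes M: "smooth_structure M" and N: "smooth_structure N" and p: "p \<in> topspace (mtop M)"
    and f: "continuous_map (mtop M) (mtop N) f" "inj_on f (topspace (mtop M))"
  shows "mdim M \<le> mdim N"
proof -
  have "f p \<in> topspace (mtop N)" using f(1) p by (auto simp: continuous_map_def)
  then obtain V \<psi> where d: "(V, \<psi>) \<in> charts N" "f p \<in> V" using structure_cover[OF N] by blast
  note d1 = structure_chart[OF N d(1)]
  have "openin (mtop M) (topspace (mtop M) \<inter> f -` V)"
    using openin_continuous_map_preimage[OF f(1) chart_open[OF d1]] by (simp add: vimage_def Collect_conj_eq)
  then obtain U \<phi> where c: "(U, \<phi>) \<in> charts M" "p \<in> U" "U \<subseteq> topspace (mtop M) \<inter> f -` V"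
    using structure_cover_within[OF M, of _ p] p d(2) by blast
  note c1 = structure_chart[OF M c(1)]
  show ?thesis
  proof (rule dimension_le_if_embedding[OF chart_open_image[OF c1]])
    show "\<phi> ` U \<noteq> {}" using c(2) by blast
    have "continuous_map (subtopology (Euclidean_space (mdim M)) (\<phi> ` U)) (mtop N) (f \<circ> inv_into U \<phi>)"
      using chart_inv_continuous[OF c1] f(1) by (rule continuous_map_compose)
    then have "continuous_map (subtopology (Euclidean_space (mdim M)) (\<phi> ` U)) (subtopology (mtop N) V) (f \<circ> inv_into U \<phi>)"
      using c(3) chart_inv[OF c1] by (auto simp: continuous_map_in_subtopology)
    then show "continuous_map (subtopology (Euclidean_space (mdim M)) (\<phi> ` U)) (Euclidean_space (mdim N)) (\<psi> \<circ> (f \<circ> inv_into U \<phi>))"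
      using chart_continuous[OF d1] by (rule continuous_map_compose)
    show "inj_on (\<psi> \<circ> (f \<circ> inv_into U \<phi>)) (\<phi> ` U)"
    proof (rule inj_onI)
      fix y z assume "y \<in> \<phi> ` U" "z \<in> \<phi> ` U" and eq: "(\<psi> \<circ> (f \<circ> inv_into U \<phi>)) y = (\<psi> \<circ> (f \<circ> inv_into U \<phi>)) z"
      then obtain a b where ab: "a \<in> U" "b \<in> U" "y = \<phi> a" "z = \<phi> b" by blast
      then have "\<psi> (f a) = \<psi> (f b)" using eq chart_inv[OF c1] by simp
      then have "f a = f b" using inj_onD[OF chart_inj[OF d1]] ab c(3) by blast
      then have "a = b" using inj_onD[OF f(2)] ab c(3) by blast
      then show "y = z" using ab by simp
    qed
  qed
qed

section \<open>Groupoids and twists\<close>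

lemma groupoid_facts:
  assumes "is_groupoid G"
  shows groupoid_unit_arrow: "u \<in> units G \<Longrightarrow> u \<in> arrows G"
    and groupoid_rng: "g \<in> arrows G \<Longrightarrow> rng G g \<in> units G"
    and groupoid_src: "g \<in> arrows G \<Longrightarrow> src G g \<in> units G"
    and groupoid_rng_unit: "u \<in> units G \<Longrightarrow> rng G u = u"
    and groupoid_src_unit: "u \<in> units G \<Longrightarrow> src G u = u"
    and groupoid_mult: "g \<in> arrows G \<Longrightarrow> h \<in> arrows G \<Longrightarrow> src G g = rng G h \<Longrightarrow> gmult G g h \<in> arrows G"
    and groupoid_rng_mult: "g \<in> arrows G \<Longrightarrow> h \<in> arrows G \<Longrightarrow> src G g = rng G h \<Longrightarrow> rng G (gmult G g h) = rng G g"
    and groupoid_src_mult: "g \<in> arrows G \<Longrightarrow> h \<in> arrows G \<Longrightarrow> src G g = rng G h \<Longrightarrow> src G (gmult G g h) = src G h"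
    and groupoid_assoc: "g \<in> arrows G \<Longrightarrow> h \<in> arrows G \<Longrightarrow> k \<in> arrows G \<Longrightarrow> src G g = rng G h \<Longrightarrow>
        src G h = rng G k \<Longrightarrow> gmult G (gmult G g h) k = gmult G g (gmult G h k)"
    and groupoid_rng_left: "g \<in> arrows G \<Longrightarrow> gmult G (rng G g) g = g"
    and groupoid_src_right: "g \<in> arrows G \<Longrightarrow> gmult G g (src G g) = g"
    and groupoid_inv: "g \<in> arrows G \<Longrightarrow> ginv G g \<in> arrows G"
    and groupoid_rng_inv: "g \<in> arrows G \<Longrightarrow> rng G (ginv G g) = src G g"
    and groupoid_src_inv: "g \<in> arrows G \<Longrightarrow> src G (ginv G g) = rng G g"
    and groupoid_right_inv: "g \<in> arrows G \<Longrightarrow> gmult G g (ginv G g) = rng G g"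
    and groupoid_left_inv: "g \<in> arrows G \<Longrightarrow> gmult G (ginv G g) g = src G g"
  using assms unfolding is_groupoid_def composable_def by (auto simp: subset_iff)

lemma groupoid_inv_unique:
  assumes G: "is_groupoid G" and g: "g \<in> arrows G" and h: "h \<in> arrows G" and gh: "src G g = rng G h"
    and eq: "gmult G g h = rng G g"
  shows "ginv G g = h"
proof -
  have "h = gmult G (rng G h) h" by (simp add: groupoid_rng_left[OF G h])
  also have "\<dots> = gmult G (gmult G (ginv G g) g) h" by (simp add: groupoid_left_inv[OF G g] gh)
  also have "\<dots> = gmult G (ginv G g) (gmult G g h)"
    by (rule groupoid_assoc[OF G groupoid_inv[OF G g] g h groupoid_src_inv[OF G g] gh])
  also have "\<dots> = ginv G g"
    using groupoid_src_right[OF G groupoid_inv[OF G g]] by (simp add: eq groupoid_src_inv[OF G g])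
  finally show ?thesis by simp
qed

text \<open>This recovers units from the multiplication alone: a homomorphism is only required to preserve products, and
  it preserves units, range, source and inverses because idempotents are units.\<close>

lemma groupoid_idempotent_unit:
  assumes G: "is_groupoid G" and g: "g \<in> arrows G" and sr: "src G g = rng G g" and gg: "gmult G g g = g"
  shows "g \<in> units G"
proof -
  have "src G g = gmult G (ginv G g) (gmult G g g)" by (simp add: gg groupoid_left_inv[OF G g])
  also have "\<dots> = gmult G (gmult G (ginv G g) g) g"
    by (rule groupoid_assoc[OF G groupoid_inv[OF G g] g g groupoid_src_inv[OF G g] sr, symmetric])
  also have "\<dots> = g" by (simp add: groupoid_left_inv[OF G g] sr groupoid_rng_left[OF G g])
  finally show ?thesis using groupoid_src[OF G g] by simp
qed

lemma groupoid_hom_facts: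
  assumes G: "is_groupoid G" and H: "is_groupoid H" and f: "groupoid_hom G H f"
  shows hom_arrow: "g \<in> arrows G \<Longrightarrow> f g \<in> arrows H"
    and hom_mult: "g \<in> arrows G \<Longrightarrow> h \<in> arrows G \<Longrightarrow> src G g = rng G h \<Longrightarrow> f (gmult G g h) = gmult H (f g) (f h)"
    and hom_composable: "g \<in> arrows G \<Longrightarrow> h \<in> arrows G \<Longrightarrow> src G g = rng G h \<Longrightarrow> src H (f g) = rng H (f h)"
    and hom_unit: "u \<in> units G \<Longrightarrow> f u \<in> units H"
    and hom_rng: "g \<in> arrows G \<Longrightarrow> f (rng G g) = rng H (f g)"
    and hom_src: "g \<in> arrows G \<Longrightarrow> f (src G g) = src H (f g)"
    and hom_inv: "g \<in> arrows G \<Longrightarrow> f (ginv G g) = ginv H (f g)"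
proof -
  show a: "f g \<in> arrows H" if "g \<in> arrows G" for g using that f by (auto simp: groupoid_hom_def)
  show m: "f (gmult G g h) = gmult H (f g) (f h)" if "g \<in> arrows G" "h \<in> arrows G" "src G g = rng G h" for g h
    using that f by (auto simp: groupoid_hom_def composable_def)
  show c: "src H (f g) = rng H (f h)" if "g \<in> arrows G" "h \<in> arrows G" "src G g = rng G h" for g h
    using that f by (auto simp: groupoid_hom_def composable_def)
  show u: "f u \<in> units H" if "u \<in> units G" for u
  proof (rule groupoid_idempotent_unit[OF H])
    note u = groupoid_unit_arrow[OF G that] groupoid_rng_unit[OF G that] groupoid_src_unit[OF G that]
    show "f u \<in> arrows H" using u a by simp
    show "src H (f u) = rng H (f u)" using u by (intro c) simp_all
    show "gmult H (f u) (f u) = f u" using m[of u u] u groupoid_rng_left[OF G u(1)] by simp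
  qed
  show r: "f (rng G g) = rng H (f g)" if g: "g \<in> arrows G" for g
    using c[OF groupoid_unit_arrow[OF G groupoid_rng[OF G g]] g] groupoid_src_unit[OF G groupoid_rng[OF G g]]
      groupoid_src_unit[OF H u[OF groupoid_rng[OF G g]]] by simp
  show "f (src G g) = src H (f g)" if g: "g \<in> arrows G" for g
    using c[OF g groupoid_unit_arrow[OF G groupoid_src[OF G g]]] groupoid_rng_unit[OF G groupoid_src[OF G g]]
      groupoid_rng_unit[OF H u[OF groupoid_src[OF G g]]] by simp
  show "f (ginv G g) = ginv H (f g)" if g: "g \<in> arrows G" for g
  proof (rule groupoid_inv_unique[OF H a[OF g] a[OF groupoid_inv[OF G g]], symmetric])
    show "src H (f g) = rng H (f (ginv G g))" by (rule c[OF g groupoid_inv[OF G g] groupoid_rng_inv[OF G g, symmetric]])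
    show "gmult H (f g) (f (ginv G g)) = rng H (f g)"
      using m[OF g groupoid_inv[OF G g] groupoid_rng_inv[OF G g, symmetric]] groupoid_right_inv[OF G g] r[OF g] by simp
  qed
qed

locale twist =
  fixes G :: "'g groupoid" and E :: "'e groupoid" and \<iota> :: "complex \<times> 'g \<Rightarrow> 'e" and \<pi> :: "'e \<Rightarrow> 'g"
  assumes twist: "topological_twist G E \<iota> \<pi>"
begin

lemma groupoid_G: "is_groupoid G" and groupoid_E: "is_groupoid E" and hom_\<pi>: "groupoid_hom E G \<pi>"
  and continuous_\<pi>: "continuous_map (gtop E) (gtop G) \<pi>"
  using twist by (auto simp: topological_twist_def topological_groupoid_def)

lemmas \<pi>_arrow = hom_arrow[OF groupoid_E groupoid_G hom_\<pi>]
  and \<pi>_mult = hom_mult[OF groupoid_E groupoid_G hom_\<pi>]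
  and \<pi>_unit = hom_unit[OF groupoid_E groupoid_G hom_\<pi>]
  and \<pi>_rng = hom_rng[OF groupoid_E groupoid_G hom_\<pi>]
  and \<pi>_src = hom_src[OF groupoid_E groupoid_G hom_\<pi>]
  and \<pi>_inv = hom_inv[OF groupoid_E groupoid_G hom_\<pi>]

lemma units_subset: "units G \<subseteq> arrows G" using groupoid_G by (simp add: is_groupoid_def)

lemma \<iota>_homeomorphic: "homeomorphic_map (prod_topology (top_of_set circle) (unit_top G)) (subtopology (gtop E) (\<pi> -` units G)) \<iota>"
  using twist by (simp add: topological_twist_def circle_bundle_def)

lemma \<iota>_bij: "bij_betw \<iota> (circle \<times> units G) {e \<in> arrows E. \<pi> e \<in> units G}"
  unfolding bij_betw_def
proof
  have top: "topspace (prod_topology (top_of_set circle) (unit_top G)) = circle \<times> units G"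
    using units_subset by auto
  show "inj_on \<iota> (circle \<times> units G)"
    using homeomorphic_imp_injective_map[OF \<iota>_homeomorphic] by (simp only: top)
  show "\<iota> ` (circle \<times> units G) = {e \<in> arrows E. \<pi> e \<in> units G}"
    using homeomorphic_imp_surjective_map[OF \<iota>_homeomorphic] unfolding top by auto
qed

lemma \<iota>_arrow: "z \<in> circle \<Longrightarrow> x \<in> units G \<Longrightarrow> \<iota> (z, x) \<in> arrows E"
  and \<iota>_over_unit: "z \<in> circle \<Longrightarrow> x \<in> units G \<Longrightarrow> \<pi> (\<iota> (z, x)) \<in> units G"
  using bij_betwE[OF \<iota>_bij] by auto

lemma \<iota>_composable:
  assumes "z \<in> circle" "w \<in> circle" "x \<in> units G"
  shows "src E (\<iota> (z, x)) = rng E (\<iota> (w, x))" and "gmult E (\<iota> (z, x)) (\<iota> (w, x)) = \<iota> (z * w, x)"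
proof -
  have "x \<in> arrows G" using assms units_subset by blast
  then have "((z, x), (w, x)) \<in> composable (circle_bundle G)"
    using assms by (auto simp: composable_def circle_bundle_def)
  moreover have "gmult (circle_bundle G) (z, x) (w, x) = (z * w, x)" by (simp add: circle_bundle_def)
  moreover have "groupoid_hom (circle_bundle G) E \<iota>" using twist by (simp add: topological_twist_def)
  ultimately show "src E (\<iota> (z, x)) = rng E (\<iota> (w, x))" "gmult E (\<iota> (z, x)) (\<iota> (w, x)) = \<iota> (z * w, x)"
    unfolding groupoid_hom_def composable_def by fastforce+
qed

lemma \<iota>_one_unit: "x \<in> units G \<Longrightarrow> \<iota> (1, x) \<in> units E"
  using groupoid_idempotent_unit[OF groupoid_E \<iota>_arrow[of 1 x]] \<iota>_composable[of 1 1 x] by simp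

lemma \<iota>_rng: "z \<in> circle \<Longrightarrow> x \<in> units G \<Longrightarrow> rng E (\<iota> (z, x)) = \<iota> (1, x)"
  and \<iota>_src: "z \<in> circle \<Longrightarrow> x \<in> units G \<Longrightarrow> src E (\<iota> (z, x)) = \<iota> (1, x)"
  using \<iota>_composable(1)[of 1 z x] \<iota>_composable(1)[of z 1 x] groupoid_src_unit[OF groupoid_E \<iota>_one_unit[of x]]
    groupoid_rng_unit[OF groupoid_E \<iota>_one_unit[of x]] by auto

lemma \<iota>_one_\<pi>: "y \<in> units E \<Longrightarrow> \<iota> (1, \<pi> y) = y"
  using twist by (simp add: topological_twist_def)

lemma \<pi>_\<iota>_one: assumes x: "x \<in> units G" shows "\<pi> (\<iota> (1, x)) = x"
proof -
  have "\<iota> (1, \<pi> (\<iota> (1, x))) = \<iota> (1, x)" by (rule \<iota>_one_\<pi>[OF \<iota>_one_unit[OF x]])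
  then have "(1::complex, \<pi> (\<iota> (1, x))) = (1, x)"
    using x \<iota>_over_unit[of 1 x] by (intro inj_onD[OF bij_betw_imp_inj_on[OF \<iota>_bij]]) auto
  then show ?thesis by simp
qed

text \<open>The element lies over some unit, which is then its own range; the range of \<open>\<iota> (z, x)\<close> is \<open>\<iota> (1, x)\<close>.\<close>

lemma \<pi>_\<iota>:
  assumes z: "z \<in> circle" and x: "x \<in> units G"
  shows "\<pi> (\<iota> (z, x)) = x"
proof -
  have "\<pi> (\<iota> (z, x)) = rng G (\<pi> (\<iota> (z, x)))"
    using groupoid_rng_unit[OF groupoid_G \<iota>_over_unit[OF z x]] by simp
  also have "\<dots> = \<pi> (\<iota> (1, x))" using \<pi>_rng[OF \<iota>_arrow[OF z x]] \<iota>_rng[OF z x] by simp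
  finally show ?thesis using \<pi>_\<iota>_one[OF x] by simp
qed

lemma rng_E: "e \<in> arrows E \<Longrightarrow> rng E e = \<iota> (1, rng G (\<pi> e))"
  and src_E: "e \<in> arrows E \<Longrightarrow> src E e = \<iota> (1, src G (\<pi> e))"
  using \<iota>_one_\<pi>[OF groupoid_rng[OF groupoid_E]] \<pi>_rng \<iota>_one_\<pi>[OF groupoid_src[OF groupoid_E]] \<pi>_src by metis+

text \<open>Units of \<open>E\<close> are determined by their images in \<open>G\<close>.\<close>

lemma composable_E_iff:
  assumes "e \<in> arrows E" "f \<in> arrows E"
  shows "src E e = rng E f \<longleftrightarrow> src G (\<pi> e) = rng G (\<pi> f)"
  using rng_E src_E \<pi>_src \<pi>_rng assms by metis

lemma composable_E: "composable E = {p. fst p \<in> arrows E \<and> snd p \<in> arrows E \<and> (\<pi> (fst p), \<pi> (snd p)) \<in> composable G}"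
  using composable_E_iff \<pi>_arrow by (auto simp: composable_def)

definition act :: "complex \<Rightarrow> 'e \<Rightarrow> 'e" where "act = twist_action E \<iota> \<pi>"

lemma rng_\<pi>: "e \<in> arrows E \<Longrightarrow> rng G (\<pi> e) \<in> units G"
  using groupoid_rng[OF groupoid_G \<pi>_arrow] .

lemma act_eq: "e \<in> arrows E \<Longrightarrow> act z e = gmult E (\<iota> (z, rng G (\<pi> e))) e"
  by (simp add: act_def twist_action_def \<pi>_rng)

lemma act_composable: "z \<in> circle \<Longrightarrow> e \<in> arrows E \<Longrightarrow> src E (\<iota> (z, rng G (\<pi> e))) = rng E e"
  using \<iota>_src rng_E rng_\<pi> by simp

lemma act_arrow: "z \<in> circle \<Longrightarrow> e \<in> arrows E \<Longrightarrow> act z e \<in> arrows E"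
  and act_rng: "z \<in> circle \<Longrightarrow> e \<in> arrows E \<Longrightarrow> rng E (act z e) = rng E e"
  and act_src: "z \<in> circle \<Longrightarrow> e \<in> arrows E \<Longrightarrow> src E (act z e) = src E e"
  using groupoid_mult[OF groupoid_E \<iota>_arrow _ act_composable] groupoid_rng_mult[OF groupoid_E \<iota>_arrow _ act_composable]
    groupoid_src_mult[OF groupoid_E \<iota>_arrow _ act_composable] rng_\<pi> \<iota>_rng rng_E
  by (simp_all add: act_eq)

lemma \<pi>_act:
  assumes "z \<in> circle" "e \<in> arrows E"
  shows "\<pi> (act z e) = \<pi> e"
proof -
  note i = \<iota>_arrow[OF assms(1) rng_\<pi>[OF assms(2)]]
  show ?thesis
    using \<pi>_mult[OF i assms(2) act_composable[OF assms]] \<pi>_\<iota>[OF assms(1) rng_\<pi>[OF assms(2)]]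
      groupoid_rng_left[OF groupoid_G \<pi>_arrow[OF assms(2)]] by (simp add: act_eq assms)
qed

lemma act_one: "e \<in> arrows E \<Longrightarrow> act 1 e = e"
  using groupoid_rng_left[OF groupoid_E] rng_E by (simp add: act_eq)

lemma act_act:
  assumes z: "z \<in> circle" and w: "w \<in> circle" and e: "e \<in> arrows E"
  shows "act z (act w e) = act (z * w) e"
proof -
  let ?x = "rng G (\<pi> e)"
  note x = rng_\<pi>[OF e]
  have "act z (act w e) = gmult E (\<iota> (z, ?x)) (gmult E (\<iota> (w, ?x)) e)"
    using act_eq[OF act_arrow[OF w e]] \<pi>_act[OF w e] act_eq[OF e] by simp
  also have "\<dots> = gmult E (gmult E (\<iota> (z, ?x)) (\<iota> (w, ?x))) e"
    by (rule groupoid_assoc[OF groupoid_E \<iota>_arrow[OF z x] \<iota>_arrow[OF w x] e \<iota>_composable(1)[OF z w x] act_composable[OF w e], symmetric])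
  also have "\<dots> = act (z * w) e" using \<iota>_composable(2)[OF z w x] act_eq[OF e] by simp
  finally show ?thesis .
qed

lemma act_mult_left:
  assumes z: "z \<in> circle" and e: "e \<in> arrows E" and f: "f \<in> arrows E" and ef: "src E e = rng E f"
  shows "gmult E (act z e) f = act z (gmult E e f)"
proof -
  note m = groupoid_mult[OF groupoid_E e f ef]
  have "rng G (\<pi> (gmult E e f)) = rng G (\<pi> e)"
    using \<pi>_rng[OF m] \<pi>_rng[OF e] groupoid_rng_mult[OF groupoid_E e f ef] by simp
  then show ?thesis
    using groupoid_assoc[OF groupoid_E \<iota>_arrow[OF z rng_\<pi>[OF e]] e f act_composable[OF z e] ef]
    by (simp add: act_eq e m)
qed

lemma act_right:
  assumes z: "z \<in> circle" and e: "e \<in> arrows E"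
  shows "act z e = gmult E e (\<iota> (z, src G (\<pi> e)))"
  using twist z e \<pi>_rng[OF e] \<pi>_src[OF e] unfolding topological_twist_def act_def twist_action_def by metis

text \<open>Centrality of the circle moves the factor past \<open>e\<close>.\<close>

lemma act_mult_right:
  assumes z: "z \<in> circle" and e: "e \<in> arrows E" and f: "f \<in> arrows E" and ef: "src E e = rng E f"
  shows "gmult E e (act z f) = act z (gmult E e f)"
proof -
  note i = \<iota>_arrow[OF z rng_\<pi>[OF f]]
  have s: "src G (\<pi> e) = rng G (\<pi> f)" using composable_E_iff[OF e f] ef by simp
  have "gmult E e (act z f) = gmult E (gmult E e (\<iota> (z, rng G (\<pi> f)))) f"
    unfolding act_eq[OF f]
    by (rule groupoid_assoc[OF groupoid_E e i f _ act_composable[OF z f], symmetric])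
      (use \<iota>_rng[OF z rng_\<pi>[OF f]] rng_E[OF f] ef in simp)
  also have "\<dots> = gmult E (act z e) f" using act_right[OF z e] s by simp
  finally show ?thesis using act_mult_left[OF z e f ef] by simp
qed

lemma act_inv:
  assumes z: "z \<in> circle" and e: "e \<in> arrows E"
  shows "ginv E (act z e) = act (inverse z) (ginv E e)"
proof -
  have z': "inverse z \<in> circle" "z \<noteq> 0" using z by (auto simp: norm_inverse)
  note ie = groupoid_inv[OF groupoid_E e]
  note c = groupoid_rng_inv[OF groupoid_E e, symmetric]
  show ?thesis
  proof (rule groupoid_inv_unique[OF groupoid_E act_arrow[OF z e] act_arrow[OF z'(1) ie]])
    show "src E (act z e) = rng E (act (inverse z) (ginv E e))" using act_src[OF z e] act_rng[OF z'(1) ie] c by simp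
    have "gmult E (act z e) (act (inverse z) (ginv E e)) = act z (gmult E e (act (inverse z) (ginv E e)))"
      using act_rng[OF z'(1) ie] c by (intro act_mult_left[OF z e act_arrow[OF z'(1) ie]]) simp
    also have "\<dots> = act z (act (inverse z) (rng E e))"
      using act_mult_right[OF z'(1) e ie c] groupoid_right_inv[OF groupoid_E e] by simp
    also have "\<dots> = rng E e"
      using act_act[OF z z'(1)] act_one z'(2) groupoid_unit_arrow[OF groupoid_E groupoid_rng[OF groupoid_E e]] by simp
    finally show "gmult E (act z e) (act (inverse z) (ginv E e)) = rng E (act z e)" using act_rng[OF z e] by simp
  qed
qed

text \<open>The element of the circle that moves \<open>f\<close> to \<open>e\<close>.\<close>

definition quotient :: "'e \<Rightarrow> 'e \<Rightarrow> complex" where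
  "quotient e f = fst (twist_coord G \<iota> (gmult E e (ginv E f)))"

text \<open>If \<open>e\<close> and \<open>f\<close> lie over the same point, \<open>e f\<^sup>-\<^sup>1\<close> lies over a unit, hence in the image of \<open>\<iota>\<close>, and its circle
  component moves \<open>f\<close> to \<open>e\<close>.\<close>

lemma quotient:
  assumes e: "e \<in> arrows E" and f: "f \<in> arrows E" and ef: "\<pi> e = \<pi> f"
  shows quotient_circle: "quotient e f \<in> circle" and act_quotient: "act (quotient e f) f = e"
proof -
  note f' = groupoid_inv[OF groupoid_E f]
  have s: "src E e = src E f" using src_E e f ef by simp
  have c: "src E e = rng E (ginv E f)" using s groupoid_rng_inv[OF groupoid_E f] by simp
  let ?g = "gmult E e (ginv E f)"
  have g: "?g \<in> arrows E" by (rule groupoid_mult[OF groupoid_E e f' c])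
  have "\<pi> ?g = rng G (\<pi> f)"
    using \<pi>_mult[OF e f' c] \<pi>_inv[OF f] groupoid_right_inv[OF groupoid_G \<pi>_arrow[OF f]] ef by simp
  then have g': "?g \<in> {e \<in> arrows E. \<pi> e \<in> units G}" using g rng_\<pi>[OF f] by simp
  obtain z x where zx: "twist_coord G \<iota> ?g = (z, x)" by (cases "twist_coord G \<iota> ?g")
  have "(z, x) \<in> circle \<times> units G" "\<iota> (z, x) = ?g"
    using g' zx[symmetric] bij_betw_imp_surj_on[OF \<iota>_bij] unfolding twist_coord_def
    by (auto simp: inv_into_into f_inv_into_f simp del: mem_Collect_eq mem_Times_iff mem_Sigma_iff)
  then have z: "z \<in> circle" "x \<in> units G" "\<iota> (z, x) = ?g" by auto
  have x: "x = rng G (\<pi> f)" using \<pi>_\<iota>[OF z(1,2)] z(3) \<open>\<pi> ?g = rng G (\<pi> f)\<close> by simp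
  have q: "quotient e f = z" by (simp add: quotient_def zx)
  show "quotient e f \<in> circle" using q z by simp
  have "act z f = gmult E ?g f" using act_eq[OF f] z(3) x by simp
  also have "\<dots> = gmult E e (gmult E (ginv E f) f)"
    by (rule groupoid_assoc[OF groupoid_E e f' f c groupoid_src_inv[OF groupoid_E f]])
  also have "\<dots> = e" using groupoid_left_inv[OF groupoid_E f] groupoid_src_right[OF groupoid_E e] s by simp
  finally show "act (quotient e f) f = e" using q by simp
qed

lemma act_free:
  assumes z: "z \<in> circle" and w: "w \<in> circle" and e: "e \<in> arrows E" and eq: "act z e = act w e"
  shows "z = w"
proof -
  let ?x = "rng G (\<pi> e)"
  note x = rng_\<pi>[OF e] and e' = groupoid_inv[OF groupoid_E e] and c = groupoid_rng_inv[OF groupoid_E e, symmetric]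
  have *: "gmult E (act t e) (ginv E e) = \<iota> (t, ?x)" if t: "t \<in> circle" for t
  proof -
    have "gmult E (act t e) (ginv E e) = act t (rng E e)"
      using act_mult_left[OF t e e' c] groupoid_right_inv[OF groupoid_E e] by simp
    also have "\<dots> = gmult E (\<iota> (t, ?x)) (\<iota> (1, ?x))"
      using act_eq[OF \<iota>_arrow[of 1 ?x]] rng_E[OF e] x \<pi>_\<iota>_one[OF x] groupoid_rng_unit[OF groupoid_G x] by simp
    also have "\<dots> = \<iota> (t, ?x)" using \<iota>_composable(2)[OF t _ x, of 1] by simp
    finally show ?thesis .
  qed
  have "\<iota> (z, ?x) = \<iota> (w, ?x)" using *[OF z] *[OF w] eq by simp
  then have "(z, ?x) = (w, ?x)" using z w x by (intro inj_onD[OF bij_betw_imp_inj_on[OF \<iota>_bij]]) auto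
  then show ?thesis by simp
qed

lemma \<iota>_eq_act: "z \<in> circle \<Longrightarrow> x \<in> units G \<Longrightarrow> \<iota> (z, x) = act z (\<iota> (1, x))"
  using act_eq[OF \<iota>_arrow[of 1 x], of z] \<pi>_\<iota>_one[of x] groupoid_rng_unit[OF groupoid_G, of x] \<iota>_composable(2)[of z 1 x]
  by simp

end

section \<open>Smoothness of the structure maps of the twist\<close>

lemma smooth_map_compose_open:
  assumes P: "smooth_structure P" and M: "smooth_structure M" and N: "smooth_structure N" and W: "openin (mtop M) W"
    and f: "smooth_map P M f" and fW: "\<And>p. p \<in> topspace (mtop P) \<Longrightarrow> f p \<in> W"
    and g: "smooth_map (open_submanifold M W) N g"
  shows "smooth_map P N (\<lambda>p. g (f p))"
  by (rule smooth_map_compose[OF P smooth_structure_open_submanifold[OF M W] N smooth_map_corestrict[OF f fW] g])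

lemma slice_chart_restrict:
  assumes M: "smooth_structure M" and c: "(U, \<phi>) \<in> slice_charts M k S" and W: "openin (mtop M) W"
  shows "(U \<inter> W, \<phi>) \<in> slice_charts M k S"
proof -
  have cM: "(U, \<phi>) \<in> charts M" and eq: "\<phi> ` (U \<inter> S) = \<phi> ` U \<inter> coord_space k" using c by (auto simp: slice_charts_def)
  have inj: "inj_on \<phi> U" by (rule chart_inj[OF structure_chart[OF M cM]])
  have "\<phi> ` (U \<inter> W \<inter> S) = \<phi> ` (U \<inter> W) \<inter> coord_space k"
  proof (intro equalityI subsetI)
    fix z assume z: "z \<in> \<phi> ` (U \<inter> W) \<inter> coord_space k"
    then obtain x where x: "x \<in> U \<inter> W" "z = \<phi> x" by blast
    then have "z \<in> \<phi> ` (U \<inter> S)" using z eq by blast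
    then obtain y where "y \<in> U \<inter> S" "z = \<phi> y" by blast
    then have "x = y" using x inj_onD[OF inj] by blast
    then show "z \<in> \<phi> ` (U \<inter> W \<inter> S)" using x \<open>y \<in> U \<inter> S\<close> by blast
  qed (use eq in blast)
  then show ?thesis using structure_restrict[OF M cM W] by (simp add: slice_charts_def)
qed

text \<open>Two new coordinates are inserted directly after the first \<open>k\<close>, so that the slice \<open>\<real>\<^sup>k\<close> in \<open>\<real>\<^sup>n\<close> corresponds to the slice
  \<open>\<real>\<^sup>k\<^sup>+\<^sup>2\<close> in \<open>\<real>\<^sup>n\<^sup>+\<^sup>2\<close>.\<close>

definition insert_coords :: "nat \<Rightarrow> real \<Rightarrow> real \<Rightarrow> (nat \<Rightarrow> real) \<Rightarrow> nat \<Rightarrow> real" where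
  "insert_coords k s t z = (\<lambda>i. if i < k then z i else if i = k then s else if i = Suc k then t else z (i - 2))"

definition remove_coords :: "nat \<Rightarrow> (nat \<Rightarrow> real) \<Rightarrow> nat \<Rightarrow> real" where
  "remove_coords k z = (\<lambda>i. if i < k then z i else z (i + 2))"

lemma insert_coords_simps [simp]:
  "insert_coords k s t z k = s" "insert_coords k s t z (Suc k) = t" "remove_coords k (insert_coords k s t z) = z"
  by (auto simp: insert_coords_def remove_coords_def fun_eq_iff)

lemma insert_remove_coords: "insert_coords k (z k) (z (Suc k)) (remove_coords k z) = z"
proof
  fix i
  show "insert_coords k (z k) (z (Suc k)) (remove_coords k z) i = z i"
  proof (cases "k + 2 \<le> i")
    case True
    then obtain j where "i = j + 2" "k \<le> j" by (metis add_le_cancel_right le_add_diff_inverse2 le_add2 order_trans)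
    then show ?thesis by (simp add: insert_coords_def remove_coords_def)
  next
    case False
    then consider "i < k" | "i = k" | "i = Suc k" by linarith
    then show ?thesis by cases (simp_all add: insert_coords_def remove_coords_def)
  qed
qed

lemma remove_coords_in: "k \<le> n \<Longrightarrow> z \<in> coord_space (n + 2) \<Longrightarrow> remove_coords k z \<in> coord_space n"
  by (auto simp: remove_coords_def coord_space_iff)

lemma insert_coords_in: "k \<le> n \<Longrightarrow> z \<in> coord_space n \<Longrightarrow> insert_coords k s t z \<in> coord_space (n + 2)"
  by (auto simp: insert_coords_def coord_space_iff)

lemma insert_coords_in_slice: "insert_coords k s t z \<in> coord_space (k + 2) \<longleftrightarrow> z \<in> coord_space k"
proof
  assume z: "insert_coords k s t z \<in> coord_space (k + 2)"
  have "z i = 0" if "k \<le> i" for i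
  proof -
    have "insert_coords k s t z (i + 2) = 0" using z that by (simp add: coord_space_iff)
    then show ?thesis using that by (simp add: insert_coords_def)
  qed
  then show "z \<in> coord_space k" by (simp add: coord_space_iff)
qed (rule insert_coords_in, simp_all)

lemma smooth_fun_remove_coords: "smooth_fun (euclidean_manifold n) (\<lambda>z. remove_coords k z j)"
  by (cases "j < k") (simp_all add: remove_coords_def smooth_fun_euclidean_coordinate)

locale smooth_twist = twist G E \<iota> \<pi>
  for G :: "'g groupoid" and E :: "'e groupoid" and \<iota> :: "complex \<times> 'g \<Rightarrow> 'e" and \<pi> :: "'e \<Rightarrow> 'g" +
  fixes M M0 :: "'g manifold" and N :: "'e manifold" and A :: "'i set" and U :: "'i \<Rightarrow> 'g set" and \<sigma> :: "'i \<Rightarrow> 'g \<Rightarrow> 'e"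
  assumes lie: "lie_groupoid G M M0"
    and U_open: "\<And>\<alpha>. \<alpha> \<in> A \<Longrightarrow> openin (mtop M) (U \<alpha>)"
    and U_cover: "(\<Union>\<alpha>\<in>A. U \<alpha>) = topspace (mtop M)"
    and \<pi>_section: "\<And>\<alpha> \<gamma>. \<alpha> \<in> A \<Longrightarrow> \<gamma> \<in> U \<alpha> \<Longrightarrow> \<pi> (\<sigma> \<alpha> \<gamma>) = \<gamma>"
    and unit_smooth: "U_smooth G M0 \<iota> A U \<sigma>"
    and mult_smooth: "M_smooth G M M0 E \<iota> A U \<sigma>"
    and top_N: "mtop N = gtop E"
    and principal_bundle: "smooth_principal_circle_bundle N M (twist_action E \<iota> \<pi>) \<pi>"
    and section_smooth: "\<And>\<alpha>. \<alpha> \<in> A \<Longrightarrow> smooth_map (open_submanifold M (U \<alpha>)) N (\<sigma> \<alpha>)"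
begin

lemma top_M: "mtop M = gtop G" and top_M0: "mtop M0 = unit_top G"
  using lie by (auto simp: lie_groupoid_def)

lemma structure_M: "smooth_structure M" and structure_M0: "smooth_structure M0" and structure_N: "smooth_structure N"
  using lie principal_bundle smooth_manifold_structure by (auto simp: lie_groupoid_def smooth_principal_circle_bundle_def)

lemma topspace_M0: "topspace (mtop M0) = units G"
  using units_subset by (auto simp: top_M0)

lemma smooth_\<pi>: "smooth_map N M \<pi>"
  using principal_bundle by (simp add: smooth_principal_circle_bundle_def)

lemma smooth_unit_inclusion: "smooth_map M0 M (\<lambda>x. x)"
  using lie by (simp add: lie_groupoid_def smooth_embedding_def immersion_def)

lemma smooth_rng: "smooth_map M M0 (rng G)"
  using lie by (simp add: lie_groupoid_def submersion_def)

lemma U_subset: "\<alpha> \<in> A \<Longrightarrow> U \<alpha> \<subseteq> arrows G"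
  using U_cover top_M by auto

lemma U_coverE: assumes "\<gamma> \<in> arrows G" obtains \<alpha> where "\<alpha> \<in> A" "\<gamma> \<in> U \<alpha>"
  using assms U_cover top_M by auto

lemma section_arrow: "\<alpha> \<in> A \<Longrightarrow> \<gamma> \<in> U \<alpha> \<Longrightarrow> \<sigma> \<alpha> \<gamma> \<in> arrows E"
  using smooth_map_in_topspace[OF section_smooth] U_subset top_M top_N by fastforce

definition over :: "'g set \<Rightarrow> 'e set" where "over V = arrows E \<inter> \<pi> -` V"

lemma over_iff [simp]: "e \<in> over V \<longleftrightarrow> e \<in> arrows E \<and> \<pi> e \<in> V"
  by (simp add: over_def)

lemma over_open: "openin (mtop M) V \<Longrightarrow> openin (mtop N) (over V)"
  using smooth_map_preimage_open[OF smooth_\<pi>] by (simp add: over_def top_N)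

lemma smooth_act:
  assumes P: "smooth_structure P" and z: "smooth_map P circle_manifold z" and s: "smooth_map P N s"
  shows "smooth_map P N (\<lambda>p. act (z p) (s p))"
proof -
  have "smooth_map (prod_manifold circle_manifold N) N (\<lambda>(z, e). act z e)"
    using principal_bundle by (simp add: smooth_principal_circle_bundle_def act_def)
  from smooth_map_compose[OF P smooth_structure_prod[OF smooth_structure_circle structure_N] structure_N
      smooth_map_pair[OF P smooth_structure_circle structure_N z s] this]
  show ?thesis by simp
qed

lemma local_trivialisation:
  assumes "x \<in> topspace (mtop M)"
  obtains V h h' where "openin (mtop M) V" "x \<in> V"
    "smooth_map (open_submanifold N (over V)) (prod_manifold circle_manifold (open_submanifold M V)) h"
    "smooth_map (prod_manifold circle_manifold (open_submanifold M V)) (open_submanifold N (over V)) h'"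
    "\<And>e. e \<in> over V \<Longrightarrow> h' (h e) = e" "\<And>y. y \<in> circle \<times> V \<Longrightarrow> h (h' y) = y"
    "\<And>e. e \<in> over V \<Longrightarrow> fst (h e) \<in> circle"
    "\<And>e z. e \<in> over V \<Longrightarrow> z \<in> circle \<Longrightarrow> h (act z e) = (z * fst (h e), \<pi> e)"
proof -
  from principal_bundle assms obtain V h where V: "openin (mtop M) V" "x \<in> V"
    "diffeomorphism (open_submanifold N (over V)) (prod_manifold circle_manifold (open_submanifold M V)) h"
    "\<forall>e\<in>over V. snd (h e) = \<pi> e \<and> (\<forall>z\<in>circle. h (act z e) = (z * fst (h e), \<pi> e))"
    unfolding smooth_principal_circle_bundle_def act_def[symmetric] over_def top_N by blast
  have topV: "topspace (mtop M) \<inter> V = V" using openin_subset[OF V(1)] by blast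
  have topO: "topspace (mtop (open_submanifold N (over V))) = over V" by (auto simp: top_N)
  from V(3) obtain h' where h: "smooth_map (open_submanifold N (over V)) (prod_manifold circle_manifold (open_submanifold M V)) h"
    "smooth_map (prod_manifold circle_manifold (open_submanifold M V)) (open_submanifold N (over V)) h'"
    "\<forall>e\<in>over V. h' (h e) = e" "\<forall>y\<in>circle \<times> V. h (h' y) = y"
    unfolding diffeomorphism_def topO by (auto simp: topV)
  have "fst (h e) \<in> circle" if "e \<in> over V" for e
    using smooth_map_in_topspace[OF h(1), of e] that unfolding topO by (auto simp: mem_Times_iff)
  then show ?thesis using that[of V h h'] V h by blast
qed

definition phase :: "'i \<Rightarrow> 'e \<Rightarrow> complex" where "phase \<alpha> e = quotient e (\<sigma> \<alpha> (\<pi> e))"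

lemma phase_circle: "\<alpha> \<in> A \<Longrightarrow> e \<in> arrows E \<Longrightarrow> \<pi> e \<in> U \<alpha> \<Longrightarrow> phase \<alpha> e \<in> circle"
  and act_phase: "\<alpha> \<in> A \<Longrightarrow> e \<in> arrows E \<Longrightarrow> \<pi> e \<in> U \<alpha> \<Longrightarrow> act (phase \<alpha> e) (\<sigma> \<alpha> (\<pi> e)) = e"
  unfolding phase_def using quotient_circle act_quotient section_arrow \<pi>_section by simp_all

text \<open>The action of the circle is free.\<close>

lemma phase_act:
  assumes "\<alpha> \<in> A" "\<gamma> \<in> U \<alpha>" "z \<in> circle"
  shows "phase \<alpha> (act z (\<sigma> \<alpha> \<gamma>)) = z"
proof -
  note s = section_arrow[OF assms(1,2)]
  have p: "\<pi> (act z (\<sigma> \<alpha> \<gamma>)) = \<gamma>" using \<pi>_act[OF assms(3) s] \<pi>_section[OF assms(1,2)] by simp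
  note a = act_arrow[OF assms(3) s]
  show ?thesis
    using act_free[OF phase_circle[OF assms(1) a] assms(3) s] act_phase[OF assms(1) a] p assms(2) by simp
qed

lemma smooth_section_over:
  assumes "\<alpha> \<in> A"
  shows "smooth_map (open_submanifold N (over (U \<alpha>))) N (\<lambda>e. \<sigma> \<alpha> (\<pi> e))"
  by (rule smooth_map_compose_open[OF smooth_structure_open_submanifold[OF structure_N over_open[OF U_open[OF assms]]]
        structure_M structure_N U_open[OF assms] smooth_map_restrict[OF smooth_\<pi>] _ section_smooth[OF assms]]) simp

text \<open>A trivialisation \<open>h\<close> is equivariant, so \<open>e = z \<cdot> \<sigma> \<alpha> (\<pi> e)\<close> gives \<open>fst (h e) = z * fst (h (\<sigma> \<alpha> (\<pi> e)))\<close>; both circle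
  components depend smoothly on \<open>e\<close>.\<close>

lemma smooth_phase:
  assumes \<alpha>: "\<alpha> \<in> A"
  shows "smooth_map (open_submanifold N (over (U \<alpha>))) circle_manifold (phase \<alpha>)"
proof (rule smooth_map_local[OF smooth_structure_open_submanifold[OF structure_N over_open[OF U_open[OF \<alpha>]]] smooth_structure_circle])
  fix e0 assume "e0 \<in> topspace (mtop (open_submanifold N (over (U \<alpha>))))"
  then have e0: "e0 \<in> arrows E" "\<pi> e0 \<in> U \<alpha>" by auto
  have "\<pi> e0 \<in> topspace (mtop M)" using \<pi>_arrow[OF e0(1)] by (simp add: top_M)
  then obtain V h h' where V: "openin (mtop M) V" "\<pi> e0 \<in> V"
    "smooth_map (open_submanifold N (over V)) (prod_manifold circle_manifold (open_submanifold M V)) h"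
    and h: "\<And>e. e \<in> over V \<Longrightarrow> fst (h e) \<in> circle"
    "\<And>e z. e \<in> over V \<Longrightarrow> z \<in> circle \<Longrightarrow> h (act z e) = (z * fst (h e), \<pi> e)"
    using local_trivialisation by metis
  note SV = smooth_structure_open_submanifold[OF structure_M V(1)]
  note SO = smooth_structure_open_submanifold[OF structure_N over_open[OF V(1)]]
  have UV: "openin (mtop M) (V \<inter> U \<alpha>)" using V(1) U_open[OF \<alpha>] by blast
  let ?W = "over (V \<inter> U \<alpha>)"
  note W = over_open[OF UV] and SW = smooth_structure_open_submanifold[OF structure_N over_open[OF UV]]
  have fh: "smooth_map (open_submanifold N (over V)) circle_manifold (\<lambda>e. fst (h e))"
    by (rule smooth_map_compose[OF SO smooth_structure_prod[OF smooth_structure_circle SV] smooth_structure_circle V(3)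
          smooth_map_fst[OF smooth_structure_circle SV]])
  have 1: "smooth_map (open_submanifold N ?W) circle_manifold (\<lambda>e. fst (h e))"
    by (rule smooth_map_restrict_mono[OF fh]) auto
  have 2: "smooth_map (open_submanifold N ?W) N (\<lambda>e. \<sigma> \<alpha> (\<pi> e))"
    by (rule smooth_map_restrict_mono[OF smooth_section_over[OF \<alpha>]]) auto
  have "smooth_map (open_submanifold N ?W) circle_manifold (\<lambda>e. fst (h (\<sigma> \<alpha> (\<pi> e))))"
    by (rule smooth_map_compose_open[OF SW structure_N smooth_structure_circle over_open[OF V(1)] 2 _ fh])
      (use section_arrow \<pi>_section \<alpha> in auto)
  from smooth_map_circle_mult[OF SW 1 smooth_map_circle_inverse[OF SW this]]
  have "smooth_map (open_submanifold N ?W) circle_manifold (phase \<alpha>)"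
  proof (rule smooth_map_cong[OF SW smooth_structure_circle, rotated])
    fix e assume "e \<in> topspace (mtop (open_submanifold N ?W))"
    then have e: "e \<in> arrows E" "\<pi> e \<in> V" "\<pi> e \<in> U \<alpha>" by auto
    note s = section_arrow[OF \<alpha> e(3)]
    have sV: "\<sigma> \<alpha> (\<pi> e) \<in> over V" using s e \<pi>_section[OF \<alpha> e(3)] by simp
    have "fst (h e) = phase \<alpha> e * fst (h (\<sigma> \<alpha> (\<pi> e)))"
      using h(2)[OF sV phase_circle[OF \<alpha> e(1,3)]] act_phase[OF \<alpha> e(1,3)] by simp
    moreover have "fst (h (\<sigma> \<alpha> (\<pi> e))) \<noteq> 0" using h(1)[OF sV] by auto
    ultimately show "fst (h e) * inverse (fst (h (\<sigma> \<alpha> (\<pi> e)))) = phase \<alpha> e" by simp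
  qed
  moreover have "open_submanifold (open_submanifold N (over (U \<alpha>))) ?W = open_submanifold N ?W"
    by (rule open_submanifold_open_submanifold) auto
  moreover have "openin (mtop (open_submanifold N (over (U \<alpha>)))) ?W"
    using W over_open[OF U_open[OF \<alpha>]] by (auto simp: openin_open_subtopology)
  ultimately show "\<exists>W. openin (mtop (open_submanifold N (over (U \<alpha>)))) W \<and> e0 \<in> W \<and>
      smooth_map (open_submanifold (open_submanifold N (over (U \<alpha>))) W) circle_manifold (phase \<alpha>)"
    using e0 V(2) by (intro exI[of _ ?W]) auto
qed

text \<open>The section \<open>\<sigma> \<alpha>\<close>, rotated by the phase of \<open>e\<close>, is a local section of \<open>\<pi>\<close> through \<open>e\<close>.\<close>

lemma submersion_\<pi>: "submersion N M \<pi>"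
proof (rule submersion_if_local_sections[OF structure_N structure_M smooth_\<pi>])
  fix e assume "e \<in> topspace (mtop N)"
  then have e: "e \<in> arrows E" by (simp add: top_N)
  obtain \<alpha> where \<alpha>: "\<alpha> \<in> A" "\<pi> e \<in> U \<alpha>" using U_coverE[OF \<pi>_arrow[OF e]] .
  note S = smooth_structure_open_submanifold[OF structure_M U_open[OF \<alpha>(1)]]
  note z = phase_circle[OF \<alpha>(1) e \<alpha>(2)]
  have "smooth_map (open_submanifold M (U \<alpha>)) N (\<lambda>\<gamma>. act (phase \<alpha> e) (\<sigma> \<alpha> \<gamma>))"
    by (rule smooth_act[OF S smooth_map_const[OF S smooth_structure_circle] section_smooth[OF \<alpha>(1)]]) (use z in simp)
  moreover have "\<pi> (act (phase \<alpha> e) (\<sigma> \<alpha> \<gamma>)) = \<gamma>" if "\<gamma> \<in> U \<alpha>" for \<gamma>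
    using \<pi>_act[OF z section_arrow[OF \<alpha>(1) that]] \<pi>_section[OF \<alpha>(1) that] by simp
  ultimately show "\<exists>W s. openin (mtop M) W \<and> \<pi> e \<in> W \<and> smooth_map (open_submanifold M W) N s \<and> s (\<pi> e) = e \<and>
      (\<forall>y\<in>W. \<pi> (s y) = y)"
    using U_open[OF \<alpha>(1)] \<alpha>(2) act_phase[OF \<alpha>(1) e \<alpha>(2)]
    by (intro exI[of _ "U \<alpha>"] exI[of _ "\<lambda>\<gamma>. act (phase \<alpha> e) (\<sigma> \<alpha> \<gamma>)"]) auto
qed

lemma unit_phase:
  assumes "\<alpha> \<in> A"
  obtains k where "smooth_map (open_submanifold M0 (U \<alpha> \<inter> units G)) circle_manifold k"
    "\<And>x. x \<in> U \<alpha> \<inter> units G \<Longrightarrow> k x \<in> circle" "\<And>x. x \<in> U \<alpha> \<inter> units G \<Longrightarrow> \<sigma> \<alpha> x = act (k x) (\<iota> (1, x))"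
proof -
  obtain k where k: "smooth_map (open_submanifold M0 (U \<alpha> \<inter> units G)) circle_manifold k"
    "\<And>x. x \<in> U \<alpha> \<inter> units G \<Longrightarrow> \<sigma> \<alpha> x = \<iota> (k x, x)"
    using unit_smooth assms unfolding U_smooth_def by blast
  have c: "k x \<in> circle" if "x \<in> U \<alpha> \<inter> units G" for x
    using smooth_map_in_topspace[OF k(1), of x] that by (simp add: topspace_M0)
  then have "\<sigma> \<alpha> x = act (k x) (\<iota> (1, x))" if "x \<in> U \<alpha> \<inter> units G" for x
    using k(2)[OF that] \<iota>_eq_act[of "k x" x] that by simp
  then show ?thesis using that k(1) c by blast
qed

lemma U_units_open:
  assumes "\<alpha> \<in> A"
  shows "openin (mtop M0) (U \<alpha> \<inter> units G)"
  unfolding top_M0 using openin_subtopology_Int[OF U_open[OF assms, unfolded top_M]] .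

text \<open>Condition (U) says that \<open>\<sigma> \<alpha>\<close> differs from the unit section by a smooth function \<open>k\<close>; acting with the inverse of
  \<open>k\<close> on \<open>\<sigma> \<alpha>\<close> gives the unit section.\<close>

lemma smooth_unit_section: "smooth_map M0 N (\<lambda>x. \<iota> (1, x))"
proof (rule smooth_map_local[OF structure_M0 structure_N])
  fix x assume "x \<in> topspace (mtop M0)"
  then have x: "x \<in> units G" by (simp add: topspace_M0)
  then obtain \<alpha> where \<alpha>: "\<alpha> \<in> A" "x \<in> U \<alpha>" using U_coverE units_subset by blast
  obtain k where k: "smooth_map (open_submanifold M0 (U \<alpha> \<inter> units G)) circle_manifold k"
    "\<And>x. x \<in> U \<alpha> \<inter> units G \<Longrightarrow> k x \<in> circle" "\<And>x. x \<in> U \<alpha> \<inter> units G \<Longrightarrow> \<sigma> \<alpha> x = act (k x) (\<iota> (1, x))"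
    using unit_phase[OF \<alpha>(1)] by blast
  let ?W = "U \<alpha> \<inter> units G"
  note W = U_units_open[OF \<alpha>(1)]
  note S = smooth_structure_open_submanifold[OF structure_M0 W]
  have s: "smooth_map (open_submanifold M0 ?W) N (\<sigma> \<alpha>)"
    by (rule smooth_map_compose_open[OF S structure_M structure_N U_open[OF \<alpha>(1)]
          smooth_map_restrict[OF smooth_unit_inclusion] _ section_smooth[OF \<alpha>(1)]]) auto
  have "smooth_map (open_submanifold M0 ?W) N (\<lambda>x. act (inverse (k x)) (\<sigma> \<alpha> x))"
    by (rule smooth_act[OF S smooth_map_circle_inverse[OF S k(1)] s])
  then have "smooth_map (open_submanifold M0 ?W) N (\<lambda>x. \<iota> (1, x))"
  proof (rule smooth_map_cong[OF S structure_N, rotated])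
    fix y assume "y \<in> topspace (mtop (open_submanifold M0 ?W))"
    then have y: "y \<in> ?W" by simp
    note a = \<iota>_arrow[of 1 y]
    have "inverse (k y) \<in> circle" "k y \<noteq> 0" using k(2)[OF y] by (auto simp: norm_inverse)
    then show "act (inverse (k y)) (\<sigma> \<alpha> y) = \<iota> (1, y)"
      using k(3)[OF y] act_act[OF _ k(2)[OF y] a] act_one[OF a] y by simp
  qed
  then show "\<exists>W. openin (mtop M0) W \<and> x \<in> W \<and> smooth_map (open_submanifold M0 W) N (\<lambda>x. \<iota> (1, x))"
    using W \<alpha> x by blast
qed

lemma smooth_\<iota>: "smooth_map (prod_manifold circle_manifold M0) N \<iota>"
proof -
  note S = smooth_structure_prod[OF smooth_structure_circle structure_M0]
  have "smooth_map (prod_manifold circle_manifold M0) N (\<lambda>p. act (fst p) (\<iota> (1, snd p)))"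
    by (rule smooth_act[OF S smooth_map_fst[OF smooth_structure_circle structure_M0]
          smooth_map_compose[OF S structure_M0 structure_N smooth_map_snd[OF smooth_structure_circle structure_M0] smooth_unit_section]])
  then show ?thesis
  proof (rule smooth_map_cong[OF S structure_N, rotated])
    fix p assume "p \<in> topspace (mtop (prod_manifold circle_manifold M0))"
    then have "fst p \<in> circle" "snd p \<in> units G" by (auto simp: topspace_M0)
    from \<iota>_eq_act[OF this] show "act (fst p) (\<iota> (1, snd p)) = \<iota> p" by simp
  qed
qed

abbreviation N0 :: "'e manifold" where "N0 \<equiv> twist_unit_manifold E \<pi> M0"

lemma units_E_subset: "units E \<subseteq> arrows E"
  using groupoid_E by (simp add: is_groupoid_def)

lemma unit_homeomorphism: "homeomorphic_maps (unit_top E) (mtop M0) \<pi> (\<lambda>x. \<iota> (1, x))"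
  unfolding homeomorphic_maps_def
proof (intro conjI ballI)
  show "continuous_map (unit_top E) (mtop M0) \<pi>"
    unfolding top_M0 continuous_map_in_subtopology
    using continuous_map_from_subtopology[OF continuous_\<pi>] \<pi>_unit by auto
  show "continuous_map (mtop M0) (unit_top E) (\<lambda>x. \<iota> (1, x))"
    unfolding continuous_map_in_subtopology
    using smooth_map_continuous[OF smooth_unit_section] \<iota>_one_unit by (simp add: topspace_M0 top_N image_subset_iff Pi_iff)
  show "\<iota> (1, \<pi> y) = y" if "y \<in> topspace (unit_top E)" for y using that \<iota>_one_\<pi> by simp
  show "\<pi> (\<iota> (1, x)) = x" if "x \<in> topspace (mtop M0)" for x using that \<pi>_\<iota>_one topspace_M0 by simp
qed

lemma manifold_N0: "smooth_manifold N0"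
  unfolding twist_unit_manifold_def
  using lie smooth_manifold_transported[OF _ unit_homeomorphism] by (simp add: lie_groupoid_def)

lemmas structure_N0 = smooth_manifold_structure[OF manifold_N0]

lemma top_N0: "mtop N0 = unit_top E" and dim_N0: "mdim N0 = mdim M0"
  by (simp_all add: twist_unit_manifold_def)

lemma topspace_N0: "topspace (mtop N0) = units E"
  using units_E_subset by (auto simp: top_N0)

lemma smooth_\<pi>_units: "smooth_map N0 M0 \<pi>"
  unfolding twist_unit_manifold_def by (rule smooth_map_transport[OF structure_M0 unit_homeomorphism])

lemma smooth_units_\<iota>: "smooth_map M0 N0 (\<lambda>x. \<iota> (1, x))"
  unfolding twist_unit_manifold_def by (rule smooth_map_transport_inverse[OF structure_M0 unit_homeomorphism])

text \<open>Smoothness holds because the inclusion is the unit section after \<open>\<pi>\<close>.  It is an immersion because followed by \<open>\<pi>\<close> it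
  becomes the inclusion of the units of \<open>G\<close>.\<close>

lemma smooth_embedding_units: "smooth_embedding N0 N (\<lambda>y. y)"
proof -
  have "smooth_map N0 N (\<lambda>y. \<iota> (1, \<pi> y))"
    by (rule smooth_map_compose[OF structure_N0 structure_M0 structure_N smooth_\<pi>_units smooth_unit_section])
  then have s: "smooth_map N0 N (\<lambda>y. y)"
    by (rule smooth_map_cong[OF structure_N0 structure_N, rotated]) (simp add: topspace_N0 \<iota>_one_\<pi>)
  have "immersion N0 M0 \<pi>"
    by (rule immersion_if_left_inverse[OF structure_N0 structure_M0 smooth_\<pi>_units smooth_units_\<iota>])
      (simp add: topspace_N0 \<iota>_one_\<pi>)
  moreover have "immersion M0 M (\<lambda>x. x)" using lie by (simp add: lie_groupoid_def smooth_embedding_def)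
  ultimately have "immersion N0 M (\<lambda>y. \<pi> y)"
    by (rule immersion_compose[OF structure_N0 structure_M0 structure_M, where g = "\<lambda>x. x"])
  then have "immersion N0 N (\<lambda>y. y)" by (rule immersion_factor[OF structure_N0 structure_N structure_M s smooth_\<pi>])
  moreover have "embedding_map (mtop N0) (mtop N) (\<lambda>y. y)"
    using units_E_subset by (simp add: embedding_map_def top_N0 top_N inf.absorb2 homeomorphic_map_id[unfolded id_def])
  ultimately show ?thesis by (simp add: smooth_embedding_def)
qed

lemma submersion_units_\<iota>: "submersion M0 N0 (\<lambda>x. \<iota> (1, x))"
proof (rule submersion_if_local_sections[OF structure_M0 structure_N0 smooth_units_\<iota>])
  fix x assume "x \<in> topspace (mtop M0)"
  then have x: "x \<in> units G" by (simp add: topspace_M0)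
  show "\<exists>W s. openin (mtop N0) W \<and> \<iota> (1, x) \<in> W \<and> smooth_map (open_submanifold N0 W) M0 s \<and> s (\<iota> (1, x)) = x \<and>
      (\<forall>y\<in>W. \<iota> (1, s y) = y)"
    using x \<iota>_one_unit \<pi>_\<iota>_one \<iota>_one_\<pi> topspace_N0 smooth_map_restrict[OF smooth_\<pi>_units] openin_topspace[of "mtop N0"]
    by (intro exI[of _ "units E"] exI[of _ \<pi>]) auto
qed

lemma submersion_rng_src: "submersion N N0 (rng E)" "submersion N N0 (src E)"
proof -
  have G: "submersion M M0 (rng G)" "submersion M M0 (src G)" using lie by (auto simp: lie_groupoid_def)
  note c = submersion_compose[OF structure_N structure_M0 structure_N0
      submersion_compose[OF structure_N structure_M structure_M0 submersion_\<pi>] submersion_units_\<iota>]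
  show "submersion N N0 (rng E)"
    by (rule submersion_cong[OF structure_N structure_N0 c[OF G(1)]]) (simp add: rng_E top_N)
  show "submersion N N0 (src E)"
    by (rule submersion_cong[OF structure_N structure_N0 c[OF G(2)]]) (simp add: src_E top_N)
qed

text \<open>These two relations make the dimension of the composable pairs of \<open>E\<close> exceed that of \<open>G\<close> by two; the second one excludes
  that the subtraction in \<^const>\<open>composable_dim\<close> is cut off at 0.\<close>

lemma dim_N:
  assumes e: "e \<in> arrows E"
  shows "mdim N = mdim M + 1" and "mdim M0 \<le> mdim M"
proof -
  note \<pi>_arrow[OF e]
  then obtain V h h' where V: "openin (mtop M) V" "\<pi> e \<in> V"
    "smooth_map (open_submanifold N (over V)) (prod_manifold circle_manifold (open_submanifold M V)) h"
    "smooth_map (prod_manifold circle_manifold (open_submanifold M V)) (open_submanifold N (over V)) h'"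
    and h: "\<And>e. e \<in> over V \<Longrightarrow> h' (h e) = e" "\<And>y. y \<in> circle \<times> V \<Longrightarrow> h (h' y) = y"
    using local_trivialisation[of "\<pi> e"] unfolding top_M by metis
  note SN = smooth_structure_open_submanifold[OF structure_N over_open[OF V(1)]]
  note SP = smooth_structure_prod[OF smooth_structure_circle smooth_structure_open_submanifold[OF structure_M V(1)]]
  have tN: "topspace (mtop (open_submanifold N (over V))) = over V" by (auto simp: top_N)
  have tP: "topspace (mtop (prod_manifold circle_manifold (open_submanifold M V))) = circle \<times> V"
    using openin_subset[OF V(1)] by auto
  have "mdim (open_submanifold N (over V)) \<le> mdim (prod_manifold circle_manifold (open_submanifold M V))"
    by (rule manifold_dimension_le[OF SN SP _ smooth_map_continuous[OF V(3)], of e])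
      (use e V(2) h(1) in \<open>auto simp only: tN over_iff intro: inj_on_inverseI[of _ h']\<close>)
  moreover have "mdim (prod_manifold circle_manifold (open_submanifold M V)) \<le> mdim (open_submanifold N (over V))"
    by (rule manifold_dimension_le[OF SP SN _ smooth_map_continuous[OF V(4)], of "(1, \<pi> e)"])
      (use V(2) h(2) in \<open>auto simp only: tP intro: inj_on_inverseI[of _ h]\<close>, use V(2) in simp)
  ultimately show "mdim N = mdim M + 1" by simp
  show "mdim M0 \<le> mdim M"
    by (rule manifold_dimension_le[OF structure_M0 structure_M _ smooth_map_continuous[OF smooth_unit_inclusion], of "rng G (\<pi> e)"])
      (use rng_\<pi>[OF e] topspace_M0 in auto)
qed

end

section \<open>Composable pairs of the twist\<close>

context smooth_twist
begin

abbreviation MM where "MM \<equiv> prod_manifold M M"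
abbreviation NN where "NN \<equiv> prod_manifold N N"

lemma structure_MM: "smooth_structure MM" and structure_NN: "smooth_structure NN"
  by (rule smooth_structure_prod[OF structure_M structure_M], rule smooth_structure_prod[OF structure_N structure_N])

lemma topspace_NN: "topspace (mtop NN) = arrows E \<times> arrows E"
  by (simp add: top_N)

definition \<pi>\<pi> :: "'e \<times> 'e \<Rightarrow> 'g \<times> 'g" where "\<pi>\<pi> p = (\<pi> (fst p), \<pi> (snd p))"

lemma smooth_\<pi>\<pi>: "smooth_map NN MM \<pi>\<pi>"
  unfolding \<pi>\<pi>_def
  by (rule smooth_map_pair[OF structure_NN structure_M structure_M
      smooth_map_compose[OF structure_NN structure_N structure_M smooth_map_fst[OF structure_N structure_N] smooth_\<pi>]
      smooth_map_compose[OF structure_NN structure_N structure_M smooth_map_snd[OF structure_N structure_N] smooth_\<pi>]])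

lemma embedded_composable_G: "embedded_submanifold MM (composable_dim M M0) (composable G)"
  using lie by (simp add: lie_groupoid_def)

lemma composable_E_\<pi>\<pi>: "p \<in> arrows E \<times> arrows E \<Longrightarrow> p \<in> composable E \<longleftrightarrow> \<pi>\<pi> p \<in> composable G"
  by (auto simp: composable_E \<pi>\<pi>_def)

text \<open>Near a composable pair, \<open>E \<times> E\<close> looks like \<open>G \<times> G\<close> times two circles, and being composable is a condition on the
  component in \<open>G \<times> G\<close>.  The chart is verified through \<open>chart_of_diffeomorphism\<close>: it and its inverse are composed of
  smooth maps.\<close>

lemma composable_slice_chart:
  assumes p0: "p0 \<in> composable E"
  shows "\<exists>Q \<Phi>. (Q, \<Phi>) \<in> slice_charts NN (composable_dim N N0) (composable E) \<and> p0 \<in> Q"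
proof -
  let ?k = "composable_dim M M0" and ?n = "mdim M + mdim M"
  have p0': "fst p0 \<in> arrows E" "snd p0 \<in> arrows E" "\<pi>\<pi> p0 \<in> composable G" using p0 by (auto simp: composable_E \<pi>\<pi>_def)
  have kn: "?k \<le> ?n" by (simp add: composable_dim_def)
  have dimNN: "mdim NN = ?n + 2" using dim_N(1)[OF p0'(1)] by simp
  have dimk: "composable_dim N N0 = ?k + 2"
    using dim_N[OF p0'(1)] by (simp add: composable_dim_def dim_N0)
  obtain \<alpha> where \<alpha>: "\<alpha> \<in> A" "\<pi> (fst p0) \<in> U \<alpha>" using U_coverE[OF \<pi>_arrow[OF p0'(1)]] .
  obtain \<beta> where \<beta>: "\<beta> \<in> A" "\<pi> (snd p0) \<in> U \<beta>" using U_coverE[OF \<pi>_arrow[OF p0'(2)]] .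
  obtain P0 \<phi> where P0: "(P0, \<phi>) \<in> slice_charts MM ?k (composable G)" "\<pi>\<pi> p0 \<in> P0"
    using embedded_submanifold_cover[OF embedded_composable_G p0'(3)] .
  define P where "P = P0 \<inter> U \<alpha> \<times> U \<beta>"
  have "openin (mtop MM) (U \<alpha> \<times> U \<beta>)" using U_open \<alpha>(1) \<beta>(1) by (simp add: openin_prod_Times_iff)
  from slice_chart_restrict[OF structure_MM P0(1) this]
  have slice: "(P, \<phi>) \<in> slice_charts MM ?k (composable G)" by (simp add: P_def)
  have Pch: "(P, \<phi>) \<in> charts MM" and Peq: "\<phi> ` (P \<inter> composable G) = \<phi> ` P \<inter> coord_space ?k"
    using slice by (auto simp: slice_charts_def)
  note P1 = structure_chart[OF structure_MM Pch]
  have P1': "\<phi> q \<in> coord_space ?n" if "q \<in> P" for q using chart_coord[OF P1 that] by simp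
  obtain a where a: "cis a \<noteq> phase \<alpha> (fst p0)" using exists_cis_not by blast
  obtain b where b: "cis b \<noteq> phase \<beta> (snd p0)" using exists_cis_not by blast
  define R where "R = topspace (mtop NN) \<inter> \<pi>\<pi> -` P"
  have Ro: "openin (mtop NN) R" unfolding R_def by (rule smooth_map_preimage_open[OF smooth_\<pi>\<pi> chart_open[OF P1]])
  note SR = smooth_structure_open_submanifold[OF structure_NN Ro]
  have RD: "fst p \<in> arrows E" "snd p \<in> arrows E" "\<pi> (fst p) \<in> U \<alpha>" "\<pi> (snd p) \<in> U \<beta>" "\<pi>\<pi> p \<in> P" if "p \<in> R" for p
    using that unfolding R_def topspace_NN by (auto simp: P_def \<pi>\<pi>_def)
  have pa: "smooth_map (open_submanifold NN R) circle_manifold (\<lambda>p. phase \<alpha> (fst p))"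
    by (rule smooth_map_compose_open[OF SR structure_N smooth_structure_circle over_open[OF U_open[OF \<alpha>(1)]]
          smooth_map_restrict[OF smooth_map_fst[OF structure_N structure_N]] _ smooth_phase[OF \<alpha>(1)]]) (use RD in auto)
  have pb: "smooth_map (open_submanifold NN R) circle_manifold (\<lambda>p. phase \<beta> (snd p))"
    by (rule smooth_map_compose_open[OF SR structure_N smooth_structure_circle over_open[OF U_open[OF \<beta>(1)]]
          smooth_map_restrict[OF smooth_map_snd[OF structure_N structure_N]] _ smooth_phase[OF \<beta>(1)]]) (use RD in auto)
  \<comment> \<open>The chart lives where both phases avoid the base points of the chosen angle charts.\<close>
  define Q where "Q = {p \<in> R. phase \<alpha> (fst p) \<noteq> cis a \<and> phase \<beta> (snd p) \<noteq> cis b}"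
  have topR: "topspace (mtop (open_submanifold NN R)) = R" unfolding R_def by auto
  have co: "openin (mtop circle_manifold) (circle - {cis t})" for t
    by (rule chart_open[OF structure_chart[OF smooth_structure_circle angle_chart_in]])
  have "openin (mtop (open_submanifold NN R)) ((R \<inter> (\<lambda>p. phase \<alpha> (fst p)) -` (circle - {cis a})) \<inter>
      (R \<inter> (\<lambda>p. phase \<beta> (snd p)) -` (circle - {cis b})))"
    using smooth_map_preimage_open[OF pa co[of a]] smooth_map_preimage_open[OF pb co[of b]] unfolding topR by (rule openin_Int)
  moreover have "(R \<inter> (\<lambda>p. phase \<alpha> (fst p)) -` (circle - {cis a})) \<inter> (R \<inter> (\<lambda>p. phase \<beta> (snd p)) -` (circle - {cis b})) = Q"
    unfolding Q_def using RD phase_circle[OF \<alpha>(1)] phase_circle[OF \<beta>(1)] by blast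
  ultimately have "openin (subtopology (mtop NN) R) Q" by simp
  then have Qo: "openin (mtop NN) Q" using Ro by (rule openin_trans_full)
  note SQ = smooth_structure_open_submanifold[OF structure_NN Qo]
  have QR: "Q \<subseteq> R" by (auto simp: Q_def)
  have p0Q: "p0 \<in> Q" using p0' P0(2) \<alpha> \<beta> a b by (auto simp: Q_def R_def P_def topspace_NN \<pi>\<pi>_def mem_Times_iff top_N)
  \<comment> \<open>A pair is recorded by the coordinates of its image in \<open>G \<times> G\<close> and by the angles of its phases; conversely, the
    sections over that image are rotated by the angles.\<close>
  define \<Phi> where "\<Phi> p = insert_coords ?k (angle a (phase \<alpha> (fst p))) (angle b (phase \<beta> (snd p))) (\<phi> (\<pi>\<pi> p))" for p
  define \<Psi> where "\<Psi> z = (let q = inv_into P \<phi> (remove_coords ?k z)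
      in (act (cis (z ?k)) (\<sigma> \<alpha> (fst q)), act (cis (z (Suc ?k))) (\<sigma> \<beta> (snd q))))" for z
  define V where "V = {z \<in> coord_space (?n + 2). remove_coords ?k z \<in> \<phi> ` P} \<inter>
      ({z \<in> coord_space (?n + 2). z ?k \<in> {a<..<a + 2 * pi}} \<inter> {z \<in> coord_space (?n + 2). z (Suc ?k) \<in> {b<..<b + 2 * pi}})"
  have inv: "\<Psi> (\<Phi> p) = p" if p: "p \<in> Q" for p
  proof -
    note r = RD[OF subsetD[OF QR p]]
    have "cis (angle a (phase \<alpha> (fst p))) = phase \<alpha> (fst p)" "cis (angle b (phase \<beta> (snd p))) = phase \<beta> (snd p)"
      using p phase_circle[OF \<alpha>(1) r(1,3)] phase_circle[OF \<beta>(1) r(2,4)] unfolding Q_def by (blast intro: cis_angle)+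
    then show ?thesis
      using chart_inv[OF P1 r(5)] act_phase[OF \<alpha>(1) r(1,3)] act_phase[OF \<beta>(1) r(2,4)]
      by (simp add: \<Psi>_def \<Phi>_def Let_def \<pi>\<pi>_def)
  qed
  have \<Phi>V: "\<Phi> p \<in> V" if p: "p \<in> Q" for p
  proof -
    note r = RD[OF subsetD[OF QR p]]
    have "angle a (phase \<alpha> (fst p)) \<in> {a<..<a + 2 * pi}" "angle b (phase \<beta> (snd p)) \<in> {b<..<b + 2 * pi}"
      using p phase_circle[OF \<alpha>(1) r(1,3)] phase_circle[OF \<beta>(1) r(2,4)] unfolding Q_def by (blast intro: angle_range)+
    then show ?thesis
      using insert_coords_in[OF kn P1'[OF r(5)]] r(5) by (simp add: V_def \<Phi>_def)
  qed
  have \<Psi>Q: "\<Psi> z \<in> Q \<and> \<Phi> (\<Psi> z) = z" if z: "z \<in> V" for z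
  proof -
    have z': "remove_coords ?k z \<in> \<phi> ` P" "z ?k \<in> {a<..<a + 2 * pi}" "z (Suc ?k) \<in> {b<..<b + 2 * pi}"
      using z by (auto simp: V_def)
    then obtain q where q: "q \<in> P" "remove_coords ?k z = \<phi> q" by blast
    then have qU: "fst q \<in> U \<alpha>" "snd q \<in> U \<beta>" by (auto simp: P_def)
    have \<Psi>: "\<Psi> z = (act (cis (z ?k)) (\<sigma> \<alpha> (fst q)), act (cis (z (Suc ?k))) (\<sigma> \<beta> (snd q)))"
      using chart_inv[OF P1 q(1)] by (simp add: \<Psi>_def Let_def q(2))
    have c: "cis t \<in> circle" for t by simp
    note s = section_arrow[OF \<alpha>(1) qU(1)] section_arrow[OF \<beta>(1) qU(2)]
    have \<pi>q: "\<pi>\<pi> (\<Psi> z) = q"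
      using \<pi>_act[OF c s(1)] \<pi>_act[OF c s(2)] \<pi>_section[OF \<alpha>(1) qU(1)] \<pi>_section[OF \<beta>(1) qU(2)]
      by (simp add: \<Psi> \<pi>\<pi>_def)
    have ph: "phase \<alpha> (fst (\<Psi> z)) = cis (z ?k)" "phase \<beta> (snd (\<Psi> z)) = cis (z (Suc ?k))"
      using phase_act[OF \<alpha>(1) qU(1) c] phase_act[OF \<beta>(1) qU(2) c] by (simp_all add: \<Psi>)
    have "\<Psi> z \<in> R" using act_arrow[OF c s(1)] act_arrow[OF c s(2)] \<pi>q q(1) unfolding R_def topspace_NN by (simp add: \<Psi>)
    then have "\<Psi> z \<in> Q" using ph cis_not_base[OF z'(2)] cis_not_base[OF z'(3)] by (simp add: Q_def)
    moreover have "\<Phi> (\<Psi> z) = z"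
      using insert_remove_coords[of ?k z] by (simp add: \<Phi>_def ph \<pi>q angle_cis[OF z'(2)] angle_cis[OF z'(3)] flip: q(2))
    ultimately show ?thesis by blast
  qed
  have im: "\<Phi> ` Q = V"
  proof
    show "\<Phi> ` Q \<subseteq> V" using \<Phi>V by blast
    show "V \<subseteq> \<Phi> ` Q"
    proof
      fix z assume "z \<in> V"
      with \<Psi>Q[OF this] show "z \<in> \<Phi> ` Q" by (intro image_eqI[of _ _ "\<Psi> z"]) auto
    qed
  qed
  have "continuous_map (Euclidean_space (?n + 2)) (Euclidean_space ?n) (remove_coords ?k)"
    by (rule continuous_map_into_Euclidean_space[OF _ remove_coords_in[OF kn]])
      (simp_all add: remove_coords_def continuous_map_coordinate)
  from openin_continuous_map_preimage[OF this, of "\<phi> ` P"] chart_open_image[OF P1]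
  have "openin (Euclidean_space (?n + 2)) {z \<in> coord_space (?n + 2). remove_coords ?k z \<in> \<phi> ` P}" by simp
  moreover have "openin (Euclidean_space (?n + 2)) {z \<in> coord_space (?n + 2). z i \<in> {t<..<t + 2 * pi}}" for i t
    by (rule openin_continuous_map_preimage[OF continuous_map_coordinate]) simp
  ultimately have Vo: "openin (Euclidean_space (?n + 2)) V" unfolding V_def by (intro openin_Int)
  have QC: "(Q, \<Phi>) \<in> charts NN"
  proof (rule chart_of_diffeomorphism[OF structure_NN Qo _ _ _ inv])
    show "openin (Euclidean_space (mdim NN)) (\<Phi> ` Q)" using Vo im dimNN by simp
    have p\<phi>: "smooth_fun (open_submanifold NN Q) (\<lambda>p. \<phi> (\<pi>\<pi> p) j)" for j
      by (rule smooth_map_coordinate[OF SQ structure_MM smooth_map_restrict[OF smooth_\<pi>\<pi>] Pch]) (use RD QR in auto)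
    have "smooth_fun (open_submanifold NN Q) (\<lambda>p. angle a (phase \<alpha> (fst p)))"
      by (rule smooth_fun_angle[OF SQ smooth_map_restrict_mono[OF pa QR]]) (auto simp: Q_def)
    moreover have "smooth_fun (open_submanifold NN Q) (\<lambda>p. angle b (phase \<beta> (snd p)))"
      by (rule smooth_fun_angle[OF SQ smooth_map_restrict_mono[OF pb QR]]) (auto simp: Q_def)
    ultimately show "smooth_fun (open_submanifold NN Q) (\<lambda>p. \<Phi> p j)" for j
      using p\<phi> unfolding \<Phi>_def insert_coords_def by (cases "j < ?k"; cases "j = ?k"; cases "j = Suc ?k") simp_all
    let ?E = "open_submanifold (euclidean_manifold (?n + 2)) V"
    have SE: "smooth_structure ?E" using smooth_structure_open_submanifold[OF smooth_structure_euclidean, of "?n + 2" V] Vo by simp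
    have VE: "z \<in> V" if "z \<in> topspace (mtop ?E)" for z using that by simp
    have coord: "smooth_fun ?E (\<lambda>z. z j)" for j by (rule smooth_fun_restrict[OF smooth_fun_euclidean_coordinate])
    have r: "smooth_map ?E (euclidean_manifold ?n) (remove_coords ?k)"
    proof (rule smooth_map_into_euclidean[OF SE])
      show "remove_coords ?k z \<in> coord_space ?n" if "z \<in> topspace (mtop ?E)" for z
        using VE[OF that] by (intro remove_coords_in[OF kn]) (simp add: V_def)
      show "smooth_fun ?E (\<lambda>z. remove_coords ?k z j)" for j by (rule smooth_fun_restrict[OF smooth_fun_remove_coords])
    qed
    have Pinv: "smooth_map (open_submanifold (euclidean_manifold ?n) (\<phi> ` P)) MM (inv_into P \<phi>)"
      using chart_inverse_smooth[OF structure_MM Pch] by simp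
    have q: "smooth_map ?E MM (\<lambda>z. inv_into P \<phi> (remove_coords ?k z))"
      by (rule smooth_map_compose_open[OF SE smooth_structure_euclidean structure_MM _ r _ Pinv])
        (use chart_open_image[OF P1] VE in \<open>auto simp: V_def\<close>)
    have qP: "inv_into P \<phi> (remove_coords ?k z) \<in> P" if "z \<in> topspace (mtop ?E)" for z
      using VE[OF that] by (intro inv_into_into) (simp add: V_def)
    have "smooth_map ?E N (\<lambda>z. \<sigma> \<alpha> (fst (inv_into P \<phi> (remove_coords ?k z))))"
      by (rule smooth_map_compose_open[OF SE structure_M structure_N U_open[OF \<alpha>(1)]
            smooth_map_compose[OF SE structure_MM structure_M q smooth_map_fst[OF structure_M structure_M]] _ section_smooth[OF \<alpha>(1)]])
        (use qP in \<open>auto simp: P_def mem_Times_iff\<close>)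
    from smooth_act[OF SE smooth_map_cis[OF SE coord[of ?k]] this]
    have 1: "smooth_map ?E N (\<lambda>z. act (cis (z ?k)) (\<sigma> \<alpha> (fst (inv_into P \<phi> (remove_coords ?k z)))))" .
    have "smooth_map ?E N (\<lambda>z. \<sigma> \<beta> (snd (inv_into P \<phi> (remove_coords ?k z))))"
      by (rule smooth_map_compose_open[OF SE structure_M structure_N U_open[OF \<beta>(1)]
            smooth_map_compose[OF SE structure_MM structure_M q smooth_map_snd[OF structure_M structure_M]] _ section_smooth[OF \<beta>(1)]])
        (use qP in \<open>auto simp: P_def mem_Times_iff\<close>)
    from smooth_act[OF SE smooth_map_cis[OF SE coord[of "Suc ?k"]] this]
    have 2: "smooth_map ?E N (\<lambda>z. act (cis (z (Suc ?k))) (\<sigma> \<beta> (snd (inv_into P \<phi> (remove_coords ?k z)))))" .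
    have "smooth_map ?E NN \<Psi>"
      unfolding \<Psi>_def Let_def by (rule smooth_map_pair[OF SE structure_N structure_N 1 2])
    then show "smooth_map (open_submanifold (euclidean_manifold (mdim NN)) (\<Phi> ` Q)) NN \<Psi>" by (simp only: dimNN im)
  qed
  \<comment> \<open>Composability depends on the image in \<open>G \<times> G\<close> only, where the slice chart detects it.\<close>
  have slice_iff: "p \<in> composable E \<longleftrightarrow> \<Phi> p \<in> coord_space (?k + 2)" if p: "p \<in> Q" for p
  proof -
    note r = RD[OF subsetD[OF QR p]]
    have "p \<in> composable E \<longleftrightarrow> \<pi>\<pi> p \<in> composable G" by (rule composable_E_\<pi>\<pi>) (use r in \<open>simp add: mem_Times_iff\<close>)
    also have "\<dots> \<longleftrightarrow> \<phi> (\<pi>\<pi> p) \<in> coord_space ?k"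
    proof
      assume "\<phi> (\<pi>\<pi> p) \<in> coord_space ?k"
      then have "\<phi> (\<pi>\<pi> p) \<in> \<phi> ` (P \<inter> composable G)" using Peq r(5) by blast
      then obtain q where q: "q \<in> P \<inter> composable G" "\<phi> (\<pi>\<pi> p) = \<phi> q" by blast
      then have "\<pi>\<pi> p = q" using inj_onD[OF chart_inj[OF P1], of "\<pi>\<pi> p" q] r(5) by blast
      then show "\<pi>\<pi> p \<in> composable G" using q by blast
    qed (use Peq r(5) in blast)
    finally show ?thesis by (simp only: \<Phi>_def insert_coords_in_slice)
  qed
  have "\<Phi> ` (Q \<inter> composable E) = \<Phi> ` Q \<inter> coord_space (?k + 2)" using slice_iff by auto
  then show ?thesis using QC p0Q by (intro exI[of _ Q] exI[of _ \<Phi>]) (simp add: slice_charts_def dimk)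
qed

lemma embedded_composable_E: "embedded_submanifold NN (composable_dim N N0) (composable E)"
  unfolding embedded_submanifold_def
proof
  show "composable E \<subseteq> topspace (mtop NN)" unfolding topspace_NN by (auto simp: composable_def)
  show "composable E \<subseteq> (\<Union>c\<in>slice_charts NN (composable_dim N N0) (composable E). fst c)"
    using composable_slice_chart by force
qed

abbreviation CG where "CG \<equiv> composable_manifold G M M0"
abbreviation CE where "CE \<equiv> composable_manifold E N N0"

lemma composable_dims: "composable_dim M M0 \<le> mdim MM" "composable_dim N N0 \<le> mdim NN"
  by (simp_all add: composable_dim_def)

lemma structure_CG: "smooth_structure CG" and structure_CE: "smooth_structure CE"
  unfolding composable_manifold_def
  by (rule smooth_structure_submanifold[OF structure_MM composable_dims(1) embedded_composable_G],
      rule smooth_structure_submanifold[OF structure_NN composable_dims(2) embedded_composable_E])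

lemma topspace_CG: "topspace (mtop CG) = composable G"
  by (auto simp: composable_manifold_def top_M composable_def)

lemma topspace_CE: "topspace (mtop CE) = composable E"
  by (auto simp: composable_manifold_def top_N composable_def)

lemma smooth_CG: "smooth_map CG MM (\<lambda>p. p)" and smooth_CE: "smooth_map CE NN (\<lambda>p. p)"
  unfolding composable_manifold_def
  by (rule smooth_map_submanifold_inclusion[OF structure_MM composable_dims(1) embedded_composable_G],
      rule smooth_map_submanifold_inclusion[OF structure_NN composable_dims(2) embedded_composable_E])

lemma smooth_into_CG:
  "smooth_structure P \<Longrightarrow> smooth_map P MM f \<Longrightarrow> (\<And>p. p \<in> topspace (mtop P) \<Longrightarrow> f p \<in> composable G) \<Longrightarrow> smooth_map P CG f"
  unfolding composable_manifold_def
  by (rule smooth_map_into_submanifold[OF _ structure_MM composable_dims(1) embedded_composable_G])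

lemma smooth_mult_G: "smooth_map CG M (\<lambda>(g, h). gmult G g h)"
  using lie by (simp add: lie_groupoid_def)

lemma smooth_inv_G: "smooth_map M M (ginv G)"
  using lie by (simp add: lie_groupoid_def)

section \<open>Multiplication and inversion of the twist\<close>

definition mult_domain :: "'i \<Rightarrow> 'i \<Rightarrow> 'i \<Rightarrow> ('g \<times> 'g) set" where
  "mult_domain \<alpha>\<^sub>1 \<alpha>\<^sub>2 \<alpha> = {(\<gamma>\<^sub>1, \<gamma>\<^sub>2) \<in> composable G. \<gamma>\<^sub>1 \<in> U \<alpha>\<^sub>1 \<and> \<gamma>\<^sub>2 \<in> U \<alpha>\<^sub>2 \<and> gmult G \<gamma>\<^sub>1 \<gamma>\<^sub>2 \<in> U \<alpha>}"

text \<open>The circle component of the map in condition (M).\<close>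

definition mult_phase :: "'i \<Rightarrow> 'i \<Rightarrow> 'i \<Rightarrow> 'g \<times> 'g \<Rightarrow> complex" where
  "mult_phase \<alpha>\<^sub>1 \<alpha>\<^sub>2 \<alpha> p = quotient (gmult E (\<sigma> \<alpha>\<^sub>1 (fst p)) (\<sigma> \<alpha>\<^sub>2 (snd p))) (\<sigma> \<alpha> (gmult G (fst p) (snd p)))"

lemma mult_domain_open:
  assumes "\<alpha>\<^sub>1 \<in> A" "\<alpha>\<^sub>2 \<in> A" "\<alpha> \<in> A"
  shows "openin (mtop CG) (mult_domain \<alpha>\<^sub>1 \<alpha>\<^sub>2 \<alpha>)"
proof -
  have 1: "smooth_map CG M fst" and 2: "smooth_map CG M snd"
    using smooth_map_compose[OF structure_CG structure_MM structure_M smooth_CG smooth_map_fst[OF structure_M structure_M]]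
      smooth_map_compose[OF structure_CG structure_MM structure_M smooth_CG smooth_map_snd[OF structure_M structure_M]] by simp_all
  have eq: "mult_domain \<alpha>\<^sub>1 \<alpha>\<^sub>2 \<alpha> = (composable G \<inter> fst -` U \<alpha>\<^sub>1) \<inter> ((composable G \<inter> snd -` U \<alpha>\<^sub>2) \<inter>
      (composable G \<inter> (\<lambda>(g, h). gmult G g h) -` U \<alpha>))"
    by (auto simp: mult_domain_def)
  show ?thesis
    unfolding eq
    using smooth_map_preimage_open[OF 1 U_open[OF assms(1)]] smooth_map_preimage_open[OF 2 U_open[OF assms(2)]]
      smooth_map_preimage_open[OF smooth_mult_G U_open[OF assms(3)]]
    unfolding topspace_CG by (blast intro: openin_Int)
qed

lemma smooth_mult_phase:
  assumes "\<alpha>\<^sub>1 \<in> A" "\<alpha>\<^sub>2 \<in> A" "\<alpha> \<in> A"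
  shows "smooth_map (open_submanifold CG (mult_domain \<alpha>\<^sub>1 \<alpha>\<^sub>2 \<alpha>)) circle_manifold (mult_phase \<alpha>\<^sub>1 \<alpha>\<^sub>2 \<alpha>)"
proof -
  note S = smooth_structure_open_submanifold[OF structure_CG mult_domain_open[OF assms]]
  have "smooth_map (open_submanifold CG (mult_domain \<alpha>\<^sub>1 \<alpha>\<^sub>2 \<alpha>)) (prod_manifold circle_manifold M0)
      (\<lambda>(\<gamma>\<^sub>1, \<gamma>\<^sub>2). twist_coord G \<iota> (gmult E (gmult E (\<sigma> \<alpha>\<^sub>1 \<gamma>\<^sub>1) (\<sigma> \<alpha>\<^sub>2 \<gamma>\<^sub>2)) (ginv E (\<sigma> \<alpha> (gmult G \<gamma>\<^sub>1 \<gamma>\<^sub>2)))))"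
    using mult_smooth assms unfolding M_smooth_def mult_domain_def by blast
  from smooth_map_compose[OF S smooth_structure_prod[OF smooth_structure_circle structure_M0] smooth_structure_circle this
      smooth_map_fst[OF smooth_structure_circle structure_M0]]
  show ?thesis
    by (rule smooth_map_cong[OF S smooth_structure_circle, rotated]) (simp add: mult_phase_def quotient_def case_prod_beta)
qed

lemma section_mult:
  assumes A: "\<alpha>\<^sub>1 \<in> A" "\<alpha>\<^sub>2 \<in> A" "\<alpha> \<in> A" and p: "(\<gamma>, \<eta>) \<in> mult_domain \<alpha>\<^sub>1 \<alpha>\<^sub>2 \<alpha>"
  shows "src E (\<sigma> \<alpha>\<^sub>1 \<gamma>) = rng E (\<sigma> \<alpha>\<^sub>2 \<eta>)"
    and "mult_phase \<alpha>\<^sub>1 \<alpha>\<^sub>2 \<alpha> (\<gamma>, \<eta>) \<in> circle"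
    and "gmult E (\<sigma> \<alpha>\<^sub>1 \<gamma>) (\<sigma> \<alpha>\<^sub>2 \<eta>) = act (mult_phase \<alpha>\<^sub>1 \<alpha>\<^sub>2 \<alpha> (\<gamma>, \<eta>)) (\<sigma> \<alpha> (gmult G \<gamma> \<eta>))"
proof -
  have u: "\<gamma> \<in> U \<alpha>\<^sub>1" "\<eta> \<in> U \<alpha>\<^sub>2" "gmult G \<gamma> \<eta> \<in> U \<alpha>" and c: "src G \<gamma> = rng G \<eta>"
    using p by (auto simp: mult_domain_def composable_def)
  note s = section_arrow[OF A(1) u(1)] section_arrow[OF A(2) u(2)] section_arrow[OF A(3) u(3)]
  note \<pi>s = \<pi>_section[OF A(1) u(1)] \<pi>_section[OF A(2) u(2)] \<pi>_section[OF A(3) u(3)]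
  show sr: "src E (\<sigma> \<alpha>\<^sub>1 \<gamma>) = rng E (\<sigma> \<alpha>\<^sub>2 \<eta>)" using composable_E_iff[OF s(1,2)] \<pi>s c by simp
  note m = groupoid_mult[OF groupoid_E s(1,2) sr]
  have "\<pi> (gmult E (\<sigma> \<alpha>\<^sub>1 \<gamma>) (\<sigma> \<alpha>\<^sub>2 \<eta>)) = \<pi> (\<sigma> \<alpha> (gmult G \<gamma> \<eta>))"
    using \<pi>_mult[OF s(1,2) sr] \<pi>s by simp
  from quotient[OF m s(3) this]
  show "mult_phase \<alpha>\<^sub>1 \<alpha>\<^sub>2 \<alpha> (\<gamma>, \<eta>) \<in> circle"
    "gmult E (\<sigma> \<alpha>\<^sub>1 \<gamma>) (\<sigma> \<alpha>\<^sub>2 \<eta>) = act (mult_phase \<alpha>\<^sub>1 \<alpha>\<^sub>2 \<alpha> (\<gamma>, \<eta>)) (\<sigma> \<alpha> (gmult G \<gamma> \<eta>))"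
    by (simp_all add: mult_phase_def)
qed

text \<open>Near a given pair, the product is the action of three smooth phases on a section over the product in \<open>G\<close>.\<close>

lemma smooth_mult_E: "smooth_map CE N (\<lambda>(g, h). gmult E g h)"
proof (rule smooth_map_local[OF structure_CE structure_N])
  fix p0 assume "p0 \<in> topspace (mtop CE)"
  then have p0: "p0 \<in> composable E" "fst p0 \<in> arrows E" "snd p0 \<in> arrows E" "\<pi>\<pi> p0 \<in> composable G"
    unfolding topspace_CE by (auto simp: composable_E \<pi>\<pi>_def)
  have comp: "src G (\<pi> (fst p0)) = rng G (\<pi> (snd p0))" using p0(4) by (simp add: composable_def \<pi>\<pi>_def)
  obtain \<alpha>\<^sub>1 where \<alpha>\<^sub>1: "\<alpha>\<^sub>1 \<in> A" "\<pi> (fst p0) \<in> U \<alpha>\<^sub>1" using U_coverE[OF \<pi>_arrow[OF p0(2)]] .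
  obtain \<alpha>\<^sub>2 where \<alpha>\<^sub>2: "\<alpha>\<^sub>2 \<in> A" "\<pi> (snd p0) \<in> U \<alpha>\<^sub>2" using U_coverE[OF \<pi>_arrow[OF p0(3)]] .
  obtain \<alpha> where \<alpha>: "\<alpha> \<in> A" "gmult G (\<pi> (fst p0)) (\<pi> (snd p0)) \<in> U \<alpha>"
    using U_coverE[OF groupoid_mult[OF groupoid_G \<pi>_arrow[OF p0(2)] \<pi>_arrow[OF p0(3)] comp]] .
  let ?D = "mult_domain \<alpha>\<^sub>1 \<alpha>\<^sub>2 \<alpha>"
  note D = mult_domain_open[OF \<alpha>\<^sub>1(1) \<alpha>\<^sub>2(1) \<alpha>(1)]
  have \<pi>C: "smooth_map CE CG \<pi>\<pi>"
    by (rule smooth_into_CG[OF structure_CE smooth_map_compose[OF structure_CE structure_NN structure_MM smooth_CE smooth_\<pi>\<pi>]])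
      (auto simp: topspace_CE composable_E \<pi>\<pi>_def)
  define W where "W = composable E \<inter> \<pi>\<pi> -` ?D"
  have W: "openin (mtop CE) W" unfolding W_def using smooth_map_preimage_open[OF \<pi>C D] by (simp add: topspace_CE)
  note SW = smooth_structure_open_submanifold[OF structure_CE W]
  have WD: "fst p \<in> arrows E" "snd p \<in> arrows E" "\<pi> (fst p) \<in> U \<alpha>\<^sub>1" "\<pi> (snd p) \<in> U \<alpha>\<^sub>2"
      "gmult G (\<pi> (fst p)) (\<pi> (snd p)) \<in> U \<alpha>" "(\<pi> (fst p), \<pi> (snd p)) \<in> ?D" "src E (fst p) = rng E (snd p)" if "p \<in> W" for p
    using that by (auto simp: W_def mult_domain_def \<pi>\<pi>_def composable_def)
  have topW: "topspace (mtop (open_submanifold CE W)) = W" unfolding W_def by (auto simp: topspace_CE)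
  have f: "smooth_map (open_submanifold CE W) N fst" "smooth_map (open_submanifold CE W) N snd"
    using smooth_map_restrict[OF smooth_map_compose[OF structure_CE structure_NN structure_N smooth_CE smooth_map_fst[OF structure_N structure_N]]]
      smooth_map_restrict[OF smooth_map_compose[OF structure_CE structure_NN structure_N smooth_CE smooth_map_snd[OF structure_N structure_N]]] by simp_all
  have c1: "smooth_map (open_submanifold CE W) circle_manifold (\<lambda>p. phase \<alpha>\<^sub>1 (fst p))"
    by (rule smooth_map_compose_open[OF SW structure_N smooth_structure_circle over_open[OF U_open[OF \<alpha>\<^sub>1(1)]] f(1) _ smooth_phase[OF \<alpha>\<^sub>1(1)]])
      (use WD in \<open>simp only: topW over_iff\<close>)
  have c2: "smooth_map (open_submanifold CE W) circle_manifold (\<lambda>p. phase \<alpha>\<^sub>2 (snd p))"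
    by (rule smooth_map_compose_open[OF SW structure_N smooth_structure_circle over_open[OF U_open[OF \<alpha>\<^sub>2(1)]] f(2) _ smooth_phase[OF \<alpha>\<^sub>2(1)]])
      (use WD in \<open>simp only: topW over_iff\<close>)
  have m: "smooth_map (open_submanifold CE W) circle_manifold (\<lambda>p. mult_phase \<alpha>\<^sub>1 \<alpha>\<^sub>2 \<alpha> (\<pi>\<pi> p))"
    by (rule smooth_map_compose_open[OF SW structure_CG smooth_structure_circle D smooth_map_restrict[OF \<pi>C] _
          smooth_mult_phase[OF \<alpha>\<^sub>1(1) \<alpha>\<^sub>2(1) \<alpha>(1)]]) (use WD in \<open>simp only: topW \<pi>\<pi>_def\<close>)
  have "smooth_map (open_submanifold CE W) M (\<lambda>p. (\<lambda>(g, h). gmult G g h) (\<pi>\<pi> p))"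
    by (rule smooth_map_compose[OF SW structure_CG structure_M smooth_map_restrict[OF \<pi>C] smooth_mult_G])
  then have "smooth_map (open_submanifold CE W) M (\<lambda>p. gmult G (\<pi> (fst p)) (\<pi> (snd p)))" by (simp add: \<pi>\<pi>_def)
  from smooth_map_compose_open[OF SW structure_M structure_N U_open[OF \<alpha>(1)] this _ section_smooth[OF \<alpha>(1)]] WD(5)
  have s: "smooth_map (open_submanifold CE W) N (\<lambda>p. \<sigma> \<alpha> (gmult G (\<pi> (fst p)) (\<pi> (snd p))))" by (simp only: topW)
  have "smooth_map (open_submanifold CE W) N (\<lambda>p. act (phase \<alpha>\<^sub>1 (fst p)) (act (phase \<alpha>\<^sub>2 (snd p))
      (act (mult_phase \<alpha>\<^sub>1 \<alpha>\<^sub>2 \<alpha> (\<pi>\<pi> p)) (\<sigma> \<alpha> (gmult G (\<pi> (fst p)) (\<pi> (snd p)))))))"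
    by (rule smooth_act[OF SW c1 smooth_act[OF SW c2 smooth_act[OF SW m s]]])
  then have "smooth_map (open_submanifold CE W) N (\<lambda>(g, h). gmult E g h)"
  proof (rule smooth_map_cong[OF SW structure_N, rotated])
    fix p assume "p \<in> topspace (mtop (open_submanifold CE W))"
    then have p: "p \<in> W" by (simp only: topW)
    note d = WD[OF p]
    let ?e = "\<sigma> \<alpha>\<^sub>1 (\<pi> (fst p))" and ?f = "\<sigma> \<alpha>\<^sub>2 (\<pi> (snd p))"
    note s = section_arrow[OF \<alpha>\<^sub>1(1) d(3)] section_arrow[OF \<alpha>\<^sub>2(1) d(4)]
    note c = phase_circle[OF \<alpha>\<^sub>1(1) d(1,3)] phase_circle[OF \<alpha>\<^sub>2(1) d(2,4)]
    note sm = section_mult[OF \<alpha>\<^sub>1(1) \<alpha>\<^sub>2(1) \<alpha>(1) d(6)]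
    have "gmult E (fst p) (snd p) = gmult E (act (phase \<alpha>\<^sub>1 (fst p)) ?e) (act (phase \<alpha>\<^sub>2 (snd p)) ?f)"
      using act_phase[OF \<alpha>\<^sub>1(1) d(1,3)] act_phase[OF \<alpha>\<^sub>2(1) d(2,4)] by simp
    also have "\<dots> = act (phase \<alpha>\<^sub>1 (fst p)) (gmult E ?e (act (phase \<alpha>\<^sub>2 (snd p)) ?f))"
      using act_rng[OF c(2) s(2)] sm(1) by (intro act_mult_left[OF c(1) s(1) act_arrow[OF c(2) s(2)]]) simp
    also have "\<dots> = act (phase \<alpha>\<^sub>1 (fst p)) (act (phase \<alpha>\<^sub>2 (snd p)) (gmult E ?e ?f))"
      using act_mult_right[OF c(2) s sm(1)] by simp
    finally show "act (phase \<alpha>\<^sub>1 (fst p)) (act (phase \<alpha>\<^sub>2 (snd p))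
        (act (mult_phase \<alpha>\<^sub>1 \<alpha>\<^sub>2 \<alpha> (\<pi>\<pi> p)) (\<sigma> \<alpha> (gmult G (\<pi> (fst p)) (\<pi> (snd p)))))) = (case p of (g, h) \<Rightarrow> gmult E g h)"
      using sm(3) by (simp add: \<pi>\<pi>_def case_prod_beta)
  qed
  moreover have "p0 \<in> W" using p0 \<alpha>\<^sub>1 \<alpha>\<^sub>2 \<alpha> by (auto simp: W_def mult_domain_def \<pi>\<pi>_def)
  ultimately show "\<exists>W. openin (mtop CE) W \<and> p0 \<in> W \<and> smooth_map (open_submanifold CE W) N (\<lambda>(g, h). gmult E g h)"
    using W by blast
qed

text \<open>The product of \<open>\<sigma> \<alpha> \<gamma>\<close> and \<open>\<sigma> \<beta> (\<gamma>\<^sup>-\<^sup>1)\<close> is the unit at \<open>r(\<gamma>)\<close> up to the phase \<open>mult_phase * k\<close>, so rotating the second factor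
  back gives the inverse of the first.\<close>

lemma section_inv:
  assumes A: "\<alpha> \<in> A" "\<beta> \<in> A" "\<delta> \<in> A" and \<gamma>: "\<gamma> \<in> U \<alpha>" "ginv G \<gamma> \<in> U \<beta>" "rng G \<gamma> \<in> U \<delta>"
    and k: "k \<in> circle" "\<sigma> \<delta> (rng G \<gamma>) = act k (\<iota> (1, rng G \<gamma>))"
  shows "(\<gamma>, ginv G \<gamma>) \<in> mult_domain \<alpha> \<beta> \<delta>"
    and "ginv E (\<sigma> \<alpha> \<gamma>) = act (inverse (mult_phase \<alpha> \<beta> \<delta> (\<gamma>, ginv G \<gamma>) * k)) (\<sigma> \<beta> (ginv G \<gamma>))"
proof -
  have \<gamma>G: "\<gamma> \<in> arrows G" using \<gamma>(1) U_subset[OF A(1)] by blast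
  note i = groupoid_inv[OF groupoid_G \<gamma>G] groupoid_rng_inv[OF groupoid_G \<gamma>G] groupoid_right_inv[OF groupoid_G \<gamma>G]
  show D: "(\<gamma>, ginv G \<gamma>) \<in> mult_domain \<alpha> \<beta> \<delta>"
    using \<gamma> \<gamma>G i by (simp add: mult_domain_def composable_def)
  note sm = section_mult[OF A D]
  note s = section_arrow[OF A(1) \<gamma>(1)] section_arrow[OF A(2) \<gamma>(2)]
  define t where "t = mult_phase \<alpha> \<beta> \<delta> (\<gamma>, ginv G \<gamma>) * k"
  have t: "t \<in> circle" using sm(2) k(1) by (simp add: t_def norm_mult)
  have inv_circle: "inverse z \<in> circle" "z \<noteq> 0" if "z \<in> circle" for z :: complex
    using that by (auto simp: norm_inverse)
  note t' = inv_circle[OF t]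
  have r: "rng E (\<sigma> \<alpha> \<gamma>) = \<iota> (1, rng G \<gamma>)" using rng_E[OF s(1)] \<pi>_section[OF A(1) \<gamma>(1)] by simp
  have ra: "rng E (\<sigma> \<alpha> \<gamma>) \<in> arrows E" by (rule groupoid_unit_arrow[OF groupoid_E groupoid_rng[OF groupoid_E s(1)]])
  have "gmult E (\<sigma> \<alpha> \<gamma>) (\<sigma> \<beta> (ginv G \<gamma>)) = act t (rng E (\<sigma> \<alpha> \<gamma>))"
    using sm(3) k(2) act_act[OF sm(2) k(1) ra] by (simp add: i(3) r t_def)
  then have "gmult E (\<sigma> \<alpha> \<gamma>) (act (inverse t) (\<sigma> \<beta> (ginv G \<gamma>))) = rng E (\<sigma> \<alpha> \<gamma>)"
    using act_mult_right[OF t'(1) s sm(1)] act_act[OF t'(1) t ra] act_one[OF ra] t'(2) by simp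
  moreover have "src E (\<sigma> \<alpha> \<gamma>) = rng E (act (inverse t) (\<sigma> \<beta> (ginv G \<gamma>)))"
    using sm(1) act_rng[OF t'(1) s(2)] by simp
  ultimately have "ginv E (\<sigma> \<alpha> \<gamma>) = act (inverse t) (\<sigma> \<beta> (ginv G \<gamma>))"
    by (intro groupoid_inv_unique[OF groupoid_E s(1) act_arrow[OF t'(1) s(2)]])
  then show "ginv E (\<sigma> \<alpha> \<gamma>) = act (inverse (mult_phase \<alpha> \<beta> \<delta> (\<gamma>, ginv G \<gamma>) * k)) (\<sigma> \<beta> (ginv G \<gamma>))"
    by (simp only: t_def)
qed

lemma smooth_inv_E: "smooth_map N N (ginv E)"
proof (rule smooth_map_local[OF structure_N structure_N])
  fix e0 assume "e0 \<in> topspace (mtop N)"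
  then have e0: "e0 \<in> arrows E" by (simp add: top_N)
  note \<gamma>0 = \<pi>_arrow[OF e0]
  obtain \<alpha> where \<alpha>: "\<alpha> \<in> A" "\<pi> e0 \<in> U \<alpha>" using U_coverE[OF \<gamma>0] .
  obtain \<beta> where \<beta>: "\<beta> \<in> A" "ginv G (\<pi> e0) \<in> U \<beta>" using U_coverE[OF groupoid_inv[OF groupoid_G \<gamma>0]] .
  obtain \<delta> where \<delta>: "\<delta> \<in> A" "rng G (\<pi> e0) \<in> U \<delta>"
    using U_coverE[OF groupoid_unit_arrow[OF groupoid_G groupoid_rng[OF groupoid_G \<gamma>0]]] .
  obtain k where k: "smooth_map (open_submanifold M0 (U \<delta> \<inter> units G)) circle_manifold k"
    "\<And>x. x \<in> U \<delta> \<inter> units G \<Longrightarrow> k x \<in> circle" "\<And>x. x \<in> U \<delta> \<inter> units G \<Longrightarrow> \<sigma> \<delta> x = act (k x) (\<iota> (1, x))"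
    using unit_phase[OF \<delta>(1)] by blast
  let ?D = "mult_domain \<alpha> \<beta> \<delta>"
  \<comment> \<open>On \<open>B\<close> the sections \<open>\<sigma> \<alpha>\<close> at \<open>\<gamma>\<close>, \<open>\<sigma> \<beta>\<close> at its inverse and \<open>\<sigma> \<delta>\<close> at its range are all available.\<close>
  define B where "B = U \<alpha> \<inter> ((topspace (mtop M) \<inter> ginv G -` U \<beta>) \<inter> (topspace (mtop M) \<inter> rng G -` (U \<delta> \<inter> units G)))"
  have B: "openin (mtop M) B"
    unfolding B_def
    by (intro openin_Int U_open[OF \<alpha>(1)] smooth_map_preimage_open[OF smooth_inv_G U_open[OF \<beta>(1)]]
        smooth_map_preimage_open[OF smooth_rng U_units_open[OF \<delta>(1)]])
  have BD: "\<gamma> \<in> U \<alpha>" "ginv G \<gamma> \<in> U \<beta>" "rng G \<gamma> \<in> U \<delta> \<inter> units G" "\<gamma> \<in> arrows G" if "\<gamma> \<in> B" for \<gamma>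
    using that by (auto simp: B_def top_M)
  have kB: "k (rng G \<gamma>) \<in> circle" "\<sigma> \<delta> (rng G \<gamma>) = act (k (rng G \<gamma>)) (\<iota> (1, rng G \<gamma>))" if "\<gamma> \<in> B" for \<gamma>
    using k(2,3) BD(3)[OF that] by blast+
  have inv: "(\<gamma>, ginv G \<gamma>) \<in> ?D" "ginv E (\<sigma> \<alpha> \<gamma>) = act (inverse (mult_phase \<alpha> \<beta> \<delta> (\<gamma>, ginv G \<gamma>) * k (rng G \<gamma>))) (\<sigma> \<beta> (ginv G \<gamma>))"
    if "\<gamma> \<in> B" for \<gamma>
    using section_inv[OF \<alpha>(1) \<beta>(1) \<delta>(1) BD(1,2)[OF that] IntD1[OF BD(3)[OF that]] kB[OF that]] by blast+
  note SB = smooth_structure_open_submanifold[OF structure_M B]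
  have topB: "topspace (mtop (open_submanifold M B)) = B" unfolding B_def by (auto simp: top_M)
  have i: "smooth_map (open_submanifold M B) M (ginv G)" by (rule smooth_map_restrict[OF smooth_inv_G])
  have g: "smooth_map (open_submanifold M B) CG (\<lambda>\<gamma>. (\<gamma>, ginv G \<gamma>))"
    by (rule smooth_into_CG[OF SB smooth_map_pair[OF SB structure_M structure_M smooth_map_inclusion[OF structure_M] i]])
      (use inv(1) in \<open>force simp only: topB mult_domain_def\<close>)
  have m: "smooth_map (open_submanifold M B) circle_manifold (\<lambda>\<gamma>. mult_phase \<alpha> \<beta> \<delta> (\<gamma>, ginv G \<gamma>))"
    by (rule smooth_map_compose_open[OF SB structure_CG smooth_structure_circle mult_domain_open[OF \<alpha>(1) \<beta>(1) \<delta>(1)] g _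
          smooth_mult_phase[OF \<alpha>(1) \<beta>(1) \<delta>(1)]]) (use inv(1) in \<open>simp only: topB\<close>)
  have kr: "smooth_map (open_submanifold M B) circle_manifold (\<lambda>\<gamma>. k (rng G \<gamma>))"
    by (rule smooth_map_compose_open[OF SB structure_M0 smooth_structure_circle U_units_open[OF \<delta>(1)]
          smooth_map_restrict[OF smooth_rng] _ k(1)]) (use BD(3) in \<open>simp only: topB\<close>)
  have s: "smooth_map (open_submanifold M B) N (\<lambda>\<gamma>. \<sigma> \<beta> (ginv G \<gamma>))"
    by (rule smooth_map_compose_open[OF SB structure_M structure_N U_open[OF \<beta>(1)] i _ section_smooth[OF \<beta>(1)]])
      (use BD(2) in \<open>simp only: topB\<close>)
  have si: "smooth_map (open_submanifold M B) N (\<lambda>\<gamma>. ginv E (\<sigma> \<alpha> \<gamma>))"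
    by (rule smooth_map_cong[OF SB structure_N _ smooth_act[OF SB smooth_map_circle_inverse[OF SB smooth_map_circle_mult[OF SB m kr]] s]])
      (use inv(2) in \<open>simp only: topB\<close>)
  let ?W = "over B"
  note W = over_open[OF B] and SW = smooth_structure_open_submanifold[OF structure_N over_open[OF B]]
  have c: "smooth_map (open_submanifold N ?W) circle_manifold (phase \<alpha>)"
    by (rule smooth_map_restrict_mono[OF smooth_phase[OF \<alpha>(1)]]) (use BD(1) in auto)
  have "smooth_map (open_submanifold N ?W) N (\<lambda>e. ginv E (\<sigma> \<alpha> (\<pi> e)))"
    by (rule smooth_map_compose_open[OF SW structure_M structure_N B smooth_map_restrict[OF smooth_\<pi>] _ si]) simp
  from smooth_act[OF SW smooth_map_circle_inverse[OF SW c] this]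
  have "smooth_map (open_submanifold N ?W) N (ginv E)"
  proof (rule smooth_map_cong[OF SW structure_N, rotated])
    fix e assume "e \<in> topspace (mtop (open_submanifold N ?W))"
    then have e: "e \<in> arrows E" "\<pi> e \<in> U \<alpha>" using BD(1) by auto
    show "act (inverse (phase \<alpha> e)) (ginv E (\<sigma> \<alpha> (\<pi> e))) = ginv E e"
      using act_inv[OF phase_circle[OF \<alpha>(1) e] section_arrow[OF \<alpha>(1) e(2)]] act_phase[OF \<alpha>(1) e] by simp
  qed
  moreover have "e0 \<in> ?W" using e0 \<alpha> \<beta> \<delta> \<gamma>0 rng_\<pi>[OF e0] by (simp add: B_def top_M)
  ultimately show "\<exists>W. openin (mtop N) W \<and> e0 \<in> W \<and> smooth_map (open_submanifold N W) N (ginv E)"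
    using W by blast
qed

lemma lie_groupoid_E: "lie_groupoid E N N0"
  unfolding lie_groupoid_def
proof (intro conjI)
  show "topological_groupoid E" using twist by (simp add: topological_twist_def)
  show "smooth_manifold N" using principal_bundle by (simp add: smooth_principal_circle_bundle_def)
qed (fact top_N manifold_N0 top_N0 smooth_embedding_units submersion_rng_src embedded_composable_E smooth_mult_E smooth_inv_E)+

lemma lie_twist_E: "lie_twist G M M0 E N \<iota> \<pi>"
  unfolding lie_twist_def using lie twist lie_groupoid_E submersion_\<pi> smooth_\<iota> by blast

end

section \<open>The twist is a Lie twist\<close>

theorem theorem4p21:
  fixes G :: "'g groupoid" and M M0 :: "'g manifold"
    and E :: "'e groupoid" and N :: "'e manifold"
    and \<iota> :: "complex \<times> 'g \<Rightarrow> 'e" and \<pi> :: "'e \<Rightarrow> 'g"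
    and A :: "'i set" and U :: "'i \<Rightarrow> 'g set" and \<phi> :: "'i \<Rightarrow> 'g \<Rightarrow> nat \<Rightarrow> real"
    and \<sigma> :: "'i \<Rightarrow> 'g \<Rightarrow> 'e"
  assumes "lie_groupoid G M M0"
    and "topological_twist G E \<iota> \<pi>"
    and "smooth_atlas_of M A U \<phi>"
    and "\<And>\<alpha>. \<alpha> \<in> A \<Longrightarrow> continuous_section G E \<pi> (U \<alpha>) (\<sigma> \<alpha>)"
    and "S_smooth G M M0 E \<iota> A U \<sigma>"
    and "U_smooth G M0 \<iota> A U \<sigma>"
    and "M_smooth G M M0 E \<iota> A U \<sigma>"
    and "mtop N = gtop E"
    and "smooth_principal_circle_bundle N M (twist_action E \<iota> \<pi>) \<pi>"
    and "\<And>\<alpha>. \<alpha> \<in> A \<Longrightarrow> smooth_map (open_submanifold M (U \<alpha>)) N (\<sigma> \<alpha>)"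
  shows "lie_groupoid E N (twist_unit_manifold E \<pi> M0) \<and> lie_twist G M M0 E N \<iota> \<pi>"
proof -
  have M: "smooth_structure M"
    using assms(1) smooth_manifold_structure by (auto simp: lie_groupoid_def)
  have atlas: "openin (mtop M) (U \<alpha>)" if "\<alpha> \<in> A" for \<alpha>
    using assms(3) that chart_open[OF structure_chart[OF M]] by (auto simp: smooth_atlas_of_def)
  interpret smooth_twist G E \<iota> \<pi> M M0 N A U \<sigma>
  proof unfold_locales
    show "topological_twist G E \<iota> \<pi>" by fact
    show "(\<Union>\<alpha>\<in>A. U \<alpha>) = topspace (mtop M)" using assms(3) by (simp add: smooth_atlas_of_def)
    show "\<pi> (\<sigma> \<alpha> \<gamma>) = \<gamma>" if "\<alpha> \<in> A" "\<gamma> \<in> U \<alpha>" for \<alpha> \<gamma>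
      using assms(4)[OF that(1)] that(2) by (simp add: continuous_section_def)
  qed (use assms atlas in auto)
  show ?thesis using lie_groupoid_E lie_twist_E by blast
qed

end
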